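(* Let $K$ be an algebraically closed field, and let $F,G\in K[X]$ have degrees $m,n$, where $m,n>1$ and $\mathrm{char}(K)\nmid mn$. Then the following are equivalent: (a) the semigroup generated by $F$ and $G$ under composition is not the free semigroup on the letters $F$ and $G$; (b) there is a root of unity $\gamma\in K^*$ for which the semigroup generated by $F$ and $G$ under composition is isomorphic to the semigroup generated by $X^m$ and $\gamma X^n$ under composition, via an isomorphism which maps $F$ and $G$ to $X^m$ and $\gamma X^n$, respectively; (c) there is a degree-one polynomial $L(X)\in K[X]$ for which $L^{\langle -1\rangle}\circ F\circ L$ and $L^{\langle -1\rangle}\circ G\circ L$ are, respectively, one of the following: (c1) $X^m$ and $\alpha X^n$, where $\alpha\in K^*$ is a root of unity; (c2) $\alpha T_m(X)$ and $\beta T_n(X)$, where $\alpha,\beta\in\{1,-1\}$; (c3) $\alpha H^{\langle i\rangle}(X)$ and $\beta H^{\langle j\rangle}(X)$, where $i,j>0$ are integers, $H(X)=X^rC(X^s)$ for some $C(X)\in K[X]$ and some integers $s>0$ and $r\ge 0$, and $\alpha,\beta\in K^*$ satisfy $\alpha^s=\beta^s=1$.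
   Context: For a polynomial $H$, $H^{\langle i\rangle}$ denotes the $i$-th iterate of $H$ under composition; for a degree-one polynomial $L$, $L^{\langle -1\rangle}$ denotes the inverse of $L$ under composition. For a positive integer $m$, $T_m(X)$ denotes the normalized Chebyshev polynomial, i.e. the unique polynomial in $K[X]$ satisfying $T_m(X+X^{-1})=X^m+X^{-m}$. The semigroup generated by $F$ and $G$ under composition consists of all compositions of one or more copies of $F$ and $G$. It "is the free semigroup on the letters $F$ and $G$" if distinct nonempty words in the two letters $F,G$ always give distinct compositions (so it is not free exactly when two distinct words in the letters give the same composition). When $\mathrm{char}(K)=0$, the condition $\mathrm{char}(K)\nmid mn$ is automatically satisfied. *)

theory Defs
  imports "HOL-Computational_Algebra.Computational_Algebra"
begin

definition comp_pow :: "'a::comm_semiring_1 poly \<Rightarrow> nat \<Rightarrow> 'a poly" where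
  "comp_pow H i = (pcompose H ^^ i) [:0, 1:]"

definition comp_inv :: "'a::comm_semiring_1 poly \<Rightarrow> 'a poly" where
  "comp_inv L = (THE M. L \<circ>\<^sub>p M = [:0, 1:] \<and> M \<circ>\<^sub>p L = [:0, 1:])"

lemma pcompose_X_left: "[:0, 1:] \<circ>\<^sub>p P = (P :: 'a::comm_semiring_1 poly)"
  by (simp add: pcompose_pCons)

lemma comp_inv_unique:
  fixes L M :: "'a::comm_semiring_1 poly"
  assumes "L \<circ>\<^sub>p M = [:0, 1:]" "M \<circ>\<^sub>p L = [:0, 1:]"
  shows "comp_inv L = M"
  unfolding comp_inv_def
proof (rule the_equality)
  fix N assume N: "L \<circ>\<^sub>p N = [:0, 1:] \<and> N \<circ>\<^sub>p L = [:0, 1:]"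
  have "N = (N \<circ>\<^sub>p L) \<circ>\<^sub>p M"
    using assms by (simp flip: pcompose_assoc)
  with N show "N = M" by (simp add: pcompose_X_left)
qed (use assms in blast)

lemma comp_inv_linear:
  fixes a b :: "'a::field"
  assumes "a \<noteq> 0"
  shows "comp_inv [:b, a:] = [:- b / a, 1 / a:]"
  using assms by (intro comp_inv_unique) (simp_all add: pcompose_pCons)

lemma comp_inv_degree_1:
  fixes L :: "'a::field poly"
  assumes "degree L = 1"
  shows "L \<circ>\<^sub>p comp_inv L = [:0, 1:]" "comp_inv L \<circ>\<^sub>p L = [:0, 1:]"
proof -
  obtain a b where "L = [:b, a:]" "a \<noteq> 0"
    using assms by (cases L; cases "tl (coeffs L)") (auto split: if_splits elim!: degree_eq_zeroE)
  then show "L \<circ>\<^sub>p comp_inv L = [:0, 1:]" "comp_inv L \<circ>\<^sub>p L = [:0, 1:]"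
    by (simp_all add: comp_inv_linear pcompose_pCons)
qed

datatype letter = LetterF | LetterG

text \<open>The word \<open>[w\<^sub>1, \<dots>, w\<^sub>k]\<close> denotes \<open>w\<^sub>1 \<circ> \<dots> \<circ> w\<^sub>k\<close>. The empty word, which would denote
  \<open>X\<close>, is excluded below: these are semigroups, not monoids.\<close>

definition comp_word :: "'a::comm_semiring_1 poly \<Rightarrow> 'a poly \<Rightarrow> letter list \<Rightarrow> 'a poly" where
  "comp_word F G w =
     foldr (\<lambda>l P. (case l of LetterF \<Rightarrow> F | LetterG \<Rightarrow> G) \<circ>\<^sub>p P) w [:0, 1:]"

definition comp_semigroup :: "'a::comm_semiring_1 poly \<Rightarrow> 'a poly \<Rightarrow> 'a poly set" where
  "comp_semigroup F G = comp_word F G ` {w. w \<noteq> []}"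

definition free_on_letters :: "'a::comm_semiring_1 poly \<Rightarrow> 'a poly \<Rightarrow> bool" where
  "free_on_letters F G \<longleftrightarrow> inj_on (comp_word F G) {w. w \<noteq> []}"

definition comp_semigroup_iso ::
  "('a::comm_semiring_1 poly \<Rightarrow> 'a poly) \<Rightarrow> 'a poly set \<Rightarrow> 'a poly set \<Rightarrow> bool" where
  "comp_semigroup_iso \<phi> S T \<longleftrightarrow>
     bij_betw \<phi> S T \<and> (\<forall>P\<in>S. \<forall>Q\<in>S. \<phi> (P \<circ>\<^sub>p Q) = \<phi> P \<circ>\<^sub>p \<phi> Q)"

lemma comp_word_append:
  "comp_word F G (v @ w) = comp_word F G v \<circ>\<^sub>p comp_word F G w"
  unfolding comp_word_def
  by (induction v) (simp_all add: pcompose_X_left pcompose_assoc)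

lemma comp_semigroup_closed:
  assumes "P \<in> comp_semigroup F G" "Q \<in> comp_semigroup F G"
  shows "P \<circ>\<^sub>p Q \<in> comp_semigroup F G"
proof -
  obtain v w where "v \<noteq> []" "P = comp_word F G v" "Q = comp_word F G w"
    using assms by (auto simp: comp_semigroup_def)
  then have "P \<circ>\<^sub>p Q = comp_word F G (v @ w)" "v @ w \<noteq> []"
    by (simp_all add: comp_word_append)
  then show ?thesis by (auto simp: comp_semigroup_def)
qed

definition is_root_of_unity :: "'a::monoid_mult \<Rightarrow> bool" where
  "is_root_of_unity x \<longleftrightarrow> (\<exists>k>0. x ^ k = 1)"

text \<open>The identity \<open>T(X + X\<^sup>-\<^sup>1) = X\<^sup>m + X\<^sup>-\<^sup>m\<close> is stated in the field \<open>K(X)\<close> of rational functions.\<close>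

definition fract_X :: "'a::field poly fract" where
  "fract_X = to_fract [:0, 1:]"

definition poly_at_fract :: "'a::field poly \<Rightarrow> 'a poly fract \<Rightarrow> 'a poly fract" where
  "poly_at_fract P z = poly (map_poly (\<lambda>c. to_fract [:c:]) P) z"

definition is_chebyshev :: "nat \<Rightarrow> 'a::field poly \<Rightarrow> bool" where
  "is_chebyshev m P \<longleftrightarrow>
     poly_at_fract P (fract_X + inverse fract_X) = fract_X ^ m + inverse fract_X ^ m"

definition chebyshev :: "nat \<Rightarrow> 'a::field poly" where
  "chebyshev m = (THE P. is_chebyshev m P)"

lemma fract_X_nonzero: "fract_X \<noteq> 0"
  by (simp add: fract_X_def)

lemma poly_at_fract_0: "poly_at_fract 0 z = 0"
  by (simp add: poly_at_fract_def)

lemma poly_at_fract_pCons: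
  "poly_at_fract (pCons c P) z = to_fract [:c:] + z * poly_at_fract P z"
  by (simp add: poly_at_fract_def map_poly_pCons)

lemma poly_at_fract_1: "poly_at_fract 1 z = 1"
  by (simp add: poly_at_fract_def flip: one_pCons)

lemma poly_at_fract_diff:
  "poly_at_fract (P - Q) z = poly_at_fract P z - poly_at_fract Q z"
proof (induction P Q rule: poly_induct2)
  case (pCons a p b q)
  have "to_fract [:a - b:] = to_fract [:a:] - to_fract [:b:]"
    by (metis diff_pCons diff_zero to_fract_diff)
  then show ?case
    by (simp only: diff_pCons poly_at_fract_pCons pCons right_diff_distrib add_diff_add)
qed (simp add: poly_at_fract_0)

text \<open>Clearing denominators in \<open>P(X + X\<^sup>-\<^sup>1)\<close> gives a polynomial whose constant term is the leading
  coefficient of \<open>P\<close>.\<close>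

lemma poly_at_fract_clear_denominators:
  "\<exists>Q. to_fract Q = fract_X ^ degree P * poly_at_fract P (fract_X + inverse fract_X)
     \<and> poly Q 0 = lead_coeff P"
proof (induction P)
  case 0
  show ?case by (auto simp: poly_at_fract_0 intro!: exI[of _ 0])
next
  case (pCons c P)
  show ?case
  proof (cases "P = 0")
    case True
    then show ?thesis
      by (intro exI[of _ "[:c:]"]) (simp add: poly_at_fract_pCons poly_at_fract_0)
  next
    case False
    obtain Q where Q:
      "to_fract Q = fract_X ^ degree P * poly_at_fract P (fract_X + inverse fract_X)"
      "poly Q 0 = lead_coeff P"
      using pCons.IH by blast
    let ?X = "[:0, 1:] :: 'a poly"
    let ?R = "?X ^ Suc (degree P) * [:c:] + (?X ^ 2 + 1) * Q"
    have pow: "to_fract (?X ^ k) = fract_X ^ k" for k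
      by (induction k) (simp_all add: fract_X_def del: mult_pCons_left)
    have "fract_X * (fract_X + inverse fract_X) = (fract_X ^ 2 + 1 :: 'a poly fract)"
      using fract_X_nonzero[where 'a = 'a] by (simp add: field_simps power2_eq_square)
    then have "(fract_X ^ 2 + 1) * to_fract Q = fract_X ^ Suc (degree P) *
        ((fract_X + inverse fract_X) * poly_at_fract P (fract_X + inverse fract_X))"
      unfolding Q(1) by (metis (no_types, lifting) mult.assoc mult.left_commute power_Suc)
    moreover have "to_fract ?R =
        fract_X ^ Suc (degree P) * to_fract [:c:] + (fract_X ^ 2 + 1) * to_fract Q"
      by (simp only: to_fract_add to_fract_mult pow to_fract_1)
    ultimately have "to_fract ?R = fract_X ^ degree (pCons c P) *
        poly_at_fract (pCons c P) (fract_X + inverse fract_X)"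
      using False by (simp add: poly_at_fract_pCons distrib_left del: power_Suc)
    moreover have "poly ?R 0 = lead_coeff (pCons c P)"
      using Q(2) False by simp
    ultimately show ?thesis by blast
  qed
qed

lemma is_chebyshev_unique:
  assumes "is_chebyshev m P" "is_chebyshev m Q"
  shows "P = Q"
proof -
  have "poly_at_fract (P - Q) (fract_X + inverse fract_X) = 0"
    using assms by (simp add: is_chebyshev_def poly_at_fract_diff)
  with poly_at_fract_clear_denominators[of "P - Q"]
  have "lead_coeff (P - Q) = 0" by auto
  then show ?thesis by (simp only: leading_coeff_0_iff right_minus_eq)
qed

lemma is_chebyshev_exists: "\<exists>P :: 'a::field poly. is_chebyshev m P"
proof (induction m rule: induct_nat_012)
  case 0
  have "to_fract [:2 :: 'a:] = 1 + 1"
    by (metis numeral_poly one_add_one to_fract_1 to_fract_add)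
  then have "is_chebyshev 0 [:2 :: 'a:]"
    by (simp add: is_chebyshev_def poly_at_fract_pCons poly_at_fract_0)
  then show ?case by blast
next
  case 1
  have "is_chebyshev (Suc 0) [:0, 1 :: 'a:]"
    by (simp add: is_chebyshev_def poly_at_fract_1 poly_at_fract_pCons pCons_one)
  then show ?case by blast
next
  case (ge2 n)
  then obtain P Q :: "'a poly" where "is_chebyshev n P" "is_chebyshev (Suc n) Q"
    by blast
  then have "is_chebyshev (Suc (Suc n)) (pCons 0 Q - P)"
    using fract_X_nonzero[where 'a = 'a]
    by (simp add: is_chebyshev_def poly_at_fract_pCons poly_at_fract_diff field_simps)
  then show ?case by blast
qed

lemma is_chebyshev_chebyshev: "is_chebyshev m (chebyshev m)"
  unfolding chebyshev_def
  by (rule theI') (use is_chebyshev_exists is_chebyshev_unique in blast)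

end

theory Submission
  imports Defs "HOL-Analysis.Kronecker_Approximation_Theorem"
begin

text \<open>
  Everything takes place in the field of Laurent series in a parameter \<open>t\<close> at infinity. Write
  \<open>P(x)\<close> for the value \<open>ev x P\<close> of a polynomial at a series, \<open>f(z t\<^sup>M)\<close> for
  \<open>power_subst z M f\<close>, and \<open>\<theta> = - t d/dt\<close> for the derivation \<open>euler\<close>, which is normalised so that
  \<open>\<theta>(t\<^sup>-\<^sup>d) = d t\<^sup>-\<^sup>d\<close>. The predicate \<open>ord_ge k f\<close> says that \<open>f\<close> vanishes to order at least \<open>k\<close>.

  A polynomial \<open>F\<close> of degree \<open>m > 1\<close> with \<open>m \<noteq> 0\<close> in the field has a Boettcher coordinate: a series \<open>x\<close>
  with a simple pole and \<open>F(x) = x(t\<^sup>m)\<close> (\<open>Boettcher_exists\<close>). If two distinct words agree, then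
  cancelling on the right gives \<open>A \<circ> F = B \<circ> G\<close> for words \<open>A, B\<close>. If \<open>G(x)\<close> were \<open>x(\<gamma> t\<^sup>n)\<close> times
  \<open>1 + c t\<^sup>k + \<dots>\<close> with \<open>c \<noteq> 0\<close>, then every word ending in \<open>G\<close> would have relative error of exact order
  \<open>k\<close>, and every word ending in \<open>F\<close> a later one. So \<open>G(x) = x(\<gamma> t\<^sup>n)\<close> (\<open>common_Boettcher\<close>): one
  coordinate serves both polynomials. A linear change of variable makes
  \<open>x = t\<^sup>-\<^sup>1 + a t + \<dots>\<close>. Say that \<open>P\<close> scales \<open>x\<close> if \<open>P(x) = x(z t\<^sup>M)\<close>; such polynomials compose by
  the same rule as monomials, and \<open>F\<close> and \<open>G\<close> are two of them. There are three cases.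

  If \<open>x = t\<^sup>-\<^sup>1\<close>, then \<open>F\<close> and \<open>G\<close> are monomials, and the relation makes \<open>\<gamma>\<close> a root of unity.

  If \<open>x \<noteq> t\<^sup>-\<^sup>1\<close> and some power of \<open>m\<close> is a power of \<open>n\<close>, the scaling polynomials admit exact division with
  respect to composition, and an element \<open>H\<close> of least degree plays the role of a greatest common divisor
  (\<open>scales_common_root\<close>). The linear polynomials \<open>\<alpha> X\<close> that scale \<open>x\<close> have \<open>\<alpha>\<close> a root of unity, and
  commuting with them forces the exponents of \<open>H\<close> into one residue class
  (\<open>iterates_of_commensurable_degrees\<close>).

  Otherwise the degrees are multiplicatively independent, and Dirichlet approximation yields scaling
  polynomials \<open>A, B\<close> of degrees \<open>M < N\<close> for which \<open>N - M\<close> is as small a fraction of \<open>M\<close> as desired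
  (\<open>close_pairs_of_independent_degrees\<close>). Up to very small errors, \<open>A(x)\<close> and \<open>B(x)\<close> depend only on the leading
  coefficients of \<open>x\<close>. Eliminating between them gives a polynomial of small degree with an extremely good
  approximation property. Such an approximation is first turned into an exact polynomial identity (a polynomial
  whose value at \<open>x\<close> has positive order is zero), then reduced by a divisibility argument of the form
  \<open>B \<circ> F dvd S\<close>, which bounds \<open>degree B\<close>. Away from characteristic two the
  outcome is the Pell equation \<open>m\<^sup>2 (F\<^sup>2 - 4 a) = F'\<^sup>2 (X\<^sup>2 - 4 a)\<close> (\<open>conic_equation_char_0\<close>,
  \<open>conic_equation_char_p\<close>). In characteristic two it is an Artin-Schreier analogue
  (\<open>artin_schreier_equation\<close>). Substituting \<open>X = b (v + v\<^sup>-\<^sup>1)\<close> turns either equation into a statement about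
  units of the ring of Laurent polynomials in \<open>v\<close>; the units are monomials, and this gives Chebyshev
  polynomials (\<open>chebyshev_of_pell_equation\<close>, \<open>chebyshev_of_artin_schreier_equation\<close>).

  Conversely, in each standard form words multiply like words in \<open>\<alpha> X\<^sup>m\<close> and \<open>\<beta> X\<^sup>n\<close>
  (\<open>same_relations_of_semigroup_family\<close>), and rescaling makes \<open>\<alpha> = 1\<close>. Since \<open>\<gamma>\<close> is a root of unity, words
  of length \<open>l\<close> in \<open>X\<^sup>m\<close> and \<open>\<gamma> X\<^sup>n\<close> take only \<open>O(l)\<close> values while there are \<open>2\<^sup>l\<close> words, so two of
  them agree (\<open>not_free_monomials\<close>).
\<close>

unbundle fps_syntax

section \<open>Laurent series: substitution, order, and evaluation of polynomials\<close>

text \<open>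
  The substitution \<open>t \<mapsto> z t\<^sup>M\<close>, a ring homomorphism for \<open>z \<noteq> 0\<close> and \<open>M > 0\<close>.
\<close>

definition power_subst :: "'a::field \<Rightarrow> nat \<Rightarrow> 'a fls \<Rightarrow> 'a fls" where
  "power_subst z M f = fls_compose_power (fls_compose_fps f (fps_const z * fps_X)) M"

definition ord_ge :: "int \<Rightarrow> 'a::zero fls \<Rightarrow> bool" where
  "ord_ge k f \<longleftrightarrow> (\<forall>i<k. f $$ i = 0)"

definition ev :: "'a::field fls \<Rightarrow> 'a poly \<Rightarrow> 'a fls" where
  "ev x P = poly (map_poly fls_const P) x"

definition euler :: "'a::field fls \<Rightarrow> 'a fls" where
  "euler f = - (fls_X * fls_deriv f)"

lemma power_subst_nth:
  assumes "z \<noteq> 0" "M > 0"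
  shows "power_subst z M f $$ i = (if int M dvd i then z powi (i div int M) * f $$ (i div int M) else 0)"
  using assms by (simp add: power_subst_def fls_nth_compose_power fls_nth_fls_compose_fps_linear)

context
  fixes z :: "'a::field" and M :: nat
  assumes z: "z \<noteq> 0" and M: "M > 0"
begin

lemma power_subst_add: "power_subst z M (f + g) = power_subst z M f + power_subst z M g"
  by (intro fls_eqI) (simp add: power_subst_nth z M algebra_simps)

lemma power_subst_diff: "power_subst z M (f - g) = power_subst z M f - power_subst z M g"
  by (intro fls_eqI) (simp add: power_subst_nth z M algebra_simps)

lemma power_subst_const: "power_subst z M (fls_const c) = fls_const c"
  by (simp add: power_subst_def M)

lemma power_subst_0: "power_subst z M 0 = 0"
  by (simp add: power_subst_def M)

lemma power_subst_1: "power_subst z M 1 = 1"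
  by (simp add: power_subst_def M)

lemma power_subst_mult: "power_subst z M (f * g) = power_subst z M f * power_subst z M g"
  by (simp add: power_subst_def fls_compose_fps_mult z)

lemma power_subst_power: "power_subst z M (f ^ n) = power_subst z M f ^ n"
  by (induction n) (simp_all add: power_subst_1 power_subst_mult)

lemma power_subst_eq_0_iff: "power_subst z M f = 0 \<longleftrightarrow> f = 0"
proof
  assume *: "power_subst z M f = 0"
  show "f = 0"
  proof (intro fls_eqI)
    fix i
    have "power_subst z M f $$ (int M * i) = 0" using * by simp
    then show "f $$ i = 0 $$ i" using z M by (simp add: power_subst_nth)
  qed
qed (simp add: power_subst_0)

lemma power_subst_cancel: "power_subst z M f = power_subst z M g \<longleftrightarrow> f = g"
  using power_subst_eq_0_iff[of "f - g"] by (simp add: power_subst_diff)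

lemma power_subst_inverse: "power_subst z M (inverse f) = inverse (power_subst z M f)"
proof (cases "f = 0")
  case False
  then have "power_subst z M (inverse f) * power_subst z M f = 1"
    by (simp flip: power_subst_mult add: power_subst_1)
  then show ?thesis using False
    by (metis inverse_unique inverse_inverse_eq)
qed (simp add: power_subst_0)

lemma power_subst_divide: "power_subst z M (f / g) = power_subst z M f / power_subst z M g"
  by (simp add: divide_inverse power_subst_mult power_subst_inverse)

lemma power_subst_X_inv: "power_subst z M fls_X_inv = fls_const (inverse z) * fls_X_inv ^ M"
proof (intro fls_eqI)
  fix i
  have neg: "- int M div int M = -1"
    using M nonzero_mult_div_cancel_left[of "int M" "-1"] by simp
  show "power_subst z M fls_X_inv $$ i = (fls_const (inverse z) * fls_X_inv ^ M) $$ i"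
  proof (cases "i = - int M")
    case True
    then show ?thesis
      by (simp add: power_subst_nth z M fls_X_inv_power_conv_shift_1 neg)
  next
    case False
    then have "\<not> (int M dvd i \<and> i div int M = -1)"
      by (metis dvd_mult_div_cancel mult_minus1_right)
    then show ?thesis using False
      by (auto simp: power_subst_nth z M fls_X_inv_power_conv_shift_1)
  qed
qed

lemma ord_ge_power_subst:
  assumes "ord_ge k f" shows "ord_ge (int M * k) (power_subst z M f)"
  unfolding ord_ge_def
proof safe
  fix i assume i: "i < int M * k"
  show "power_subst z M f $$ i = 0"
  proof (cases "int M dvd i")
    case True
    then obtain j where j: "i = int M * j" by blast
    with i have "j < k" using M by simp
    then show ?thesis using assms M z j by (simp add: power_subst_nth ord_ge_def)
  qed (simp add: power_subst_nth z M)
qed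

lemma euler_power_subst: "euler (power_subst z M f) = of_nat M * power_subst z M (euler f)"
proof (intro fls_eqI)
  fix i
  have e: "euler g $$ j = - (of_int j * g $$ j)" for g :: "'a fls" and j
    by (simp add: euler_def fls_X_times_conv_shift)
  have m: "(of_nat M * g) $$ j = of_nat M * g $$ j" for g :: "'a fls" and j
    by (metis fls_const_mult_const fls_mult_const_nth(1) fls_of_nat)
  show "euler (power_subst z M f) $$ i = (of_nat M * power_subst z M (euler f)) $$ i"
    by (auto simp: e m power_subst_nth z M elim!: dvdE)
qed

end

lemma power_subst_power_subst:
  assumes "z \<noteq> 0" "M > 0" "y \<noteq> 0" "N > 0"
  shows "power_subst z M (power_subst y N f) = power_subst (y * z ^ N) (M * N) f"
proof (intro fls_eqI)
  fix i
  show "power_subst z M (power_subst y N f) $$ i = power_subst (y * z ^ N) (M * N) f $$ i"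
  proof (cases "int M dvd i")
    case True
    then obtain j where j: "i = int M * j" by blast
    show ?thesis
    proof (cases "int N dvd j")
      case True
      then obtain l where l: "j = int N * l" by blast
      have "z powi (int N * l) = (z ^ N) powi l"
        by (simp add: power_int_mult)
      then show ?thesis using assms
        by (simp add: power_subst_nth j l power_int_mult_distrib)
    next
      case False
      then show ?thesis using assms by (simp add: power_subst_nth j)
    qed
  next
    case False
    then have "\<not> int (M * N) dvd i" by auto
    then show ?thesis using assms False by (simp add: power_subst_nth)
  qed
qed

lemma ord_ge_0 [simp]: "ord_ge k 0"
  by (simp add: ord_ge_def)

lemma ord_ge_iff_subdegree: "ord_ge k f \<longleftrightarrow> f = 0 \<or> k \<le> fls_subdegree f"
proof (cases "f = 0")
  case False
  then show ?thesis
    by (metis fls_eq0_below_subdegree less_le_trans linorder_not_less nth_fls_subdegree_zero_iff ord_ge_def)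
qed simp

lemma ord_ge_mono: "ord_ge k f \<Longrightarrow> j \<le> k \<Longrightarrow> ord_ge j f"
  by (auto simp: ord_ge_def)

lemma ord_ge_add: "ord_ge k f \<Longrightarrow> ord_ge k g \<Longrightarrow> ord_ge k (f + g :: 'a::group_add fls)"
  by (auto simp: ord_ge_def)

lemma ord_ge_diff: "ord_ge k f \<Longrightarrow> ord_ge k g \<Longrightarrow> ord_ge k (f - g :: 'a::group_add fls)"
  by (auto simp: ord_ge_def)

lemma ord_ge_uminus: "ord_ge k f \<Longrightarrow> ord_ge k (- f :: 'a::group_add fls)"
  by (auto simp: ord_ge_def)

lemma ord_ge_mult:
  fixes f g :: "'a::field fls"
  assumes "ord_ge j f" "ord_ge k g" shows "ord_ge (j + k) (f * g)"
  using assms by (cases "f = 0 \<or> g = 0") (auto simp: ord_ge_iff_subdegree)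

lemma ord_ge_const [simp]: "k \<le> 0 \<Longrightarrow> ord_ge k (fls_const c)"
  by (auto simp: ord_ge_def)

lemma ord_ge_1 [simp]: "k \<le> 0 \<Longrightarrow> ord_ge k (1 :: 'a::zero_neq_one fls)"
  by (auto simp: ord_ge_def)

lemma ord_ge_power:
  fixes f :: "'a::field fls"
  assumes "ord_ge k f" shows "ord_ge (int n * k) (f ^ n)"
  by (induction n) (auto simp: algebra_simps intro!: ord_ge_mult assms)

lemma ord_ge_cmult: "ord_ge k f \<Longrightarrow> ord_ge k (fls_const c * f :: 'a::field fls)"
  by (simp add: ord_ge_def)

lemma fls_of_nat_mult_nth: "(of_nat n * f :: 'a::field fls) $$ i = of_nat n * f $$ i"
  by (metis fls_mult_const_nth(1) fls_of_nat)

lemma ord_ge_of_nat_mult: "ord_ge k f \<Longrightarrow> ord_ge k (of_nat n * f :: 'a::field fls)"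
  by (simp add: ord_ge_def fls_of_nat_mult_nth)

lemma ord_ge_cancel:
  fixes f g :: "'a::field fls"
  assumes "ord_ge k (f * g)" "f \<noteq> 0" shows "ord_ge (k - fls_subdegree f) g"
  using assms by (cases "g = 0") (auto simp: ord_ge_iff_subdegree)

lemma ord_ge_of_nat [simp]: "k \<le> 0 \<Longrightarrow> ord_ge k (of_nat n :: 'a::field fls)"
  using ord_ge_of_nat_mult[of k 1 n] by simp

lemma ord_ge_X_inv: "ord_ge (-1) fls_X_inv"
  by (simp add: ord_ge_def)

lemma ord_ge_prime_power_cancel:
  fixes f :: "'a::field fls"
  assumes "ord_ge k (f ^ n)" "n > 0" "int n * j \<le> k + int n - 1" shows "ord_ge j f"
proof (cases "f = 0")
  case False
  then have "k \<le> int n * fls_subdegree f" using assms(1)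
    by (simp add: ord_ge_iff_subdegree fls_subdegree_pow)
  then have "int n * j < int n * (fls_subdegree f + 1)" using assms(2,3) by (simp add: algebra_simps)
  then have "j \<le> fls_subdegree f" using assms(2) by (simp add: mult_less_cancel_left)
  then show ?thesis by (simp add: ord_ge_iff_subdegree)
qed simp

lemma euler_nth: "euler f $$ i = - (of_int i * f $$ i)"
  by (simp add: euler_def fls_X_times_conv_shift)

lemma euler_add: "euler (f + g) = euler f + euler g"
  by (intro fls_eqI) (simp add: euler_nth algebra_simps)

lemma euler_diff: "euler (f - g) = euler f - euler g"
  by (intro fls_eqI) (simp add: euler_nth algebra_simps)

lemma euler_mult: "euler (f * g) = f * euler g + euler f * g"
  by (simp add: euler_def algebra_simps)

lemma euler_const [simp]: "euler (fls_const c) = 0"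
  by (simp add: euler_def)

lemma euler_0 [simp]: "euler 0 = 0"
  by (simp add: euler_def)

lemma euler_1 [simp]: "euler 1 = 0"
  by (simp add: euler_def)

lemma euler_power: "euler (f ^ n) = of_nat n * f ^ (n - 1) * euler f"
  by (simp add: euler_def fls_deriv_power algebra_simps)

lemma euler_X_inv [simp]: "euler fls_X_inv = fls_X_inv"
  by (intro fls_eqI) (simp add: euler_nth)

lemma euler_X_inv_power: "euler (fls_X_inv ^ n) = of_nat n * fls_X_inv ^ n"
proof -
  have "euler (fls_X_inv ^ n) = of_nat n * fls_X_inv ^ (n - 1) * fls_X_inv"
    unfolding euler_power by simp
  also have "\<dots> = of_nat n * fls_X_inv ^ n"
    by (cases n) (simp_all only: mult.assoc power_Suc2 diff_Suc_1 of_nat_0 mult_zero_left)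
  finally show ?thesis .
qed

lemma ord_ge_euler: "ord_ge k f \<Longrightarrow> ord_ge k (euler f)"
  by (simp add: ord_ge_def euler_nth)

lemma euler_inverse: 
  assumes "f \<noteq> 0" shows "euler (inverse f) = - euler f / f ^ 2"
proof -
  have "euler (f * inverse f) = 0" using assms by simp
  then have "f * euler (inverse f) = - (euler f * inverse f)"
    by (simp add: euler_mult add_eq_0_iff2)
  then show ?thesis using assms by (simp add: field_simps power2_eq_square)
qed

lemma ev_0 [simp]: "ev x 0 = 0" by (simp add: ev_def)
lemma ev_pCons: "ev x (pCons c P) = fls_const c + x * ev x P"
  by (simp add: ev_def map_poly_pCons)
lemma ev_const [simp]: "ev x [:c:] = fls_const c" by (simp add: ev_pCons)
lemma ev_1 [simp]: "ev x 1 = 1" by (simp add: one_pCons)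
lemma ev_X [simp]: "ev x [:0, 1:] = x" by (simp add: ev_pCons)
lemma ev_add: "ev x (P + Q) = ev x P + ev x Q"
proof (induction P Q rule: poly_induct2)
  case (pCons a p b q)
  have "fls_const (a + b) = fls_const a + fls_const b" by (simp add: fls_plus_const)
  then show ?case using pCons by (simp add: ev_pCons distrib_left add.assoc add.left_commute)
qed simp
lemma ev_smult: "ev x (smult c P) = fls_const c * ev x P"
  by (induction P) (simp_all add: ev_pCons distrib_left mult.left_commute)
lemma ev_uminus: "ev x (- P) = - ev x P"
  using ev_add[of x P "- P"] by (simp add: add_eq_0_iff)
lemma ev_diff: "ev x (P - Q) = ev x P - ev x Q"
  using ev_add[of x P "- Q"] by (simp add: ev_uminus)
lemma ev_mult: "ev x (P * Q) = ev x P * ev x Q"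
  by (induction P) (simp_all add: ev_pCons ev_add ev_smult distrib_right mult.assoc)
lemma ev_power: "ev x (P ^ n) = ev x P ^ n"
  by (induction n) (simp_all add: ev_mult)
lemma ev_pcompose: "ev x (P \<circ>\<^sub>p Q) = ev (ev x Q) P"
  by (induction P) (simp_all add: pcompose_pCons ev_add ev_mult ev_pCons)
lemma ev_of_nat: "ev x (of_nat n) = of_nat n"
  by (induction n) (simp_all add: ev_add)
lemma ev_monom: "ev x (monom c n) = fls_const c * x ^ n"
  by (induction n) (simp_all add: monom_0 monom_Suc ev_pCons mult.left_commute)

lemma power_subst_ev:
  "z \<noteq> 0 \<Longrightarrow> M > 0 \<Longrightarrow> power_subst z M (ev x P) = ev (power_subst z M x) P"
  by (induction P) 
    (simp_all add: ev_pCons power_subst_0 power_subst_add power_subst_mult power_subst_const)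

lemma euler_ev: "euler (ev x P) = ev x (pderiv P) * euler x"
  by (induction P) (simp_all add: ev_pCons pderiv_pCons euler_add euler_mult ev_add distrib_right mult.assoc)

lemma ord_ge_ev:
  assumes "ord_ge (- int k) x" "degree P \<le> d" shows "ord_ge (- (int k * int d)) (ev x P)"
  using assms(2)
proof (induction P arbitrary: d)
  case (pCons c P)
  show ?case
  proof (cases "P = 0")
    case True
    then show ?thesis by simp
  next
    case False
    then obtain d' where d: "d = Suc d'" "degree P \<le> d'" using pCons.prems
      by (cases d) auto
    have "ord_ge (- int k + - (int k * int d')) (x * ev x P)"
      by (intro ord_ge_mult assms(1) pCons.IH d)
    moreover have "- (int k * int d) = - int k + - (int k * int d')"
      by (simp add: d(1) distrib_left)
    ultimately have "ord_ge (- (int k * int d)) (x * ev x P)" by (simp only:)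
    moreover have "- (int k * int d) \<le> 0" by simp
    ultimately show ?thesis unfolding ev_pCons
      by (intro ord_ge_add ord_ge_const)
  qed
qed simp

section \<open>Words in two polynomials\<close>

lemma comp_word_Nil [simp]: "comp_word F G [] = [:0, 1:]"
  by (simp add: comp_word_def)

lemma comp_word_Cons:
  "comp_word F G (l # w) = (case l of LetterF \<Rightarrow> F | LetterG \<Rightarrow> G) \<circ>\<^sub>p comp_word F G w"
  by (simp add: comp_word_def)

lemma comp_word_snoc:
  "comp_word F G (w @ [l]) = comp_word F G w \<circ>\<^sub>p (case l of LetterF \<Rightarrow> F | LetterG \<Rightarrow> G)"
  by (simp add: comp_word_append comp_word_Cons)

lemma pcompose_right_cancel:
  fixes P Q R :: "'a::idom poly"
  assumes "P \<circ>\<^sub>p R = Q \<circ>\<^sub>p R" "degree R > 0" shows "P = Q"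
proof -
  have "(P - Q) \<circ>\<^sub>p R = 0" using assms(1) by (simp add: pcompose_diff)
  then show ?thesis using assms(2) pcompose_eq_0 by fastforce
qed

lemma degree_comp_word_pos:
  fixes F G :: "'a::idom poly"
  assumes "degree F > 0" "degree G > 0" shows "degree (comp_word F G w) > 0"
  by (induction w) (use assms in \<open>auto simp: comp_word_Cons degree_pcompose split: letter.split\<close>)

lemma degree_comp_word_gt_1:
  fixes F G :: "'a::idom poly"
  assumes "degree F > 1" "degree G > 1" "w \<noteq> []" shows "degree (comp_word F G w) > 1"
proof -
  obtain l v where w: "w = l # v" using assms(3) by (cases w) auto
  have "degree (comp_word F G v) > 0" using degree_comp_word_pos assms(1,2) by force
  then show ?thesis using assms(1,2) by (cases l) (auto simp: w comp_word_Cons degree_pcompose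
      intro: less_1_mult' simp: less_le_trans)
qed

text \<open>
  Right composition with a nonconstant polynomial is injective, so common final letters cancel until
  the words end in different letters. Neither word can run out first, because a nonempty word has degree
  greater than one and so is not \<open>X\<close>.
\<close>

lemma relation_of_equal_words:
  fixes F G :: "'a::idom poly"
  assumes "degree F > 1" "degree G > 1"
  shows "comp_word F G v = comp_word F G w \<Longrightarrow> v \<noteq> w \<Longrightarrow>
    \<exists>a b. comp_word F G a \<circ>\<^sub>p F = comp_word F G b \<circ>\<^sub>p G"
proof (induction v arbitrary: w rule: rev_induct)
  case Nil
  then have "w \<noteq> []" by auto
  from degree_comp_word_gt_1[OF assms this] Nil show ?case by (metis comp_word_Nil degree_pCons_eq_if
    degree_1 degree_pCons_0 less_numeral_extra(4) one_neq_zero One_nat_def one_pCons)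
next
  case (snoc l v)
  show ?case
  proof (cases w rule: rev_cases)
    case Nil
    have "degree (comp_word F G (v @ [l])) > 1" by (rule degree_comp_word_gt_1[OF assms]) simp
    then show ?thesis using snoc.prems(1) Nil by simp
  next
    case (snoc w' l')
    show ?thesis
    proof (cases "l = l'")
      case True
      have "degree (case l of LetterF \<Rightarrow> F | LetterG \<Rightarrow> G) > 0"
        using assms by (auto split: letter.split)
      then have "comp_word F G v = comp_word F G w'"
        using snoc.prems(1) True pcompose_right_cancel unfolding snoc comp_word_snoc by blast
      then show ?thesis using snoc.IH snoc.prems(2) snoc True by blast
    next
      case False
      then show ?thesis using snoc.prems(1) unfolding snoc comp_word_snoc
        by (cases l; cases l') (auto, metis)
    qed
  qed
qed

text \<open>
  The two pairs may live over different coefficient rings. Empty words are excluded because the semigroups are not monoids.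
\<close>

definition same_relations :: "'a::comm_semiring_1 poly \<Rightarrow> 'a poly \<Rightarrow> 'b::comm_semiring_1 poly \<Rightarrow> 'b poly \<Rightarrow> bool" where
  "same_relations F G F' G' \<longleftrightarrow> (\<forall>v w. v \<noteq> [] \<longrightarrow> w \<noteq> [] \<longrightarrow>
     (comp_word F G v = comp_word F G w \<longleftrightarrow> comp_word F' G' v = comp_word F' G' w))"

lemma same_relations_trans:
  "same_relations F G F' G' \<Longrightarrow> same_relations F' G' F'' G'' \<Longrightarrow> same_relations F G F'' G''"
  by (simp add: same_relations_def)

text \<open>
  A semigroup generated by two letters is the free semigroup modulo its relations, so equal relations
  give an isomorphism matching the letters.
\<close>

lemma iso_of_same_relations:
  fixes F G F' G' :: "'a::comm_semiring_1 poly"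
  assumes "same_relations F G F' G'"
  obtains \<phi> where "comp_semigroup_iso \<phi> (comp_semigroup F G) (comp_semigroup F' G')" "\<phi> F = F'" "\<phi> G = G'"
proof -
  define \<phi> where "\<phi> P = comp_word F' G' (SOME v. v \<noteq> [] \<and> comp_word F G v = P)" for P
  have \<phi>: "\<phi> (comp_word F G v) = comp_word F' G' v" if "v \<noteq> []" for v
  proof -
    have "\<exists>u. u \<noteq> [] \<and> comp_word F G u = comp_word F G v" using that by blast
    from someI_ex[OF this] show ?thesis using assms that unfolding \<phi>_def same_relations_def by blast
  qed
  show thesis
  proof
    show "\<phi> F = F'" using \<phi>[of "[LetterF]"] by (simp add: comp_word_Cons pcompose_idR)
    show "\<phi> G = G'" using \<phi>[of "[LetterG]"] by (simp add: comp_word_Cons pcompose_idR)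
    have "inj_on \<phi> (comp_semigroup F G)"
      using assms by (auto simp: inj_on_def comp_semigroup_def \<phi> same_relations_def)
    moreover have "\<phi> ` comp_semigroup F G = comp_semigroup F' G'"
      by (auto simp: comp_semigroup_def image_image \<phi> intro!: image_cong)
    moreover have "\<phi> (P \<circ>\<^sub>p Q) = \<phi> P \<circ>\<^sub>p \<phi> Q" if "P \<in> comp_semigroup F G" "Q \<in> comp_semigroup F G" for P Q
      using that by (auto simp: comp_semigroup_def \<phi> simp flip: comp_word_append)
    ultimately show "comp_semigroup_iso \<phi> (comp_semigroup F G) (comp_semigroup F' G')"
      by (simp add: comp_semigroup_iso_def bij_betw_def)
  qed
qed

lemma not_free_of_iso:
  assumes iso: "comp_semigroup_iso \<phi> (comp_semigroup F G) (comp_semigroup F' G')"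
    and F: "\<phi> F = F'" and G: "\<phi> G = G'" and nf: "\<not> free_on_letters F' G'"
  shows "\<not> free_on_letters F G"
proof -
  have mem: "comp_word F G w \<in> comp_semigroup F G" if "w \<noteq> []" for w
    using that by (auto simp: comp_semigroup_def)
  have \<phi>: "\<phi> (comp_word F G w) = comp_word F' G' w" if "w \<noteq> []" for w
    using that
  proof (induction w)
    case (Cons l w)
    let ?l = "case l of LetterF \<Rightarrow> F | LetterG \<Rightarrow> G"
    have l: "\<phi> ?l = (case l of LetterF \<Rightarrow> F' | LetterG \<Rightarrow> G')" using F G by (cases l) auto
    show ?case
    proof (cases "w = []")
      case True
      then show ?thesis using l by (simp add: comp_word_Cons pcompose_idR)
    next
      case False
      have "?l \<in> comp_semigroup F G" using mem[of "[l]"] by (simp add: comp_word_Cons pcompose_idR)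
      then have "\<phi> (?l \<circ>\<^sub>p comp_word F G w) = \<phi> ?l \<circ>\<^sub>p \<phi> (comp_word F G w)"
        using iso mem[OF False] by (simp add: comp_semigroup_iso_def)
      then show ?thesis using l Cons.IH False by (simp add: comp_word_Cons)
    qed
  qed simp
  obtain v w where vw: "v \<noteq> []" "w \<noteq> []" "v \<noteq> w" "comp_word F' G' v = comp_word F' G' w"
    using nf by (auto simp: free_on_letters_def inj_on_def)
  have "\<phi> (comp_word F G v) = \<phi> (comp_word F G w)" using vw \<phi> by simp
  then have "comp_word F G v = comp_word F G w"
    using iso mem[OF vw(1)] mem[OF vw(2)] unfolding comp_semigroup_iso_def bij_betw_def
    by (meson inj_onD)
  then show ?thesis using vw by (auto simp: free_on_letters_def inj_on_def)
qed

lemma comp_word_conj: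
  fixes F G L L' :: "'a::comm_semiring_1 poly"
  assumes "L \<circ>\<^sub>p L' = [:0, 1:]" "L' \<circ>\<^sub>p L = [:0, 1:]"
  shows "comp_word (L' \<circ>\<^sub>p F \<circ>\<^sub>p L) (L' \<circ>\<^sub>p G \<circ>\<^sub>p L) w = L' \<circ>\<^sub>p comp_word F G w \<circ>\<^sub>p L"
proof (induction w)
  case (Cons l w)
  have "L' \<circ>\<^sub>p P \<circ>\<^sub>p L \<circ>\<^sub>p (L' \<circ>\<^sub>p Q \<circ>\<^sub>p L) = L' \<circ>\<^sub>p (P \<circ>\<^sub>p Q) \<circ>\<^sub>p L" for P Q
  proof -
    have "L' \<circ>\<^sub>p P \<circ>\<^sub>p L \<circ>\<^sub>p (L' \<circ>\<^sub>p Q \<circ>\<^sub>p L) = L' \<circ>\<^sub>p P \<circ>\<^sub>p ((L \<circ>\<^sub>p L') \<circ>\<^sub>p Q \<circ>\<^sub>p L)"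
      by (simp only: pcompose_assoc)
    then show ?thesis by (simp only: assms pcompose_X_left pcompose_assoc)
  qed
  then show ?case using Cons by (cases l) (simp_all add: comp_word_Cons)
qed (simp add: pcompose_idR assms)

lemma same_relations_conj:
  fixes F G L L' :: "'a::comm_semiring_1 poly"
  assumes "L \<circ>\<^sub>p L' = [:0, 1:]" "L' \<circ>\<^sub>p L = [:0, 1:]"
  shows "same_relations F G (L' \<circ>\<^sub>p F \<circ>\<^sub>p L) (L' \<circ>\<^sub>p G \<circ>\<^sub>p L)"
proof -
  have inv: "L \<circ>\<^sub>p (L' \<circ>\<^sub>p P \<circ>\<^sub>p L) \<circ>\<^sub>p L' = P" for P
  proof -
    have "L \<circ>\<^sub>p (L' \<circ>\<^sub>p P \<circ>\<^sub>p L) \<circ>\<^sub>p L' = (L \<circ>\<^sub>p L') \<circ>\<^sub>p P \<circ>\<^sub>p (L \<circ>\<^sub>p L')"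
      by (simp only: pcompose_assoc)
    then show ?thesis by (simp only: assms pcompose_X_left pcompose_idR)
  qed
  show ?thesis unfolding same_relations_def comp_word_conj[OF assms] by (metis inv)
qed

lemma monom_pcompose_monom:
  "monom (a::'a::comm_semiring_1) i \<circ>\<^sub>p monom b j = monom (a * b ^ i) (i * j)"
proof (induction i)
  case 0
  then show ?case by (simp add: monom_0)
next
  case (Suc i)
  then show ?case by (simp add: monom_Suc pcompose_pCons mult_monom mult.left_commute mult.commute)
qed

text \<open>
  A word of length \<open>l\<close> is \<open>\<gamma>\<^sup>e X\<^sup>N\<close>, where \<open>N = m\<^sup>i n\<^sup>l\<^sup>-\<^sup>i\<close> and \<open>e\<close> matters only modulo the order
  \<open>k\<close> of \<open>\<gamma>\<close>. This allows at most \<open>k (l + 1)\<close> values for \<open>2\<^sup>l\<close> words.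
\<close>

lemma not_free_monomials:
  fixes \<gamma> :: "'a::idom"
  assumes "is_root_of_unity \<gamma>"
  shows "\<not> free_on_letters (monom 1 m) (monom \<gamma> n)"
proof
  assume free: "free_on_letters (monom 1 m) (monom \<gamma> n)"
  obtain k where k: "k > 0" "\<gamma> ^ k = 1" using assms by (auto simp: is_root_of_unity_def)
  have form: "\<exists>e i. e < k \<and> i \<le> length w \<and>
      comp_word (monom 1 m) (monom \<gamma> n) w = monom (\<gamma> ^ e) (m ^ i * n ^ (length w - i))" for w
  proof (induction w)
    case Nil
    have "comp_word (monom 1 m) (monom \<gamma> n) [] = monom (\<gamma> ^ 0) (m ^ 0 * n ^ 0)"
      by (simp add: monom_Suc monom_0)
    then show ?case using k by force
  next
    case (Cons l w)
    then obtain e i where IH: "i \<le> length w"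
      "comp_word (monom 1 m) (monom \<gamma> n) w = monom (\<gamma> ^ e) (m ^ i * n ^ (length w - i))" by blast
    have red: "\<gamma> ^ j = \<gamma> ^ (j mod k)" for j
    proof -
      have "\<gamma> ^ j = \<gamma> ^ (k * (j div k) + j mod k)" by simp
      then show ?thesis by (simp only: power_add power_mult k(2) power_one mult_1)
    qed
    show ?case
    proof (cases l)
      case LetterF
      have "comp_word (monom 1 m) (monom \<gamma> n) (l # w) = monom (\<gamma> ^ (e * m mod k))
          (m ^ Suc i * n ^ (length (l # w) - Suc i))"
        using LetterF red by (simp add: comp_word_Cons IH(2) monom_pcompose_monom power_mult mult_ac flip: red)
      then show ?thesis using IH(1) k(1)
        by (intro exI[of _ "e * m mod k"] exI[of _ "Suc i"]) auto
    next
      case LetterG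
      have "\<gamma> * (\<gamma> ^ e) ^ n = \<gamma> ^ (Suc (e * n) mod k)"
        by (simp add: power_mult flip: red)
      then have "comp_word (monom 1 m) (monom \<gamma> n) (l # w) = monom (\<gamma> ^ (Suc (e * n) mod k))
          (m ^ i * n ^ (length (l # w) - i))"
        using LetterG IH(1) by (simp add: comp_word_Cons IH(2) monom_pcompose_monom Suc_diff_le mult_ac)
      then show ?thesis using IH(1) k(1)
        by (intro exI[of _ "Suc (e * n) mod k"] exI[of _ i]) auto
    qed
  qed
  have card_le: "2 ^ l \<le> k * (l + 1)" if "l > 0" for l
  proof -
    let ?W = "{w :: letter list. set w \<subseteq> UNIV \<and> length w = l}"
    have UNIV: "(UNIV :: letter set) = {LetterF, LetterG}" using letter.exhaust by auto
    have "card ?W = card (UNIV :: letter set) ^ l" by (rule card_lists_length_eq) (simp add: UNIV)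
    also have "card (UNIV :: letter set) = 2" by (simp add: UNIV)
    finally have cW: "card ?W = 2 ^ l" .
    let ?T = "(\<lambda>(e, i). monom (\<gamma> ^ e) (m ^ i * n ^ (l - i))) ` ({..<k} \<times> {..l})"
    have "comp_word (monom 1 m) (monom \<gamma> n) ` ?W \<subseteq> ?T"
      using form by (fastforce simp: image_iff)
    moreover have "inj_on (comp_word (monom 1 m) (monom \<gamma> n)) ?W"
      using free unfolding free_on_letters_def by (rule inj_on_subset) (use that in auto)
    ultimately have "card ?W \<le> card ?T"
      by (intro card_inj_on_le[where f = "comp_word (monom 1 m) (monom \<gamma> n)"]) auto
    also have "\<dots> \<le> card ({..<k} \<times> {..l})" by (rule card_image_le) simp
    finally show ?thesis using cW by simp
  qed
  have "k < 2 ^ k" by (rule less_exp)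
  \<comment> \<open>Any length with \<open>k (l + 1) < 2\<^sup>l\<close> will do.\<close>
  define l where "l = 2 * k + 4"
  have "k * (l + 1) < 2 ^ l"
  proof -
    have "Suc k \<le> 2 ^ k" using \<open>k < 2 ^ k\<close> by (rule Suc_leI)
    then have "l + 1 \<le> 16 * 2 ^ k" unfolding l_def by linarith
    then have "k * (l + 1) \<le> k * (16 * 2 ^ k)" by (rule mult_le_mono2)
    also have "\<dots> < 2 ^ k * (16 * 2 ^ k)" using \<open>k < 2 ^ k\<close> by (intro mult_strict_right_mono) simp_all
    also have "\<dots> = 2 ^ l" unfolding l_def mult_2 power_add by simp
    finally show ?thesis .
  qed
  then show False using card_le[of l] by (simp add: l_def)
qed

text \<open>
  A word is \<open>\<gamma>\<^sup>e X\<^sup>N\<close> with \<open>e (n - 1) < N\<close>, and this bound is what prevents the two sides of the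
  relation from carrying the same power of \<open>\<gamma>\<close>. Hence two different powers of \<open>\<gamma>\<close> are equal.
\<close>

lemma root_of_unity_of_monomial_relation:
  fixes \<gamma> :: "'a::field"
  assumes mn: "m > 1" "n > 1" and \<gamma>: "\<gamma> \<noteq> 0"
    and rel: "comp_word (monom 1 m) (monom \<gamma> n) v \<circ>\<^sub>p monom 1 m
            = comp_word (monom 1 m) (monom \<gamma> n) w \<circ>\<^sub>p monom \<gamma> n"
  shows "is_root_of_unity \<gamma>"
proof -
  have form: "\<exists>e N. comp_word (monom 1 m) (monom \<gamma> n) w = monom (\<gamma> ^ e) N \<and> e * (n - 1) < N" for w
  proof (induction w)
    case Nil
    have "comp_word (monom 1 m) (monom \<gamma> n) [] = monom (\<gamma> ^ 0) 1"
      by (simp add: monom_Suc monom_0)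
    then show ?case by force
  next
    case (Cons l w)
    then obtain e N where IH: "comp_word (monom 1 m) (monom \<gamma> n) w = monom (\<gamma> ^ e) N" "e * (n - 1) < N"
      by blast
    show ?case
    proof (cases l)
      case LetterF
      have "comp_word (monom 1 m) (monom \<gamma> n) (l # w) = monom (\<gamma> ^ (e * m)) (m * N)"
        using LetterF by (simp add: comp_word_Cons IH monom_pcompose_monom power_mult)
      moreover have "e * m * (n - 1) < m * N" using IH(2) mn by (simp add: mult_ac)
      ultimately show ?thesis by blast
    next
      case LetterG
      have "comp_word (monom 1 m) (monom \<gamma> n) (l # w) = monom (\<gamma> ^ Suc (e * n)) (n * N)"
        using LetterG by (simp add: comp_word_Cons IH monom_pcompose_monom power_mult)
      moreover have "Suc (e * n) * (n - 1) < n * N"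
      proof -
        have "Suc (e * n) * (n - 1) < n * (e * (n - 1)) + n" using mn by (simp add: mult_ac)
        also have "\<dots> = n * Suc (e * (n - 1))" by simp
        also have "\<dots> \<le> n * N" using IH(2) by (intro mult_le_mono) auto
        finally show ?thesis .
      qed
      ultimately show ?thesis by blast
    qed
  qed
  obtain e M where v: "comp_word (monom 1 m) (monom \<gamma> n) v = monom (\<gamma> ^ e) M" "e * (n - 1) < M"
    using form by blast
  obtain f N where w: "comp_word (monom 1 m) (monom \<gamma> n) w = monom (\<gamma> ^ f) N" "f * (n - 1) < N"
    using form by blast
  have eq: "monom (\<gamma> ^ e) (M * m) = monom (\<gamma> ^ (f + N)) (N * n)"
    using rel by (simp add: v w monom_pcompose_monom power_add)
  then have deg: "M * m = N * n" by (metis \<gamma> degree_monom_eq power_not_zero)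
  with eq have pow: "\<gamma> ^ e = \<gamma> ^ (f + N)" by (metis coeff_monom)
  \<comment> \<open>Otherwise the two exponent bounds and the equality of degrees give \<open>(n - 1) m < n\<close>.\<close>
  have "e \<noteq> f + N"
  proof
    assume "e = f + N"
    then have "N * (n - 1) \<le> e * (n - 1)" by simp
    then have "N * (n - 1) < M" using v(2) by (rule le_less_trans)
    then have "N * (n - 1) * m < N * n" using deg mn by (metis mult_less_cancel2 less_trans zero_less_one)
    then have "(n - 1) * m < n" by (simp add: mult.assoc)
    moreover have "(n - 1) * 2 \<le> (n - 1) * m" using mn by simp
    ultimately show False using mn by linarith
  qed
  have "\<gamma> ^ (b - a) = 1" if "\<gamma> ^ a = \<gamma> ^ b" "a < b" for a b
    using that \<gamma> by (simp add: power_diff)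
  then show ?thesis using pow \<open>e \<noteq> f + N\<close> unfolding is_root_of_unity_def
    by (metis linorder_neqE_nat zero_less_diff)
qed

section \<open>Values of polynomials at a series with a pole\<close>

lemma nth_mult_ord_ge:
  fixes f g :: "'a::field fls"
  assumes "ord_ge j f" "ord_ge k g" shows "(f * g) $$ (j + k) = f $$ j * g $$ k"
proof (cases "f = 0 \<or> g = 0")
  case False
  then have le: "j \<le> fls_subdegree f" "k \<le> fls_subdegree g"
    using assms by (auto simp: ord_ge_iff_subdegree)
  show ?thesis
  proof (cases "j = fls_subdegree f \<and> k = fls_subdegree g")
    case True
    then show ?thesis by (simp add: fls_times_base)
  next
    case not_eq: False
    then have "j + k < fls_subdegree (f * g)" using le False by auto
    moreover have "f $$ j = 0 \<or> g $$ k = 0" using not_eq le by force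
    ultimately show ?thesis by (auto simp: fls_eq0_below_subdegree)
  qed
qed auto

lemma fls_subdegree_eq_of_ord_ge: "ord_ge k f \<Longrightarrow> f $$ k \<noteq> 0 \<Longrightarrow> fls_subdegree f = k"
  by (metis fls_subdegree_eqI ord_ge_def)

lemma ord_ge_subdegree: "ord_ge (fls_subdegree f) f"
  by (simp add: ord_ge_iff_subdegree)

lemma ord_ge_Suc: "ord_ge k f \<Longrightarrow> f $$ k = 0 \<Longrightarrow> ord_ge (k + 1) f"
  unfolding ord_ge_def by (metis linorder_neqE_linordered_idom not_less zless_add1_eq)

lemma ord_ge_eq_0: "(\<And>N. ord_ge (int N - c) f) \<Longrightarrow> f = 0"
proof (rule fls_eqI)
  fix i assume *: "\<And>N. ord_ge (int N - c) f"
  have "i < int (nat (i + c + 1)) - c" by simp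
  then show "f $$ i = 0 $$ i" using *[of "nat (i + c + 1)"] unfolding ord_ge_def by simp
qed

text \<open>
  The pole of \<open>P(x)\<close> is governed by the leading term of \<open>P\<close>. This is the source of all degree
  computations below.
\<close>

lemma ev_nth_top:
  assumes x: "ord_ge (- int k) x" and k: "k > 0" and d: "degree P \<le> d"
  shows "ev x P $$ (- (int k * int d)) = coeff P d * (x $$ (- int k)) ^ d"
  using d
proof (induction P arbitrary: d)
  case 0
  then show ?case by simp
next
  case (pCons c P)
  show ?case
  proof (cases d)
    case 0
    then have "P = 0" using pCons.prems by (simp split: if_splits)
    then show ?thesis by (simp add: 0)
  next
    case (Suc d')
    then have d': "degree P \<le> d'" using pCons.prems by (cases "P = 0") auto
    have eq: "- (int k * int d) = - int k + - (int k * int d')"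
      by (simp add: Suc distrib_left)
    have neg: "- (int k * int d) < 0" using k by (simp add: Suc mult_pos_pos)
    have "(x * ev x P) $$ (- (int k * int d)) = x $$ (- int k) * ev x P $$ (- (int k * int d'))"
      unfolding eq by (intro nth_mult_ord_ge x ord_ge_ev d')
    moreover have "fls_const c $$ (- (int k * int d)) = 0" using neg by auto
    ultimately show ?thesis using pCons.IH[OF d'] by (simp add: ev_pCons Suc mult_ac)
  qed
qed

lemma fls_subdegree_ev:
  assumes x: "fls_subdegree x = - int k" and k: "k > 0" and P: "P \<noteq> 0"
  shows "fls_subdegree (ev x P) = - (int k * int (degree P))" "ev x P \<noteq> 0"
proof -
  have ox: "ord_ge (- int k) x" by (metis ord_ge_subdegree x)
  have "x \<noteq> 0" using x k by auto
  then have x0: "x $$ (- int k) \<noteq> 0" by (metis x nth_fls_subdegree_nonzero)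
  have *: "ev x P $$ (- (int k * int (degree P))) \<noteq> 0"
    using ev_nth_top[OF ox k order_refl, of P] x0 P by simp
  then show "fls_subdegree (ev x P) = - (int k * int (degree P))"
    by (intro fls_subdegree_eq_of_ord_ge ord_ge_ev ox order_refl)
  show "ev x P \<noteq> 0" using * by auto
qed

text \<open>
  The values of nonzero polynomials at a series with a pole have order at most zero. Approximate
  identities between polynomial values therefore become exact as soon as the error has positive order.
\<close>

lemma ev_eq_0I:
  assumes "fls_subdegree x < 0" "ord_ge 1 (ev x P)" shows "P = 0"
proof (rule ccontr)
  assume P: "P \<noteq> 0"
  have "fls_subdegree x = - int (nat (- fls_subdegree x))" "nat (- fls_subdegree x) > 0"
    using assms(1) by auto
  from fls_subdegree_ev[OF this P] have "fls_subdegree (ev x P) \<le> 0" "ev x P \<noteq> 0" by auto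
  with assms(2) show False by (simp add: ord_ge_iff_subdegree)
qed

lemma ev_inj: "fls_subdegree x < 0 \<Longrightarrow> ev x P = ev x Q \<Longrightarrow> P = Q"
  using ev_eq_0I[of x "P - Q"] by (simp add: ev_diff)

lemma degree_pderiv_le: "degree (pderiv P) \<le> degree P - 1"
  by (rule degree_le) (auto simp: coeff_pderiv coeff_eq_0)

text \<open>
  The error of the first-order Taylor expansion at \<open>X\<close>. The increment is written as a relative one,
  \<open>\<delta> X\<close>, because the order of \<open>X\<close> then contributes only through \<open>degree P\<close>.
\<close>

lemma ord_ge_ev_Taylor:
  assumes X: "ord_ge (- int k) X" and \<delta>: "ord_ge (int j) \<delta>" and d: "degree P \<le> d"
  shows "ord_ge (2 * int j - int k * int d)
    (ev (X * (1 + \<delta>)) P - ev X P - \<delta> * X * ev X (pderiv P))"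
  using d
proof (induction P arbitrary: d)
  case 0
  then show ?case by simp
next
  case (pCons c P)
  show ?case
  proof (cases "P = 0")
    case True
    then show ?thesis by (simp add: ev_pCons pderiv_pCons)
  next
    case False
    then obtain d' where d': "d = Suc d'" "degree P \<le> d'"
      using pCons.prems by (cases d) auto
    define E where "E = ev (X * (1 + \<delta>)) P - ev X P - \<delta> * X * ev X (pderiv P)"
    have "ev (X * (1 + \<delta>)) (pCons c P) - ev X (pCons c P) - \<delta> * X * ev X (pderiv (pCons c P))
        = X * (1 + \<delta>) * E + \<delta> * \<delta> * (X * (X * ev X (pderiv P)))"
    proof -
      have E: "ev (X * (1 + \<delta>)) P = E + ev X P + \<delta> * X * ev X (pderiv P)" by (simp add: E_def)
      show ?thesis unfolding ev_pCons pderiv_pCons ev_add E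
        by (simp add: distrib_left distrib_right mult_ac add_ac)
    qed
    moreover have "ord_ge ((- int k + 0) + (2 * int j - int k * int d')) (X * (1 + \<delta>) * E)"
      unfolding E_def
      by (intro ord_ge_mult X pCons.IH d' ord_ge_add ord_ge_mono[OF \<delta>]) auto
    moreover have "ord_ge ((int j + int j) + (- int k + - (int k * int d'))) (\<delta> * \<delta> * (X * (X * ev X (pderiv P))))"
    proof (cases "d' = 0")
      case True
      then have "pderiv P = 0" using d' by (auto elim!: degree_eq_zeroE simp: pderiv_pCons)
      then show ?thesis by simp
    next
      case False
      then obtain d'' where "d' = Suc d''" by (cases d') auto
      moreover have "degree (pderiv P) \<le> d''" using degree_pderiv_le[of P] d' \<open>d' = Suc d''\<close> by simp
      ultimately have "ord_ge (- int k + - (int k * int d'')) (X * ev X (pderiv P))"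
        by (intro ord_ge_mult X ord_ge_ev)
      moreover have "- int k + - (int k * int d'') = - (int k * int d')"
        by (simp add: \<open>d' = Suc d''\<close> distrib_left)
      ultimately have "ord_ge (- (int k * int d')) (X * ev X (pderiv P))" by (simp only:)
      then show ?thesis by (intro ord_ge_mult X \<delta>)
    qed
    moreover have "(- int k + 0) + (2 * int j - int k * int d') = 2 * int j - int k * int d"
      "(int j + int j) + (- int k + - (int k * int d')) = 2 * int j - int k * int d"
      by (simp_all add: d'(1) distrib_left)
    ultimately show ?thesis by (metis ord_ge_add)
  qed
qed

lemma ord_ge_ev_perturb:
  assumes X: "ord_ge (- int k) X" and \<delta>: "ord_ge (int j) \<delta>"
  shows "ord_ge (int j - int k * int (degree P)) (ev (X * (1 + \<delta>)) P - ev X P)"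
proof -
  have 1: "ord_ge (int j - int k * int (degree P)) (\<delta> * X * ev X (pderiv P))"
  proof (cases "degree P")
    case 0
    then have "pderiv P = 0" by (auto elim!: degree_eq_zeroE simp: pderiv_pCons)
    then show ?thesis by simp
  next
    case (Suc d)
    have "ord_ge (int j + - int k + - (int k * int d)) (\<delta> * X * ev X (pderiv P))"
      using degree_pderiv_le[of P] Suc by (intro ord_ge_mult X \<delta> ord_ge_ev) auto
    moreover have "int j + - int k + - (int k * int d) = int j - int k * int (degree P)"
      by (simp add: Suc distrib_left)
    ultimately show ?thesis by (simp only:)
  qed
  have "ord_ge (int j - int k * int (degree P))
     (ev (X * (1 + \<delta>)) P - ev X P - \<delta> * X * ev X (pderiv P))"
    by (rule ord_ge_mono[OF ord_ge_ev_Taylor[OF X \<delta> order_refl]]) simp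
  from ord_ge_add[OF this 1] show ?thesis by simp
qed

section \<open>The Boettcher coordinate\<close>

text \<open>
  Completeness of the Laurent series field, for sequences whose consecutive differences have growing order.
\<close>

lemma fls_limit:
  fixes f :: "nat \<Rightarrow> 'a::field fls"
  assumes ge: "\<And>N. ord_ge (-1) (f N)" and cauchy: "\<And>N. ord_ge (int N) (f (Suc N) - f N)"
  obtains x where "\<And>N. ord_ge (int N) (x - f N)" "ord_ge (-1) x"
proof -
  define x where "x = fls_shift 1 (fps_to_fls (Abs_fps (\<lambda>j. f j $$ (int j - 1))))"
  have x_nth: "x $$ i = (if i < -1 then 0 else f (nat (i + 1)) $$ i)" for i
    by (auto simp: x_def)
  have stab: "f (N + d) $$ i = f N $$ i" if "i < int N" for N d i
  proof (induction d)
    case (Suc d)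
    have "(f (Suc (N + d)) - f (N + d)) $$ i = 0" 
      using cauchy[of "N + d"] that by (simp add: ord_ge_def)
    then show ?case using Suc by simp
  qed simp
  have "ord_ge (int N) (x - f N)" for N
    unfolding ord_ge_def
  proof safe
    fix i assume i: "i < int N"
    show "(x - f N) $$ i = 0"
    proof (cases "i < -1")
      case True
      then show ?thesis using ge[of N] by (simp add: x_nth ord_ge_def)
    next
      case False
      have "f (nat (i + 1) + (N - nat (i + 1))) $$ i = f (nat (i + 1)) $$ i"
        using False by (intro stab) auto
      then show ?thesis using i False by (simp add: x_nth)
    qed
  qed
  moreover have "ord_ge (-1) x" by (simp add: ord_ge_def x_nth)
  ultimately show ?thesis using that by blast
qed

text \<open>
  One step of a triangular linear recursion: a relative perturbation of order \<open>N + 1\<close> enters \<open>F(x)\<close> to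
  first order with coefficient a multiple of \<open>m\<close>, but enters \<open>x(t\<^sup>m)\<close> only at order \<open>m N\<close>. As \<open>m\<close> is
  invertible in the field, one more coefficient of the error can be removed.
\<close>

lemma Boettcher_step:
  fixes F :: "'a::field poly"
  assumes deg: "degree F = m" "m > 1" "of_nat m \<noteq> (0::'a)"
    and x: "ord_ge (-1) x" "x $$ (-1) = \<alpha>" "\<alpha> \<noteq> 0" "lead_coeff F * \<alpha> ^ m = \<alpha>"
    and R: "ord_ge (int N + 1 - int m) (ev x F - power_subst 1 m x)"
  obtains y where "ord_ge (-1) y" "y $$ (-1) = \<alpha>" "ord_ge (int N) (y - x)"
    "ord_ge (int N + 2 - int m) (ev y F - power_subst 1 m y)"
proof -
  have m0: "m > 0" using deg by simp
  define R where "R = ev x F - power_subst 1 m x"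
  \<comment> \<open>This value cancels the coefficient of \<open>R\<close> at \<open>t\<^sup>N\<^sup>+\<^sup>1\<^sup>-\<^sup>m\<close>.\<close>
  define c where "c = - (R $$ (int N + 1 - int m)) / (of_nat m * \<alpha>)"
  define \<delta> where "\<delta> = fls_const c * fls_X ^ (N + 1)"
  define y where "y = x * (1 + \<delta>)"
  have \<delta>_nth: "\<delta> $$ i = (if i = int N + 1 then c else 0)" for i
    by (auto simp: \<delta>_def fls_X_power_nth simp del: power_Suc)
  have \<delta>: "ord_ge (int (N + 1)) \<delta>" by (auto simp: ord_ge_def \<delta>_nth)
  have x1: "ord_ge (- int 1) x" using x by simp
  have yx: "y - x = x * \<delta>" by (simp add: y_def distrib_left)
  have d: "ord_ge (int N) (y - x)"
    using ord_ge_mult[OF x1 \<delta>] by (simp add: yx ord_ge_mono)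
  have T: "ord_ge (int N + 2 - int m) (ev y F - ev x F - \<delta> * x * ev x (pderiv F))"
    using ord_ge_ev_Taylor[OF x1 \<delta> order_refl, of F] unfolding y_def deg(1)
    by (rule ord_ge_mono) simp
  have S: "ord_ge (int N + 2 - int m) (power_subst 1 m y - power_subst 1 m x)"
  proof -
    have "power_subst 1 m y - power_subst 1 m x = power_subst 1 m (y - x)"
      by (simp add: power_subst_diff m0)
    moreover have "ord_ge (int m * (- 1 + (int N + 1))) (power_subst 1 m (y - x))"
    proof (intro ord_ge_power_subst m0)
      show "ord_ge (- 1 + (int N + 1)) (y - x)" using d by simp
    qed simp
    moreover have "int N + 2 - int m \<le> int m * (- 1 + (int N + 1))"
    proof -
      have "int N + 2 - int m \<le> int N" using deg(2) by simp
      also have "\<dots> \<le> int m * int N" using m0 by (cases N) auto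
      finally show ?thesis by simp
    qed
    ultimately show ?thesis by (metis ord_ge_mono)
  qed
  have D: "ord_ge (int N + 1 - int m) (\<delta> * x * ev x (pderiv F))"
    "(\<delta> * x * ev x (pderiv F)) $$ (int N + 1 - int m) = c * of_nat m * \<alpha>"
  proof -
    have dp: "degree (pderiv F) \<le> m - 1" using degree_pderiv_le[of F] deg by simp
    have ox: "ord_ge (- int 1) x" using x by simp
    have o: "ord_ge (- (int 1 * int (m - 1))) (ev x (pderiv F))" by (rule ord_ge_ev[OF ox dp])
    have n: "ev x (pderiv F) $$ (- (int 1 * int (m - 1))) = coeff (pderiv F) (m - 1) * \<alpha> ^ (m - 1)"
      using ev_nth_top[OF ox _ dp] x by simp
    have e: "int N + 1 - int m = int (N + 1) + - int 1 + - (int 1 * int (m - 1))" using deg by simp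
    show "ord_ge (int N + 1 - int m) (\<delta> * x * ev x (pderiv F))"
      unfolding e by (intro ord_ge_mult \<delta> ox o)
    have "(\<delta> * x * ev x (pderiv F)) $$ (int N + 1 - int m) = c * \<alpha> * (of_nat m * lead_coeff F * \<alpha> ^ (m - 1))"
      unfolding e
      by (subst nth_mult_ord_ge[OF ord_ge_mult[OF \<delta> ox] o], subst nth_mult_ord_ge[OF \<delta> ox])
        (use n deg x in \<open>simp add: \<delta>_nth coeff_pderiv\<close>)
    also have "\<dots> = c * of_nat m * (lead_coeff F * \<alpha> ^ m)"
      using m0 by (cases m) (simp_all add: mult_ac del: of_nat_Suc)
    finally show "(\<delta> * x * ev x (pderiv F)) $$ (int N + 1 - int m) = c * of_nat m * \<alpha>"
      by (simp only: x(4))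
  qed
  have split: "ev y F - power_subst 1 m y = (R + \<delta> * x * ev x (pderiv F))
    + ((ev y F - ev x F - \<delta> * x * ev x (pderiv F)) - (power_subst 1 m y - power_subst 1 m x))"
    by (simp add: R_def)
  have "ord_ge (int N + 1 - int m + 1) (R + \<delta> * x * ev x (pderiv F))"
  proof (rule ord_ge_Suc)
    show "ord_ge (int N + 1 - int m) (R + \<delta> * x * ev x (pderiv F))"
      using R D(1) unfolding R_def by (rule ord_ge_add)
    show "(R + \<delta> * x * ev x (pderiv F)) $$ (int N + 1 - int m) = 0"
      using D(2) deg x(3) by (simp add: c_def)
  qed
  moreover have "int N + 1 - int m + 1 = int N + 2 - int m" by simp
  ultimately have "ord_ge (int N + 2 - int m) (R + \<delta> * x * ev x (pderiv F))" by (simp only:)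
  from ord_ge_add[OF this ord_ge_diff[OF T S]]
  have "ord_ge (int N + 2 - int m) (ev y F - power_subst 1 m y)"
    by (simp only: split)
  moreover have "y $$ (-1) = \<alpha>"
  proof -
    have "(y - x) $$ (-1) = 0" using d by (simp add: ord_ge_def)
    then show ?thesis using x by simp
  qed
  moreover have "ord_ge (-1) y"
    using ord_ge_add[OF x(1) ord_ge_mono[OF d]] by simp
  ultimately show ?thesis using that d by blast
qed

text \<open>
  The initial term \<open>\<alpha> t\<^sup>-\<^sup>1\<close> has to satisfy \<open>lead_coeff F * \<alpha>\<^sup>m = \<alpha>\<close>, which is solvable because
  the field is algebraically closed. The recursion then determines the rest.
\<close>

theorem Boettcher_exists:
  fixes F :: "'a::alg_closed_field poly"
  assumes deg: "degree F = m" "m > 1" "of_nat m \<noteq> (0::'a)"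
  obtains x where "fls_subdegree x = -1" "ev x F = power_subst 1 m x"
proof -
  have m0: "m > 0" using deg by simp
  have F0: "lead_coeff F \<noteq> 0" using deg by auto
  obtain \<alpha> where "\<alpha> ^ (m - 1) = 1 / lead_coeff F"
    using nth_root_exists[of "m - 1" "1 / lead_coeff F"] deg by auto
  then have \<alpha>: "\<alpha> \<noteq> 0" "lead_coeff F * \<alpha> ^ m = \<alpha>"
    using F0 deg by (auto simp: power_0_left field_simps power_eq_if)
  define P where "P N x \<longleftrightarrow> ord_ge (-1) x \<and> x $$ (-1) = \<alpha> \<and>
    ord_ge (int N + 1 - int m) (ev x F - power_subst 1 m x)" for N :: nat and x
  have "\<exists>f. \<forall>n. P n (f n) \<and> ord_ge (int n) (f (Suc n) - f n)"
  proof (rule dependent_nat_choice)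
    define x where "x = fls_const \<alpha> * fls_X_inv"
    have x: "ord_ge (- int 1) x" "x $$ (-1) = \<alpha>" by (auto simp: x_def ord_ge_def)
    have dF: "degree F \<le> m" using deg by simp
    have "ord_ge (- int m) (ev x F)" using ord_ge_ev[OF x(1) dF] by simp
    moreover have "ord_ge (- int m) (power_subst 1 m x)"
      using ord_ge_power_subst[OF _ m0 x(1)] by simp
    ultimately have "ord_ge (- int m + 1) (ev x F - power_subst 1 m x)"
    proof (intro ord_ge_Suc ord_ge_diff)
      have "(- int m) div int m = -1"
        using m0 nonzero_mult_div_cancel_left[of "int m" "-1"] by simp
      then have "power_subst 1 m x $$ (- int m) = \<alpha>"
        using m0 x by (simp add: power_subst_nth)
      moreover have "ev x F $$ (- int m) = lead_coeff F * \<alpha> ^ m"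
        using ev_nth_top[OF x(1) _ dF] x by (simp add: deg)
      ultimately show "(ev x F - power_subst 1 m x) $$ - int m = 0" using \<alpha> by simp
    qed
    then show "\<exists>x. P 0 x" using x by (intro exI[of _ x]) (simp add: P_def add.commute)
  next
    fix x n assume "P n x"
    then show "\<exists>y. P (Suc n) y \<and> ord_ge (int n) (y - x)"
      unfolding P_def using Boettcher_step[OF deg _ _ \<alpha>, of x n]
      by (metis (no_types, lifting) add.assoc add.commute of_nat_Suc one_add_one)
  qed
  then obtain f where f: "\<And>n. P n (f n)" "\<And>n. ord_ge (int n) (f (Suc n) - f n)" by blast
  obtain x where x: "\<And>N. ord_ge (int N) (x - f N)" "ord_ge (-1) x"
    using fls_limit[of f] f unfolding P_def by blast
  have x1: "x $$ (-1) = \<alpha>"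
  proof -
    have "(x - f 0) $$ (-1) = 0" using x(1)[of 0] by (simp add: ord_ge_def)
    then show ?thesis using f(1)[of 0] by (simp add: P_def)
  qed
  have "ord_ge (int N - (int m - 1)) (ev x F - power_subst 1 m x)" for N
  proof -
    let ?y = "f N"
    have y: "ord_ge (- int 1) ?y" "?y $$ (-1) = \<alpha>" "ord_ge (int N + 1 - int m) (ev ?y F - power_subst 1 m ?y)"
      using f(1)[of N] by (simp_all add: P_def)
    have y0: "?y \<noteq> 0" "fls_subdegree ?y = -1"
      using y \<alpha> fls_subdegree_eq_of_ord_ge[of "-1" ?y] by auto
    define \<delta> where "\<delta> = (x - ?y) / ?y"
    have xy: "x = ?y * (1 + \<delta>)" using y0 by (simp add: \<delta>_def field_simps)
    have "x - ?y = ?y * \<delta>" using y0 by (simp add: \<delta>_def)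
    then have "ord_ge (int N - (-1)) \<delta>" using ord_ge_cancel[of "int N" ?y \<delta>] x(1)[of N] y0 by simp
    then have \<delta>: "ord_ge (int (N + 1)) \<delta>" by (simp add: add.commute)
    have 1: "ord_ge (int N + 1 - int m) (ev x F - ev ?y F)"
      using ord_ge_ev_perturb[OF y(1) \<delta>, of F] unfolding deg(1) by (subst xy) (simp add: add.commute)
    have 2: "ord_ge (int N + 1 - int m) (power_subst 1 m x - power_subst 1 m ?y)"
    proof -
      have "int N \<le> int m * int N" using m0 by (cases N) auto
      then have "int N + 1 - int m \<le> int m * int N" using deg(2) by linarith
      then have "ord_ge (int N + 1 - int m) (power_subst 1 m (x - ?y))"
        using ord_ge_power_subst[OF _ m0 x(1)[of N]] by (rule ord_ge_mono[rotated]) simp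
      then show ?thesis by (simp add: power_subst_diff m0)
    qed
    have "ev x F - power_subst 1 m x = (ev ?y F - power_subst 1 m ?y) + (ev x F - ev ?y F)
      - (power_subst 1 m x - power_subst 1 m ?y)" by simp
    then have "ord_ge (int N + 1 - int m) (ev x F - power_subst 1 m x)"
      by (metis 1 2 y(3) ord_ge_add ord_ge_diff)
    then show ?thesis by (simp add: algebra_simps)
  qed
  then have "ev x F - power_subst 1 m x = 0" by (rule ord_ge_eq_0)
  moreover have "fls_subdegree x = -1" using x(2) x1 \<alpha> by (intro fls_subdegree_eq_of_ord_ge) auto
  ultimately show ?thesis using that by simp
qed

section \<open>A relation forces a common coordinate\<close>

lemma power_subst_nth_top:
  assumes "\<zeta> \<noteq> 0" "N > 0"
  shows "power_subst \<zeta> N x $$ (- int N) = inverse \<zeta> * x $$ (-1)"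
proof -
  have "(- int N) div int N = -1"
    using assms nonzero_mult_div_cancel_left[of "int N" "-1"] by simp
  then show ?thesis using assms by (simp add: power_subst_nth)
qed

lemma fls_subdegree_power_subst:
  assumes "\<zeta> \<noteq> 0" "N > 0" "fls_subdegree x = -1"
  shows "fls_subdegree (power_subst \<zeta> N x) = - int N" "power_subst \<zeta> N x \<noteq> 0"
proof -
  have x: "x \<noteq> 0" "ord_ge (-1) x" using assms(3) ord_ge_subdegree[of x] by auto
  then have "x $$ (-1) \<noteq> 0" using assms(3) by (metis nth_fls_subdegree_nonzero)
  then have "power_subst \<zeta> N x $$ (- int N) \<noteq> 0" using assms by (simp add: power_subst_nth_top)
  moreover have "ord_ge (- int N) (power_subst \<zeta> N x)"
    using ord_ge_power_subst[OF assms(1,2) x(2)] by simp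
  ultimately show "fls_subdegree (power_subst \<zeta> N x) = - int N" by (rule fls_subdegree_eq_of_ord_ge[rotated])
  show "power_subst \<zeta> N x \<noteq> 0" using x assms by (simp add: power_subst_eq_0_iff)
qed

lemma power_subst_top_unique:
  assumes "\<zeta> \<noteq> 0" "\<xi> \<noteq> 0" "N > 0" "fls_subdegree x = -1"
    and "ord_ge 1 \<rho>" "ord_ge 1 \<sigma>"
    and eq: "power_subst \<zeta> N x * (1 + \<rho>) = power_subst \<xi> N x * (1 + \<sigma>)"
  shows "\<zeta> = \<xi>" "\<rho> = \<sigma>"
proof -
  have x: "x \<noteq> 0" using assms by auto
  then have x0: "x $$ (-1) \<noteq> 0" using assms(4) by (metis nth_fls_subdegree_nonzero)
  have o: "ord_ge (- int N) (power_subst c N x)" if "c \<noteq> 0" for c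
    using fls_subdegree_power_subst[OF that assms(3,4)] by (metis ord_ge_subdegree)
  have *: "(power_subst c N x * (1 + r)) $$ (- int N + 0) = inverse c * x $$ (-1)"
    if "c \<noteq> 0" "ord_ge 1 r" for c r
  proof -
    have "r $$ 0 = 0" using that(2) by (simp add: ord_ge_def)
    then show ?thesis
      by (subst nth_mult_ord_ge[OF o[OF that(1)]])
        (use that assms in \<open>auto simp: power_subst_nth_top intro!: ord_ge_add ord_ge_mono[OF that(2)]\<close>)
  qed
  have "inverse \<zeta> * x $$ (-1) = inverse \<xi> * x $$ (-1)"
    using *[OF assms(1,5)] *[OF assms(2,6)] eq by simp
  then show "\<zeta> = \<xi>" using x0 by simp
  with eq fls_subdegree_power_subst(2)[OF assms(1,3,4)] show "\<rho> = \<sigma>" by simp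
qed

text \<open>
  Composing on the right with \<open>F\<close>, which scales \<open>x\<close> exactly, replaces \<open>t\<close> by \<open>t\<^sup>m\<close> in the relative
  error and so multiplies its order by \<open>m\<close>.
\<close>

lemma relative_error_of_pcompose_exact:
  assumes x: "fls_subdegree x = -1" and A: "ev x A = power_subst \<zeta> N x * (1 + \<rho>)"
    and \<zeta>: "\<zeta> \<noteq> 0" "N > 0" and F: "ev x F = power_subst 1 m x" "m > 0"
  shows "ev x (A \<circ>\<^sub>p F) = power_subst \<zeta> (m * N) x * (1 + power_subst 1 m \<rho>)"
proof -
  have "ev x (A \<circ>\<^sub>p F) = power_subst 1 m (ev x A)"
    using F by (simp add: ev_pcompose power_subst_ev)
  also have "\<dots> = power_subst 1 m (power_subst \<zeta> N x) * (1 + power_subst 1 m \<rho>)"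
    using F by (simp add: A power_subst_mult power_subst_add power_subst_1)
  finally show ?thesis using F \<zeta> by (simp add: power_subst_power_subst)
qed

text \<open>
  Composing on the right with \<open>G\<close> pushes the old error \<open>\<rho>\<close> to order at least \<open>n k > k\<close> but introduces
  the error \<open>\<sigma>\<close> of \<open>G\<close>, multiplied to first order by the degree of \<open>A\<close> (the logarithmic derivative of a
  polynomial at infinity is its degree).
\<close>

lemma relative_error_of_pcompose:
  fixes x :: "'a::field fls"
  assumes x: "fls_subdegree x = -1" and A: "ev x A = power_subst \<zeta> N x * (1 + \<rho>)" "degree A = N"
    and \<zeta>: "\<zeta> \<noteq> 0" "N > 0" and \<rho>: "ord_ge (int k) \<rho>" and k: "k > 0"
    and G: "ev x G = power_subst \<gamma> n x * (1 + \<sigma>)" "n > 1" "\<gamma> \<noteq> 0" "ord_ge (int k) \<sigma>"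
  obtains \<tau> where "ev x (A \<circ>\<^sub>p G) = power_subst (\<zeta> * \<gamma> ^ N) (n * N) x * (1 + \<tau>)"
    "ord_ge (int k) \<tau>" "\<tau> $$ int k = of_nat N * \<sigma> $$ int k"
proof -
  have n0: "n > 0" using G by simp
  define X where "X = power_subst \<gamma> n x"
  have X: "fls_subdegree X = - int n" "X \<noteq> 0"
    using fls_subdegree_power_subst[OF G(3) n0 x] by (simp_all add: X_def)
  then have oX: "ord_ge (- int n) X" by (metis ord_ge_subdegree)
  define Z where "Z = power_subst (\<zeta> * \<gamma> ^ N) (n * N) x"
  have Z: "fls_subdegree Z = - int (n * N)" "Z \<noteq> 0"
    using fls_subdegree_power_subst[of "\<zeta> * \<gamma> ^ N" "n * N" x] G \<zeta> x n0 by (simp_all add: Z_def)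
  define \<rho>' where "\<rho>' = power_subst \<gamma> n \<rho>"
  have \<rho>': "ord_ge (int k + 1) \<rho>'"
  proof -
    have "ord_ge (int n * int k) \<rho>'" unfolding \<rho>'_def using G n0 \<rho> by (intro ord_ge_power_subst)
    moreover have "2 * int k \<le> int n * int k" using G(2) by (intro mult_right_mono) auto
    ultimately show ?thesis using k by (elim ord_ge_mono) linarith
  qed
  have evX: "ev X A = Z * (1 + \<rho>')"
  proof -
    have "ev X A = power_subst \<gamma> n (ev x A)" using G n0 by (simp add: X_def power_subst_ev)
    then show ?thesis using G n0 \<zeta>
      by (simp add: A power_subst_mult power_subst_add power_subst_1 power_subst_power_subst Z_def \<rho>'_def)
  qed
  define T where "T = ev (X * (1 + \<sigma>)) A - ev X A - \<sigma> * X * ev X (pderiv A)"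
  have T: "ord_ge (2 * int k - int n * int N) T"
    unfolding T_def using A(2) G(4) oX by (intro ord_ge_ev_Taylor) auto
  have oZi: "ord_ge (int n * int N) (inverse Z)"
  proof -
    have "fls_subdegree (Z * inverse Z) = fls_subdegree Z + fls_subdegree (inverse Z)"
      using Z by (intro fls_subdegree_mult) auto
    then show ?thesis using Z by (simp add: ord_ge_iff_subdegree)
  qed
  define L where "L = X * ev X (pderiv A)"
  have dA: "degree (pderiv A) \<le> N - 1" using degree_pderiv_le[of A] A by simp
  have eN: "- (int n * int N) = - int n + - (int n * int (N - 1))"
  proof -
    obtain N' where "N = Suc N'" using \<zeta>(2) by (cases N) auto
    then show ?thesis by (simp add: distrib_left)
  qed
  have oL: "ord_ge (- (int n * int N)) L"
    unfolding L_def eN using oX dA by (intro ord_ge_mult ord_ge_ev) auto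
  have X0: "X $$ (- int n) \<noteq> 0" using X by (metis nth_fls_subdegree_nonzero)
  have "L $$ (- (int n * int N)) = of_nat N * (lead_coeff A * (X $$ (- int n)) ^ N)"
    unfolding L_def eN
    by (subst nth_mult_ord_ge[OF oX ord_ge_ev[OF oX dA]], subst ev_nth_top[OF oX n0 dA])
      (use \<zeta>(2) A(2) in \<open>cases N; simp add: coeff_pderiv mult_ac del: of_nat_Suc\<close>)
  also have "lead_coeff A * (X $$ (- int n)) ^ N = ev X A $$ (- (int n * int N))"
    using ev_nth_top[OF oX n0, of A N] A by simp
  also have "\<dots> = Z $$ (- (int n * int N))"
  proof -
    have "ord_ge (- (int n * int N)) Z" using Z by (metis ord_ge_subdegree of_nat_mult)
    moreover have "\<rho>' $$ 0 = 0" using \<rho>' by (simp add: ord_ge_def)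
    moreover have "ord_ge 0 (1 + \<rho>')" by (intro ord_ge_add ord_ge_mono[OF \<rho>']) auto
    ultimately show ?thesis unfolding evX using nth_mult_ord_ge[of "- (int n * int N)" Z 0 "1 + \<rho>'"] by simp
  qed
  finally have Ltop: "L $$ (- (int n * int N)) = of_nat N * Z $$ (- (int n * int N))" .
  have LZ: "(L * inverse Z) $$ 0 = of_nat N" "ord_ge 0 (L * inverse Z)"
  proof -
    have "(L * inverse Z) $$ (- (int n * int N) + int n * int N)
        = L $$ (- (int n * int N)) * inverse Z $$ (int n * int N)"
      by (rule nth_mult_ord_ge[OF oL oZi])
    moreover have "Z $$ (- (int n * int N)) * inverse Z $$ (int n * int N) = 1"
    proof -
      have "ord_ge (- (int n * int N)) Z" using Z by (metis ord_ge_subdegree of_nat_mult)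
      from nth_mult_ord_ge[OF this oZi] show ?thesis using Z by simp
    qed
    ultimately show "(L * inverse Z) $$ 0 = of_nat N" by (simp add: Ltop mult.assoc)
    show "ord_ge 0 (L * inverse Z)" using ord_ge_mult[OF oL oZi] by simp
  qed
  define \<tau> where "\<tau> = \<rho>' + \<sigma> * (L * inverse Z) + T * inverse Z"
  have "ev x (A \<circ>\<^sub>p G) = ev (X * (1 + \<sigma>)) A" by (simp add: ev_pcompose G X_def)
  also have "\<dots> = Z * (1 + \<rho>') + \<sigma> * L + T"
    using evX by (simp add: T_def L_def mult.assoc)
  also have "\<dots> = Z * (1 + \<tau>)" using Z by (simp add: \<tau>_def distrib_left mult.left_commute[of Z])
  finally have "ev x (A \<circ>\<^sub>p G) = power_subst (\<zeta> * \<gamma> ^ N) (n * N) x * (1 + \<tau>)" by (simp add: Z_def)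
  moreover have oT: "ord_ge (int k + 1) (T * inverse Z)"
    by (rule ord_ge_mono[OF ord_ge_mult[OF T oZi]]) (use k in simp)
  have "ord_ge (int k) \<tau>" unfolding \<tau>_def
    using ord_ge_mult[OF G(4) LZ(2)] by (intro ord_ge_add ord_ge_mono[OF \<rho>'] ord_ge_mono[OF oT]) auto
  moreover have "\<tau> $$ int k = of_nat N * \<sigma> $$ int k"
  proof -
    have "(\<sigma> * (L * inverse Z)) $$ (int k + 0) = \<sigma> $$ int k * of_nat N"
      by (subst nth_mult_ord_ge[OF G(4) LZ(2)]) (simp add: LZ)
    moreover have "\<rho>' $$ int k = 0" "(T * inverse Z) $$ int k = 0"
      using \<rho>' oT by (simp_all add: ord_ge_def)
    ultimately show ?thesis by (simp add: \<tau>_def mult.commute)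
  qed
  ultimately show ?thesis using that by blast
qed

lemma of_nat_degree_comp_word:
  fixes F G :: "'a::field poly"
  assumes "of_nat (degree F) \<noteq> (0::'a)" "of_nat (degree G) \<noteq> (0::'a)"
  shows "of_nat (degree (comp_word F G w)) \<noteq> (0::'a)"
  by (induction w) (use assms in \<open>auto simp: comp_word_Cons degree_pcompose split: letter.split\<close>)

text \<open>
  Suppose that the relative error \<open>\<sigma>\<close> of \<open>G\<close> has finite order \<open>k\<close>. On the left of the relation the
  error has order greater than \<open>k\<close>, and on the right its coefficient at \<open>t\<^sup>k\<close> is that of \<open>\<sigma>\<close> times the
  degree of a word, which is invertible in the field.
\<close>

theorem common_Boettcher:
  fixes F G :: "'a::field poly"
  assumes deg: "degree F = m" "degree G = n" "m > 1" "n > 1"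
      "of_nat m \<noteq> (0::'a)" "of_nat n \<noteq> (0::'a)"
    and x: "fls_subdegree x = -1" and F: "ev x F = power_subst 1 m x"
    and rel: "comp_word F G a \<circ>\<^sub>p F = comp_word F G b \<circ>\<^sub>p G"
  obtains \<gamma> where "\<gamma> \<noteq> 0" "ev x G = power_subst \<gamma> n x"
proof -
  have n0: "n > 0" "m > 0" using deg by auto
  have x0: "x $$ (-1) \<noteq> 0" "x \<noteq> 0" "ord_ge (-1) x" using x ord_ge_subdegree[of x]
    by (metis nth_fls_subdegree_nonzero fls_zero_subdegree neg_equal_0_iff_equal one_neq_zero, auto)
  have Gn: "ev x G $$ (- int n) = lead_coeff G * (x $$ (-1)) ^ n"
    using ev_nth_top[of 1 x G n] x0 deg by simp
  have G0: "lead_coeff G \<noteq> 0" using deg by auto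
  define \<gamma> where "\<gamma> = x $$ (-1) / (lead_coeff G * (x $$ (-1)) ^ n)"
  have \<gamma>: "\<gamma> \<noteq> 0" using x0 G0 by (simp add: \<gamma>_def)
  \<comment> \<open>The relative error of \<open>G\<close>, of positive order by the choice of \<open>\<gamma>\<close>.\<close>
  define \<sigma> where "\<sigma> = ev x G / power_subst \<gamma> n x - 1"
  note X = fls_subdegree_power_subst[OF \<gamma> n0(1) x]
  have G: "ev x G = power_subst \<gamma> n x * (1 + \<sigma>)" using X by (simp add: \<sigma>_def)
  have "power_subst \<gamma> n x * \<sigma> = ev x G - power_subst \<gamma> n x" by (simp add: G algebra_simps)
  moreover have "ord_ge (- int n + 1) (ev x G - power_subst \<gamma> n x)"
  proof (rule ord_ge_Suc)
    show "ord_ge (- int n) (ev x G - power_subst \<gamma> n x)"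
      using ord_ge_ev[of 1 x G n] x0 deg X by (intro ord_ge_diff) (auto simp: ord_ge_iff_subdegree)
    show "(ev x G - power_subst \<gamma> n x) $$ - int n = 0"
      using Gn power_subst_nth_top[OF \<gamma> n0(1)] x0 G0 by (simp add: \<gamma>_def)
  qed
  ultimately have \<sigma>: "ord_ge 1 \<sigma>" using ord_ge_cancel[of "- int n + 1" "power_subst \<gamma> n x" \<sigma>] X by simp
  have "\<sigma> = 0"
  proof (rule ccontr)
    assume nz: "\<sigma> \<noteq> 0"
    define k where "k = nat (fls_subdegree \<sigma>)"
    have k: "int k = fls_subdegree \<sigma>" "k > 0" using \<sigma> nz by (auto simp: k_def ord_ge_iff_subdegree)
    have \<sigma>k: "ord_ge (int k) \<sigma>" "\<sigma> $$ int k \<noteq> 0"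
      using nz by (simp_all add: k ord_ge_subdegree)
    let ?deg = "\<lambda>w. degree (comp_word F G w)"
    have pos: "?deg w > 0" for w using degree_comp_word_pos[of F G] deg by simp
    have words: "\<exists>\<zeta> \<rho>. \<zeta> \<noteq> 0 \<and> ord_ge (int k) \<rho> \<and>
        ev x (comp_word F G w) = power_subst \<zeta> (?deg w) x * (1 + \<rho>)" for w
    proof (induction w rule: rev_induct)
      case Nil
      have "power_subst 1 1 x = x" by (intro fls_eqI) (simp add: power_subst_nth)
      then show ?case by (intro exI[of _ 1] exI[of _ 0]) simp
    next
      case (snoc l w)
      then obtain \<zeta> \<rho> where w: "\<zeta> \<noteq> 0" "ord_ge (int k) \<rho>"
        "ev x (comp_word F G w) = power_subst \<zeta> (?deg w) x * (1 + \<rho>)" by blast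
      show ?case
      proof (cases l)
        case LetterF
        have "ord_ge (int k) (power_subst 1 m \<rho>)"
        proof -
          have "int k \<le> int m * int k" using mult_right_mono[of 1 "int m" "int k"] n0 by simp
          then show ?thesis using ord_ge_power_subst[OF _ n0(2) w(2), of 1] by (auto elim: ord_ge_mono)
        qed
        moreover have "comp_word F G (w @ [l]) = comp_word F G w \<circ>\<^sub>p F" "?deg (w @ [l]) = m * ?deg w"
          using LetterF deg by (simp_all add: comp_word_snoc degree_pcompose mult.commute)
        ultimately show ?thesis
          using relative_error_of_pcompose_exact[OF x w(3,1) pos F n0(2)] w(1) by metis
      next
        case LetterG
        obtain \<tau> where \<tau>: "ev x (comp_word F G w \<circ>\<^sub>p G) = power_subst (\<zeta> * \<gamma> ^ ?deg w) (n * ?deg w) x * (1 + \<tau>)"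
          "ord_ge (int k) \<tau>"
          by (rule relative_error_of_pcompose[OF x w(3) refl w(1) pos w(2) k(2) G deg(4) \<gamma> \<sigma>k(1)])
        have "comp_word F G (w @ [l]) = comp_word F G w \<circ>\<^sub>p G" "?deg (w @ [l]) = n * ?deg w"
          using LetterG deg by (simp_all add: comp_word_snoc degree_pcompose mult.commute)
        moreover have "\<zeta> * \<gamma> ^ ?deg w \<noteq> 0" using w(1) \<gamma> by simp
        ultimately show ?thesis using \<tau> by metis
      qed
    qed
    obtain \<zeta> \<rho> where A: "\<zeta> \<noteq> 0" "ord_ge (int k) \<rho>"
        "ev x (comp_word F G a) = power_subst \<zeta> (?deg a) x * (1 + \<rho>)" using words by blast
    obtain \<xi> \<rho>' where B: "\<xi> \<noteq> 0" "ord_ge (int k) \<rho>'"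
        "ev x (comp_word F G b) = power_subst \<xi> (?deg b) x * (1 + \<rho>')" using words by blast
    have AF: "ev x (comp_word F G a \<circ>\<^sub>p F) = power_subst \<zeta> (m * ?deg a) x * (1 + power_subst 1 m \<rho>)"
      by (rule relative_error_of_pcompose_exact[OF x A(3,1) pos F n0(2)])
    obtain \<tau> where BG: "ev x (comp_word F G b \<circ>\<^sub>p G) = power_subst (\<xi> * \<gamma> ^ ?deg b) (n * ?deg b) x * (1 + \<tau>)"
      "ord_ge (int k) \<tau>" "\<tau> $$ int k = of_nat (?deg b) * \<sigma> $$ int k"
      by (rule relative_error_of_pcompose[OF x B(3) refl B(1) pos B(2) k(2) G deg(4) \<gamma> \<sigma>k(1)])
    have "m * ?deg a = n * ?deg b"
      using arg_cong[OF rel, of degree] deg by (simp add: degree_pcompose mult.commute)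
    then have eq: "power_subst \<zeta> (n * ?deg b) x * (1 + power_subst 1 m \<rho>)
        = power_subst (\<xi> * \<gamma> ^ ?deg b) (n * ?deg b) x * (1 + \<tau>)"
      using AF BG(1) rel by simp
    have big: "ord_ge (int k + 1) (power_subst 1 m \<rho>)"
    proof -
      have "2 * int k \<le> int m * int k" using deg by (intro mult_right_mono) auto
      then have "int k + 1 \<le> int m * int k" using k(2) by linarith
      then show ?thesis using ord_ge_power_subst[OF _ n0(2) A(2), of 1] by (auto elim: ord_ge_mono)
    qed
    have "power_subst 1 m \<rho> = \<tau>"
      by (rule power_subst_top_unique(2)[OF _ _ _ x _ _ eq])
        (use A B \<gamma> n0 pos k in \<open>auto intro: ord_ge_mono[OF big] ord_ge_mono[OF BG(2)]\<close>)
    then have "\<tau> $$ int k = 0" using big by (simp add: ord_ge_def)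
    then show False using BG(3) \<sigma>k(2) of_nat_degree_comp_word[of F G b] deg by simp
  qed
  then show ?thesis using that \<gamma> G by simp
qed

section \<open>Polynomials scaling a coordinate, and commensurable degrees\<close>

lemma polynomial_in_residue_class:
  fixes H :: "'b::comm_ring_1 poly"
  assumes "s > 0" "\<And>i. coeff H i \<noteq> 0 \<Longrightarrow> i mod s = r" "r < s"
  obtains C where "H = monom 1 r * (C \<circ>\<^sub>p monom 1 s)"
proof
  define C where "C = (\<Sum>j\<le>degree H. monom (coeff H (r + s * j)) j)"
  have "monom 1 r * (C \<circ>\<^sub>p monom 1 s) = (\<Sum>j\<le>degree H. monom (coeff H (r + s * j)) (r + s * j))"
    by (simp add: C_def pcompose_sum monom_pcompose_monom sum_distrib_left mult_monom mult.commute)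
  also have "\<dots> = H"
  proof (rule poly_eqI)
    fix i
    have *: "(\<Sum>j\<le>degree H. coeff (monom (coeff H (r + s * j)) (r + s * j)) i)
      = (\<Sum>j\<le>degree H. if r + s * j = i then coeff H i else 0)"
      by (intro sum.cong) auto
    show "coeff (\<Sum>j\<le>degree H. monom (coeff H (r + s * j)) (r + s * j)) i = coeff H i"
    proof (cases "coeff H i = 0")
      case True
      then show ?thesis by (simp only: coeff_sum *) simp
    next
      case False
      then have i: "i = r + s * (i div s)" using assms(2)[OF False] by (metis add.commute mult_div_mod_eq)
      have "i \<le> degree H" using False by (rule le_degree)
      then have "i div s \<le> degree H" by (meson div_le_dividend le_trans)
      moreover have "r + s * j = i \<longleftrightarrow> j = i div s" for j
        using i assms(1,3) by auto
      ultimately show ?thesis by (simp only: coeff_sum *) simp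
    qed
  qed
  finally show "H = monom 1 r * (C \<circ>\<^sub>p monom 1 s)" by simp
qed

text \<open>
  A coordinate at infinity normalised by a linear change of variable: \<open>x = t\<^sup>-\<^sup>1 + O(t)\<close>, with no constant term.
\<close>

locale normalized_coordinate =
  fixes x :: "'a::alg_closed_field fls"
  assumes x_form: "ord_ge 1 (x - fls_X_inv)"
begin

lemma x_nth_neg1 [simp]: "x $$ (-1) = 1"
proof -
  have "(x - fls_X_inv) $$ (-1) = 0" using x_form by (simp add: ord_ge_def)
  then show ?thesis by simp
qed

lemma x_nth_0 [simp]: "x $$ 0 = 0"
proof -
  have "(x - fls_X_inv) $$ 0 = 0" using x_form by (simp add: ord_ge_def)
  then show ?thesis by simp
qed

lemma ord_ge_x: "ord_ge (-1) x"
  using ord_ge_add[OF ord_ge_mono[OF x_form] ord_ge_X_inv] by simp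

lemma subdegree_x [simp]: "fls_subdegree x = -1"
  using ord_ge_x by (rule fls_subdegree_eq_of_ord_ge) simp

lemma x_nonzero [simp]: "x \<noteq> 0"
  using subdegree_x by force

definition scales :: "'a poly \<Rightarrow> 'a \<Rightarrow> nat \<Rightarrow> bool" where
  "scales P z M \<longleftrightarrow> z \<noteq> 0 \<and> M > 0 \<and> ev x P = power_subst z M x"

lemma degree_scales:
  assumes "scales P z M" shows "degree P = M"
proof -
  have "fls_subdegree (ev x P) = - int M" "ev x P \<noteq> 0"
    using assms fls_subdegree_power_subst[of z M x] by (auto simp: scales_def)
  then show ?thesis using fls_subdegree_ev[of x 1 P] by (cases "P = 0") auto
qed

lemma scales_id: "scales [:0, 1:] 1 1"
proof -
  have "power_subst 1 1 x = x" by (intro fls_eqI) (simp add: power_subst_nth)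
  then show ?thesis by (simp add: scales_def)
qed

lemma scales_pcompose:
  assumes "scales P z M" "scales Q y N" shows "scales (P \<circ>\<^sub>p Q) (z * y ^ M) (M * N)"
  using assms by (auto simp: scales_def ev_pcompose power_subst_power_subst mult.commute simp flip: power_subst_ev)

lemma scales_comp_pow:
  assumes "scales P z M" shows "\<exists>y. scales (comp_pow P i) y (M ^ i)"
proof (induction i)
  case 0
  then show ?case using scales_id by (auto simp: comp_pow_def)
next
  case (Suc i)
  then show ?case using scales_pcompose[OF assms] by (auto simp: comp_pow_def)
qed

text \<open>
  Values of polynomials at \<open>x\<close> realise every polar part including the constant term, so each series
  has a unique nearest polynomial value.
\<close>

lemma polynomial_part: "\<exists>A. ord_ge 1 (ev x A - f)"
proof -
  have "\<exists>A. ord_ge 1 (ev x A - f)" if "ord_ge (- int k) f" for f k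
    using that
  proof (induction k arbitrary: f)
    case 0
    have "ord_ge (0 + 1) (ev x [:f $$ 0:] - f)"
      using 0 by (intro ord_ge_Suc ord_ge_diff) auto
    then show ?case by (intro exI[of _ "[:f $$ 0:]"]) simp
  next
    case (Suc k)
    let ?M = "monom (f $$ (- int (Suc k))) (Suc k)"
    have xi: "ord_ge (- int 1) x" using ord_ge_x by simp
    have o: "ord_ge (- (int 1 * int (Suc k))) (ev x ?M)"
      by (rule ord_ge_ev[OF xi degree_monom_le])
    have c: "ev x ?M $$ (- (int 1 * int (Suc k))) = f $$ (- int (Suc k))"
    proof -
      have "x $$ (- int 1) = 1" by simp
      with ev_nth_top[OF xi zero_less_one degree_monom_le, of "f $$ (- int (Suc k))" "Suc k"]
      show ?thesis by (simp only: coeff_monom power_one mult_1_right if_True simp_thms)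
    qed
    note oc = o[unfolded of_nat_1 mult_1_left] c[unfolded of_nat_1 mult_1_left]
    have "ord_ge (- int (Suc k) + 1) (f - ev x ?M)"
    proof (intro ord_ge_Suc ord_ge_diff Suc.prems oc(1))
      show "(f - ev x ?M) $$ (- int (Suc k)) = 0" by (simp only: fls_minus_nth oc(2) diff_self)
    qed
    then have "ord_ge (- int k) (f - ev x ?M)" by simp
    then obtain A where "ord_ge 1 (ev x A - (f - ev x ?M))" using Suc.IH by blast
    then have "ord_ge 1 (ev x (A + ?M) - f)" by (simp add: ev_add algebra_simps del: of_nat_Suc)
    then show ?case by blast
  qed
  moreover have "ord_ge (- int (nat (- fls_subdegree f))) f"
    by (rule ord_ge_mono[OF ord_ge_subdegree]) simp
  ultimately show ?thesis by blast
qed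

text \<open>
  Exact division with respect to composition. The quotient is the polynomial part of the series that it
  ought to be, \<open>x(\<eta> t\<^sup>k)\<close>. The error of that choice has positive order and stays so after \<open>t \<mapsto> z t\<^sup>M\<close>,
  where it becomes the value of a polynomial and hence vanishes.
\<close>

lemma scales_divide:
  assumes P: "scales P z M" and Q: "scales Q y (M * k)" and k: "k > 0"
  obtains A w where "scales A w k" "Q = A \<circ>\<^sub>p P"
proof -
  define \<eta> where "\<eta> = y / z ^ k"
  have z: "z \<noteq> 0" "M > 0" "ev x P = power_subst z M x" and y: "y \<noteq> 0" "ev x Q = power_subst y (M * k) x"
    using P Q by (auto simp: scales_def)
  have \<eta>: "\<eta> \<noteq> 0" using y z by (simp add: \<eta>_def)
  obtain A where A: "ord_ge 1 (ev x A - power_subst \<eta> k x)" using polynomial_part by blast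
  have eq: "power_subst z M (power_subst \<eta> k x) = ev x Q"
    using z y k \<eta> by (simp add: power_subst_power_subst) (simp add: \<eta>_def)
  have eqA: "power_subst z M (ev x A) = ev x (A \<circ>\<^sub>p P)"
    using z by (simp add: power_subst_ev ev_pcompose)
  have "ord_ge (int M * 1) (power_subst z M (ev x A - power_subst \<eta> k x))"
    using A z by (intro ord_ge_power_subst)
  then have "ord_ge 1 (ev x (A \<circ>\<^sub>p P - Q))"
    using z by (simp add: power_subst_diff eq eqA ev_diff) (auto elim: ord_ge_mono)
  then have *: "A \<circ>\<^sub>p P - Q = 0" by (rule ev_eq_0I[rotated]) simp
  then have "power_subst z M (ev x A) = power_subst z M (power_subst \<eta> k x)"
    using eq eqA by simp
  then have "ev x A = power_subst \<eta> k x" using z by (simp add: power_subst_cancel)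
  then have "scales A \<eta> k" using \<eta> k by (simp add: scales_def)
  then show ?thesis using that * by simp
qed

lemma scales_linear:
  assumes "scales A w 1" shows "A = [:0, inverse w:]"
proof -
  have w: "w \<noteq> 0" "ev x A = power_subst w 1 x" using assms by (auto simp: scales_def)
  have "degree A = 1" using degree_scales[OF assms] .
  then obtain c l where A: "A = [:c, l:]" by (metis degree1_coeffs)
  have "ev x A = fls_const c + fls_const l * x" by (simp add: A ev_pCons mult.commute)
  then have nth: "(fls_const c + fls_const l * x) $$ i = power_subst w 1 x $$ i" for i using w by simp
  show ?thesis using nth[of 0] nth[of "-1"] w(1) by (simp add: A power_subst_nth power_int_minus)
qed

lemma scales_linear_iff: "w \<noteq> 0 \<Longrightarrow> scales [:0, inverse w:] w 1 \<longleftrightarrow> power_subst w 1 x = fls_const (inverse w) * x"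
  by (auto simp: scales_def ev_pCons mult.commute)

lemma comp_pow_Suc_right: "comp_pow H (Suc i) = comp_pow H i \<circ>\<^sub>p (H :: 'b::comm_semiring_1 poly)"
  by (induction i) (simp_all add: comp_pow_def pcompose_idR pcompose_X_left pcompose_assoc)

text \<open>
  Take \<open>H\<close> of least degree \<open>h > 1\<close> among the scaling polynomials of degree commensurable with \<open>m\<close>.
  Comparing powers shows that \<open>h\<close> divides every such degree, so one can divide by \<open>H\<close> until a linear
  polynomial remains.
\<close>

lemma scales_common_root:
  assumes F: "scales F z m" and m: "m > 1"
  obtains H y h where "scales H y h" "h > 1"
    "\<And>P w N a b. scales P w N \<Longrightarrow> a > 0 \<Longrightarrow> N ^ a = m ^ b \<Longrightarrow>
       \<exists>i v. P = smult (inverse v) (comp_pow H i) \<and> scales [:0, inverse v:] v 1"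
proof -
  define D where "D h \<longleftrightarrow> h > 1 \<and> (\<exists>H y. scales H y h) \<and> (\<exists>a>0. \<exists>b>0. h ^ a = m ^ b)" for h
  have "D m" unfolding D_def using F m by (metis zero_less_one)
  define h where "h = (LEAST h. D h)"
  have h: "D h" "\<And>N. D N \<Longrightarrow> h \<le> N" unfolding h_def using \<open>D m\<close> by (auto intro: LeastI Least_le)
  obtain H y a' b' where H: "scales H y h" "h > 1" "a' > 0" "b' > 0" "h ^ a' = m ^ b'"
    using h(1) unfolding D_def by blast
  have "\<exists>i v. P = smult (inverse v) (comp_pow H i) \<and> scales [:0, inverse v:] v 1"
    if "scales P w N" "a > 0" "N ^ a = m ^ b" for P w N a b
    using that
  proof (induction N arbitrary: P w a b rule: less_induct)
    case (less N)
    show ?case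
    proof (cases "N = 1")
      case True
      then show ?thesis using less.prems(1) scales_linear[of P w]
        by (intro exI[of _ 0] exI[of _ w]) (auto simp: comp_pow_def)
    next
      case False
      have "N > 0" using less.prems(1) by (simp add: scales_def)
      with False have N1: "N > 1" by simp
      have "b > 0" using less.prems N1 by (cases b) auto
      then have "D N" using less.prems N1 unfolding D_def by blast
      then have hN: "h \<le> N" by (rule h(2))
      have eq: "N ^ (a * b') = h ^ (a' * b)"
      proof -
        have "N ^ (a * b') = (m ^ b) ^ b'" by (simp add: power_mult less.prems)
        also have "\<dots> = (m ^ b') ^ b" by (simp add: mult.commute flip: power_mult)
        finally show ?thesis by (simp add: power_mult H(5))
      qed
      have le: "a * b' \<le> a' * b"
      proof (rule ccontr)
        assume "\<not> ?thesis"
        then have "h ^ (a' * b) < h ^ (a * b')" using H(2) by (intro power_strict_increasing) auto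
        also have "\<dots> \<le> N ^ (a * b')" using hN by (rule power_mono) simp
        finally show False using eq by simp
      qed
      have ab: "a * b' > 0" using less.prems H by simp
      have "h ^ (a * b') dvd N ^ (a * b')" unfolding eq using le by (rule le_imp_power_dvd)
      then have "h dvd N" using ab by (simp add: pow_divides_pow_iff)
      then obtain k where k: "N = h * k" by blast
      have k0: "k > 0" using k N1 by (cases k) auto
      have kN: "k < N" using k k0 H(2) by simp
      obtain A u where A: "scales A u k" "P = A \<circ>\<^sub>p H"
        using scales_divide[OF H(1) _ k0, of P w] less.prems(1) k by auto
      have "k ^ (a * b') * h ^ (a * b') = h ^ (a' * b - a * b') * h ^ (a * b')"
        using eq le by (simp add: k power_mult_distrib mult.commute flip: power_add)
      then have "k ^ (a * b') = h ^ (a' * b - a * b')" using H(2) by simp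
      then have "k ^ (a * b' * a') = (h ^ a') ^ (a' * b - a * b')"
        by (metis mult.commute power_mult)
      then have "k ^ (a * b' * a') = m ^ (b' * (a' * b - a * b'))" by (simp add: H(5) power_mult)
      moreover have "a * b' * a' > 0" using ab H by simp
      ultimately obtain i v where iv: "A = smult (inverse v) (comp_pow H i)" "scales [:0, inverse v:] v 1"
        using less.IH[OF kN A(1)] by blast
      have "P = smult (inverse v) (comp_pow H (Suc i))"
        by (simp add: A(2) iv(1) comp_pow_Suc_right pcompose_smult)
      then show ?thesis using iv(2) by blast
    qed
  qed
  then show ?thesis using that H by blast
qed

text \<open>
  The coefficient of \<open>t\<^sup>k\<close> in \<open>x(v t) = v\<^sup>-\<^sup>1 x(t)\<close>.
\<close>

lemma root_of_unity_of_scales_linear: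
  assumes "x $$ int k \<noteq> 0" "scales [:0, inverse v:] v 1" shows "inverse v ^ Suc k = 1"
proof -
  have v: "v \<noteq> 0" using assms by (auto simp: scales_def)
  have "power_subst v 1 x $$ int k = (fls_const (inverse v) * x) $$ int k"
    using assms(2) scales_linear_iff[OF v] by metis
  then have "v ^ k = inverse v" using assms(1) v by (simp add: power_subst_nth)
  then have "v ^ k * v = 1" using v by (simp add: field_simps)
  then have "inverse (v ^ Suc k) = 1" by (simp add: mult.commute)
  then show ?thesis by (simp only: power_inverse)
qed

text \<open>
  Evaluating \<open>x\<close> at \<open>y (v t)\<^sup>h = v\<^sup>h (y t\<^sup>h)\<close> in two ways gives \<open>H(v\<^sup>-\<^sup>1 X) = v\<^sup>-\<^sup>h H(X)\<close>. Then compare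
  coefficients.
\<close>

lemma coeff_scales_linear:
  assumes H: "scales H y h" and v: "scales [:0, inverse v:] v 1" and i: "coeff H i \<noteq> 0"
  shows "inverse v ^ i = inverse v ^ h"
proof -
  let ?\<alpha> = "inverse v"
  have v0: "v \<noteq> 0" using v by (simp add: scales_def)
  have lin: "power_subst v 1 x = fls_const ?\<alpha> * x" using v scales_linear_iff[OF v0] by metis
  have pow: "power_subst (v ^ j) 1 x = fls_const (?\<alpha> ^ j) * x" for j
  proof (induction j)
    case 0
    then show ?case using scales_id by (simp add: scales_def)
  next
    case (Suc j)
    have "power_subst (v ^ Suc j) 1 x = power_subst v 1 (power_subst (v ^ j) 1 x)"
      using v0 by (simp add: power_subst_power_subst mult.commute)
    also have "\<dots> = fls_const (?\<alpha> ^ j) * power_subst v 1 x"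
      unfolding Suc power_subst_mult[OF v0 zero_less_one] power_subst_const[OF v0 zero_less_one] ..
    also have "\<dots> = fls_const (?\<alpha> ^ Suc j) * x"
      by (simp only: lin power_Suc2 fls_const_mult_const[symmetric] mult.assoc)
    finally show ?case .
  qed
  have y: "y \<noteq> 0" "h > 0" "ev x H = power_subst y h x" using H by (auto simp: scales_def)
  have "ev x (H \<circ>\<^sub>p [:0, ?\<alpha>:]) = power_subst v 1 (power_subst y h x)"
    using v v0 by (simp add: ev_pcompose scales_def power_subst_ev flip: y(3))
  also have "\<dots> = power_subst y h (power_subst (v ^ h) 1 x)"
    using v0 y by (simp add: power_subst_power_subst mult.commute)
  also have "\<dots> = ev x (smult (?\<alpha> ^ h) H)"
    unfolding pow power_subst_mult[OF y(1,2)] power_subst_const[OF y(1,2)] ev_smult y(3) ..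
  finally have "H \<circ>\<^sub>p [:0, ?\<alpha>:] = smult (?\<alpha> ^ h) H" by (rule ev_inj[rotated]) simp
  then have "coeff (H \<circ>\<^sub>p [:0, ?\<alpha>:]) i = ?\<alpha> ^ h * coeff H i" by simp
  moreover have "coeff (H \<circ>\<^sub>p [:0, ?\<alpha>:]) i = ?\<alpha> ^ i * coeff H i"
    by (simp add: coeff_pcompose_linear)
  ultimately show ?thesis using i by simp
qed

text \<open>
  The linear factors \<open>\<alpha>, \<beta>\<close> are roots of unity because \<open>x\<close> has a nonzero coefficient beyond its pole.
  Let \<open>s\<close> be the least common exponent with \<open>\<alpha>\<^sup>s = \<beta>\<^sup>s = 1\<close>. All exponents \<open>i\<close> occurring in \<open>H\<close> have the
  same \<open>\<alpha>\<^sup>i\<close> and \<open>\<beta>\<^sup>i\<close>, so they agree modulo \<open>s\<close>.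
\<close>

theorem iterates_of_commensurable_degrees:
  assumes F: "scales F z m" and G: "scales G y n" and m: "m > 1" "n > 1"
    and ab: "a > 0" "n ^ a = m ^ b" and x: "x \<noteq> fls_X_inv"
  obtains i j r s :: nat and C H :: "'a poly" and \<alpha> \<beta> where
    "i > 0" "j > 0" "s > 0" "H = monom 1 r * (C \<circ>\<^sub>p monom 1 s)" "\<alpha> \<noteq> 0" "\<beta> \<noteq> 0"
    "\<alpha> ^ s = 1" "\<beta> ^ s = 1" "F = smult \<alpha> (comp_pow H i)" "G = smult \<beta> (comp_pow H j)"
proof -
  obtain H w h where H: "scales H w h" "h > 1" and root:
    "\<And>P w N a b. scales P w N \<Longrightarrow> a > 0 \<Longrightarrow> N ^ a = m ^ b \<Longrightarrow>
       \<exists>i v. P = smult (inverse v) (comp_pow H i) \<and> scales [:0, inverse v:] v 1"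
    using scales_common_root[OF F m(1)] by blast
  obtain i v where i: "F = smult (inverse v) (comp_pow H i)" "scales [:0, inverse v:] v 1"
    using root[OF F, of 1 1] by auto
  obtain j u where j: "G = smult (inverse u) (comp_pow H j)" "scales [:0, inverse u:] u 1"
    using root[OF G ab] by auto
  have "comp_pow H 0 = [:0, 1:]" by (simp add: comp_pow_def)
  then have "degree (smult c (comp_pow H 0)) \<le> 1" for c
    using degree_smult_le[of c "[:0, 1:] :: 'a poly"] by simp
  then have ij: "i > 0" "j > 0"
    using degree_scales[OF F] degree_scales[OF G] m i(1) j(1) by (metis not_gr_zero linorder_not_less)+
  obtain l where l: "(x - fls_X_inv) $$ l \<noteq> 0" using x by (metis eq_iff_diff_eq_0 fls_nonzeroI fls_zero_nth fls_eqI)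
  then have "l \<ge> 1" using x_form unfolding ord_ge_def by force
  then obtain k where k: "l = int k" using nonneg_int_cases[of l] by auto
  have xk: "x $$ int k \<noteq> 0" using l k \<open>l \<ge> 1\<close> by (simp add: fls_X_inv_nth)
  define \<alpha> where "\<alpha> = inverse v"
  define \<beta> where "\<beta> = inverse u"
  \<comment> \<open>The exponent \<open>k + 1\<close> shows that a common order exists; the least one is needed for the residue classes.\<close>
  define T where "T s \<longleftrightarrow> s > 0 \<and> \<alpha> ^ s = 1 \<and> \<beta> ^ s = 1" for s :: nat
  have "T (Suc k)" using root_of_unity_of_scales_linear[OF xk] i(2) j(2) unfolding T_def \<alpha>_def \<beta>_def by blast
  define s where "s = (LEAST s. T s)"
  have s: "T s" "\<And>t. T t \<Longrightarrow> s \<le> t" unfolding s_def using \<open>T (Suc k)\<close> by (auto intro: LeastI Least_le)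
  have nz: "\<alpha> \<noteq> 0" "\<beta> \<noteq> 0" using i(2) j(2) by (auto simp: \<alpha>_def \<beta>_def scales_def)
  have dvd: "s dvd d" if "\<alpha> ^ d = 1" "\<beta> ^ d = 1" for d
  proof -
    have "\<alpha> ^ d = (\<alpha> ^ s) ^ (d div s) * \<alpha> ^ (d mod s)" "\<beta> ^ d = (\<beta> ^ s) ^ (d div s) * \<beta> ^ (d mod s)"
      by (simp_all flip: power_mult power_add)
    then have "\<alpha> ^ (d mod s) = 1" "\<beta> ^ (d mod s) = 1" using that s(1) by (simp_all add: T_def)
    moreover have "d mod s < s" using s(1) by (simp add: T_def)
    ultimately have "d mod s = 0" using s(2)[of "d mod s"] unfolding T_def by force
    then show ?thesis by auto
  qed
  have res: "e mod s = f mod s" if "\<alpha> ^ e = \<alpha> ^ f" "\<beta> ^ e = \<beta> ^ f" for e f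
  proof -
    have *: "e mod s = f mod s" if "\<alpha> ^ e = \<alpha> ^ f" "\<beta> ^ e = \<beta> ^ f" "e \<le> f" for e f
    proof -
      have "\<alpha> ^ (f - e) = 1" "\<beta> ^ (f - e) = 1" using that nz by (simp_all add: power_diff)
      then have "s dvd f - e" by (rule dvd)
      then show ?thesis using that(3) by (metis mod_eq_dvd_iff_nat)
    qed
    show ?thesis
    proof (cases "e \<le> f")
      case True
      then show ?thesis using * that by blast
    next
      case False
      then have "f \<le> e" by simp
      then show ?thesis using *[of f e] that by metis
    qed
  qed
  obtain C where "H = monom 1 (h mod s) * (C \<circ>\<^sub>p monom 1 s)"
  proof (rule polynomial_in_residue_class[of s H "h mod s"])
    show "s > 0" "h mod s < s" using s(1) by (simp_all add: T_def)
    show "e mod s = h mod s" if "coeff H e \<noteq> 0" for e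
      using coeff_scales_linear[OF H(1) i(2) that] coeff_scales_linear[OF H(1) j(2) that]
      by (intro res) (simp_all add: \<alpha>_def \<beta>_def)
  qed
  then show ?thesis using that[of i j s H "h mod s" C \<alpha> \<beta>] ij s(1) nz i(1) j(1) by (simp add: T_def \<alpha>_def \<beta>_def)
qed

text \<open>
  For \<open>x = t\<^sup>-\<^sup>1\<close> the scaling condition reads \<open>P(t\<^sup>-\<^sup>1) = z\<^sup>-\<^sup>1 t\<^sup>-\<^sup>M\<close>.
\<close>

lemma scales_of_trivial_coordinate:
  assumes "x = fls_X_inv" "scales P z M" shows "P = monom (inverse z) M"
proof -
  have "ev x P = power_subst z M x" "z \<noteq> 0" "M > 0" using assms(2) by (auto simp: scales_def)
  then have "ev x P = fls_const (inverse z) * fls_X_inv ^ M"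
    using assms(1) power_subst_X_inv[of z M] by metis
  also have "\<dots> = ev x (monom (inverse z) M)" by (simp add: ev_monom assms(1))
  finally show ?thesis by (rule ev_inj[rotated]) simp
qed

end

text \<open>
  If \<open>y = \<alpha> t\<^sup>-\<^sup>1 + \<beta> + \<dots>\<close>, conjugating by \<open>L = \<alpha> X + \<beta>\<close> replaces \<open>y\<close> by \<open>L\<^sup>-\<^sup>1(y)\<close>.
\<close>

lemma normalize_coordinate:
  fixes y :: "'a::alg_closed_field fls"
  assumes y: "fls_subdegree y = -1"
  obtains L x where "degree L = 1" "normalized_coordinate x"
    "\<And>P z M. z \<noteq> 0 \<Longrightarrow> M > 0 \<Longrightarrow> ev y P = power_subst z M y \<Longrightarrow>
       ev x (comp_inv L \<circ>\<^sub>p P \<circ>\<^sub>p L) = power_subst z M x"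
proof -
  define \<alpha> where "\<alpha> = y $$ (-1)"
  define \<beta> where "\<beta> = y $$ 0"
  have "y \<noteq> 0" using y by auto
  then have \<alpha>: "\<alpha> \<noteq> 0" unfolding \<alpha>_def using y by (metis nth_fls_subdegree_nonzero)
  define L where "L = [:\<beta>, \<alpha>:]"
  have L: "degree L = 1" using \<alpha> by (simp add: L_def)
  define L' where "L' = comp_inv L"
  have L': "L' = [:- \<beta> / \<alpha>, 1 / \<alpha>:]" unfolding L'_def L_def using \<alpha> by (rule comp_inv_linear)
  have LL: "L \<circ>\<^sub>p L' = [:0, 1:]" using comp_inv_degree_1(1)[OF L] by (simp add: L'_def)
  define x where "x = ev y L'"
  have yge: "ord_ge (-1) y" using ord_ge_subdegree[of y] y by simp
  have x_nth: "x $$ i = (if i = 0 then - \<beta> / \<alpha> else 0) + (1 / \<alpha>) * y $$ i" for i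
    by (simp add: x_def L' ev_pCons mult.commute[of y])
  have "ord_ge 1 (x - fls_X_inv)"
    unfolding ord_ge_def
  proof safe
    fix i :: int assume "i < 1"
    then consider "i < -1" | "i = -1" | "i = 0" by linarith
    then show "(x - fls_X_inv) $$ i = 0"
      using yge \<alpha> by cases (auto simp: x_nth ord_ge_def \<alpha>_def \<beta>_def)
  qed
  then have "normalized_coordinate x" by unfold_locales
  moreover have "ev x (L' \<circ>\<^sub>p P \<circ>\<^sub>p L) = power_subst z M x"
    if "z \<noteq> 0" "M > 0" "ev y P = power_subst z M y" for P z M
  proof -
    have "ev x L = y" by (simp add: x_def LL flip: ev_pcompose)
    then have "ev x (L' \<circ>\<^sub>p P \<circ>\<^sub>p L) = ev (power_subst z M y) L'"
      by (simp add: ev_pcompose that)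
    then show ?thesis using that by (simp add: x_def power_subst_ev)
  qed
  ultimately show ?thesis using that L by (simp add: L'_def)
qed

section \<open>Frobenius powers and pairs of close degrees\<close>

text \<open>
  Dirichlet's approximation theorem for the slope \<open>ln m / ln n\<close> makes \<open>i ln m - j ln n\<close> as small as
  desired with \<open>i > 0\<close>.
\<close>

lemma close_powers:
  fixes m n \<kappa> :: nat
  assumes mn: "m > 1" "n > 1" and indep: "\<And>i j. i > 0 \<Longrightarrow> j > 0 \<Longrightarrow> m ^ i \<noteq> n ^ j" and \<kappa>: "\<kappa> > 0"
  obtains i j where "i > 0" "j > 0" "m ^ i < n ^ j \<and> \<kappa> * (n ^ j - m ^ i) \<le> m ^ i \<or>
    n ^ j < m ^ i \<and> \<kappa> * (m ^ i - n ^ j) \<le> n ^ j"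
proof -
  define lm ln' where "lm = ln (real m)" and "ln' = ln (real n)"
  have pos: "lm > 0" "ln' > 0" using mn by (simp_all add: lm_def ln'_def)
  define \<delta> where "\<delta> = ln (1 + 1 / real \<kappa>)"
  have \<delta>: "\<delta> > 0" unfolding \<delta>_def using \<kappa> by (intro ln_gt_zero) simp
  obtain N :: nat where N: "N > 0" "real N > ln' / \<delta>" "real N > ln' / lm"
  proof -
    obtain N where "real N > max (ln' / \<delta>) (ln' / lm)" using reals_Archimedean2 by blast
    moreover have "ln' / \<delta> > 0" using pos \<delta> by simp
    ultimately show ?thesis using that[of N] by (auto intro: Nat.gr0I)
  qed
  obtain h k :: int where hk: "0 < k" "\<bar>of_int k * (lm / ln') - of_int h\<bar> < 1 / N"
    using Dirichlet_approx[OF N(1), of "lm / ln'"] by metis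
  have "of_int k * (lm / ln') \<ge> 1 * (lm / ln')" using hk(1) pos by (intro mult_right_mono) auto
  moreover have "lm / ln' > 1 / N" using N pos by (simp add: field_simps)
  ultimately have "of_int h > (0::real)" using hk(2) by linarith
  then have h: "h > 0" by simp
  define i j where "i = nat k" and "j = nat h"
  have ij: "i > 0" "j > 0" using h hk(1) by (auto simp: i_def j_def)
  have "\<bar>real i * lm - real j * ln'\<bar> = ln' * \<bar>of_int k * (lm / ln') - of_int h\<bar>"
    using pos h hk(1) by (simp add: i_def j_def abs_mult_pos' field_simps flip: abs_mult_pos)
  also have "\<dots> < ln' * (1 / N)" using hk(2) pos by (intro mult_strict_left_mono) auto
  also have "\<dots> < \<delta>" using N \<delta> by (simp add: field_simps)
  finally have close: "\<bar>ln (real (m ^ i)) - ln (real (n ^ j))\<bar> < \<delta>"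
    using mn by (simp add: ln_realpow lm_def ln'_def)
  have *: "\<kappa> * (b - a) \<le> a" if "a < b" "a > 0" "ln (real b) - ln (real a) < \<delta>" for a b :: nat
  proof -
    have "ln (real b / real a) < ln (1 + 1 / real \<kappa>)" using that by (simp add: ln_div \<delta>_def)
    moreover have "0 < 1 + 1 / real \<kappa>" by (intro add_pos_nonneg) auto
    ultimately have "real b / real a < 1 + 1 / real \<kappa>" using that by (subst (asm) ln_less_cancel_iff) auto
    then have "real \<kappa> * (real b - real a) < real a" using that \<kappa> by (simp add: field_simps)
    then have "real (\<kappa> * (b - a)) < real a" using that by (simp add: of_nat_diff)
    then show ?thesis by (simp only: of_nat_less_iff less_imp_le)
  qed
  have ne: "m ^ i \<noteq> n ^ j" by (rule indep[OF ij])
  have p: "m ^ i > 0" "n ^ j > 0" using mn by auto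
  show ?thesis
  proof (cases "m ^ i < n ^ j")
    case True
    then show ?thesis using *[OF True p(1)] close ij that by auto
  next
    case False
    then have "n ^ j < m ^ i" using ne by simp
    then show ?thesis using *[OF _ p(2)] close ij that by auto
  qed
qed

lemma frobenius_diff:
  fixes a b :: "'b::comm_ring_1"
  assumes "prime CHAR('b)" shows "(a - b) ^ CHAR('b) = a ^ CHAR('b) - b ^ CHAR('b)"
  using freshmans_dream[OF assms refl, of "a - b" b] by simp

lemma frobenius_inj:
  fixes a b :: "'b::idom"
  assumes "prime CHAR('b)" "a ^ CHAR('b) = b ^ CHAR('b)" shows "a = b"
  using frobenius_diff[OF assms(1), of a b] assms(2) by simp

lemma fermat_in_char:
  fixes m :: nat
  assumes p: "prime CHAR('b)" and m: "of_nat m \<noteq> (0::'b::field)"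
  shows "of_nat (m ^ (CHAR('b) - 1)) = (1::'b)"
proof -
  have "(of_nat m :: 'b) ^ CHAR('b) = of_nat m"
  proof (induction m)
    case 0
    then show ?case using p by (simp add: prime_gt_0_nat)
  next
    case (Suc m)
    then show ?case using freshmans_dream[OF p refl, of "1 :: 'b" "of_nat m"] by simp
  qed
  moreover have "(of_nat m :: 'b) ^ CHAR('b) = of_nat m * of_nat m ^ (CHAR('b) - 1)"
    using p by (metis power_eq_if prime_gt_0_nat not_gr_zero)
  ultimately show ?thesis using m by simp
qed

text \<open>
  Only exponents divisible by \<open>p\<close> survive, and the coefficients have \<open>p\<close>-th roots.
\<close>

lemma pth_power_of_pderiv_eq_0:
  fixes P :: "'b::alg_closed_field poly"
  assumes p: "prime CHAR('b)" and P: "pderiv P = 0"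
  obtains R where "P = R ^ CHAR('b)"
proof -
  let ?p = "CHAR('b)"
  have p0: "?p > 0" using p by (rule prime_gt_0_nat)
  have "i mod ?p = 0" if "coeff P i \<noteq> 0" for i
  proof (cases i)
    case (Suc j)
    have "of_nat (Suc j) * coeff P (Suc j) = 0" using P by (metis coeff_pderiv coeff_0)
    then have "(of_nat i :: 'b) = 0" using that Suc by simp
    then show ?thesis by (simp add: of_nat_eq_0_iff_char_dvd)
  qed simp
  then obtain C where C: "P = monom 1 0 * (C \<circ>\<^sub>p monom 1 ?p)"
    using polynomial_in_residue_class[of ?p P 0] p0 by blast
  have "\<forall>c::'b. \<exists>d. d ^ ?p = c" using nth_root_exists[OF p0] by blast
  then obtain r where r: "\<And>c::'b. r c ^ ?p = c" by metis
  have pp: "prime CHAR('b poly)" "?p = CHAR('b poly)" using p by simp_all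
  have "P = (\<Sum>j\<le>degree C. monom (coeff C j) j) \<circ>\<^sub>p monom 1 ?p"
    using C by (simp add: poly_as_sum_of_monoms monom_0)
  also have "\<dots> = (\<Sum>j\<le>degree C. monom (coeff C j) (j * ?p))"
    by (simp add: pcompose_sum monom_pcompose_monom)
  also have "\<dots> = (\<Sum>j\<le>degree C. monom (r (coeff C j)) j ^ ?p)"
    by (simp add: monom_power r)
  also have "\<dots> = (\<Sum>j\<le>degree C. monom (r (coeff C j)) j) ^ ?p"
    by (rule freshmans_dream_sum[OF pp, symmetric])
  finally show ?thesis using that by blast
qed

text \<open>
  Freshman's dream for series. It is proved by splitting off a finite part of \<open>f\<close>, to which the finite version
  applies.
\<close>

lemma fls_nth_frobenius:
  fixes f :: "'b::field fls"
  assumes p: "prime CHAR('b)"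
  shows "(f ^ CHAR('b)) $$ n = (if int CHAR('b) dvd n then (f $$ (n div int CHAR('b))) ^ CHAR('b) else 0)"
proof -
  let ?p = "CHAR('b)"
  have p0: "?p > 0" using p by (rule prime_gt_0_nat)
  have pf: "prime CHAR('b fls)" "?p = CHAR('b fls)" using p by simp_all
  define K where "K = max 1 (n + 1)"
  have K: "K > 0" "K > n" by (auto simp: K_def)
  define A where "A = {fls_subdegree f..<K}"
  have fin: "finite A" by (simp add: A_def)
  define T where "T = (\<Sum>i\<in>A. fls_const (f $$ i) * fls_X_intpow i)"
  have T_nth: "T $$ j = (if j \<in> A then f $$ j else 0)" for j
  proof -
    have "T $$ j = (\<Sum>i\<in>A. if i = j then f $$ j else 0)"
      unfolding T_def fls_nth_sum by (intro sum.cong) auto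
    then show ?thesis using fin by simp
  qed
  have r: "ord_ge K (f - T)"
    unfolding ord_ge_def by (auto simp: T_nth A_def fls_eq0_below_subdegree)
  have "f ^ ?p = (T + (f - T)) ^ ?p" by simp
  also have "\<dots> = T ^ ?p + (f - T) ^ ?p" by (rule freshmans_dream[OF pf])
  finally have fp: "f ^ ?p = T ^ ?p + (f - T) ^ ?p" .
  have "ord_ge (int ?p * K) ((f - T) ^ ?p)" by (rule ord_ge_power[OF r])
  moreover have "K \<le> int ?p * K" using p0 K mult_right_mono[of 1 "int ?p" K] by simp
  ultimately have "ord_ge K ((f - T) ^ ?p)" by (rule ord_ge_mono)
  then have "((f - T) ^ ?p) $$ n = 0" using K by (simp add: ord_ge_def)
  moreover have "T ^ ?p = (\<Sum>i\<in>A. (fls_const (f $$ i) * fls_X_intpow i) ^ ?p)"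
    unfolding T_def by (rule freshmans_dream_sum[OF pf])
  moreover have "(fls_const (f $$ i) * fls_X_intpow i) ^ ?p = fls_const ((f $$ i) ^ ?p) * fls_X_intpow (int ?p * i)" for i
    by (simp add: power_mult_distrib fls_const_power fls_X_intpow_power mult.commute)
  ultimately have "(f ^ ?p) $$ n = (\<Sum>i\<in>A. if int ?p * i = n then (f $$ i) ^ ?p else 0)"
    by (simp add: fp fls_nth_sum) (intro sum.cong, auto)
  also have "\<dots> = (if int ?p dvd n then (f $$ (n div int ?p)) ^ ?p else 0)"
  proof (cases "int ?p dvd n")
    case True
    then obtain j where j: "n = int ?p * j" by blast
    have iff: "int ?p * i = n \<longleftrightarrow> i = j" for i using p0 by (simp add: j)
    have "j < K" 
    proof (rule ccontr)
      assume "\<not> j < K"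
      then have "j \<ge> 1" using K by linarith
      then have "j \<le> n" using p0 mult_right_mono[of 1 "int ?p" j] by (simp add: j)
      then show False using \<open>\<not> j < K\<close> K by linarith
    qed
    have "(\<Sum>i\<in>A. if int ?p * i = n then (f $$ i) ^ ?p else 0) = (\<Sum>i\<in>A. if i = j then (f $$ j) ^ ?p else 0)"
      by (intro sum.cong) (auto simp: iff)
    also have "\<dots> = (f $$ j) ^ ?p"
      using fin \<open>j < K\<close> p0 by (auto simp: A_def fls_eq0_below_subdegree power_0_left)
    finally show ?thesis using p0 by (simp add: j)
  next
    case False
    then have "int ?p * i \<noteq> n" for i by auto
    then show ?thesis using False by simp
  qed
  finally show ?thesis .
qed

lemma pth_power_of_euler_eq_0:
  fixes f :: "'b::alg_closed_field fls"
  assumes p: "prime CHAR('b)" and f: "euler f = 0"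
  obtains g where "f = g ^ CHAR('b)"
proof -
  let ?p = "CHAR('b)"
  have p0: "?p > 0" using p by (rule prime_gt_0_nat)
  have "\<forall>c::'b. \<exists>d. d ^ ?p = c" using nth_root_exists[OF p0] by blast
  then obtain r where r: "\<And>c::'b. r c ^ ?p = c" by metis
  have r0: "r 0 = 0" using r[of 0] p0 by simp
  define g where "g = Abs_fls (\<lambda>i. r (f $$ (int ?p * i)))"
  have g_nth: "g $$ i = r (f $$ (int ?p * i))" for i
    unfolding g_def
  proof (rule nth_Abs_fls_lower_bound)
    show "\<forall>i<min 0 (fls_subdegree f). r (f $$ (int ?p * i)) = 0"
    proof safe
      fix i assume i: "i < min 0 (fls_subdegree f)"
      then have "int ?p * i \<le> 1 * i" using p0 by (intro mult_right_mono_neg) auto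
      then have "int ?p * i < fls_subdegree f" using i by linarith
      then show "r (f $$ (int ?p * i)) = 0" using r0 by (simp add: fls_eq0_below_subdegree)
    qed
  qed
  have "f = g ^ ?p"
  proof (rule fls_eqI)
    fix n
    show "f $$ n = (g ^ ?p) $$ n"
    proof (cases "int ?p dvd n")
      case True
      then show ?thesis by (simp add: fls_nth_frobenius[OF p] g_nth r)
    next
      case False
      have "euler f $$ n = 0" using f by simp
      then have "of_int n * f $$ n = 0" by (simp add: euler_nth)
      moreover have "of_int n \<noteq> (0::'b)" using False by (simp add: of_int_eq_0_iff_char_dvd)
      ultimately show ?thesis using False by (simp add: fls_nth_frobenius[OF p])
    qed
  qed
  then show ?thesis using that by blast
qed

lemma prime_CHAR: "CHAR('b::idom) = 0 \<or> prime CHAR('b)"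
  using prime_CHAR_semidom[where ?'a = 'b] by blast

lemma ord_ge_sub_one_nth: "ord_ge 1 (y - 1 :: 'b::field fls) \<Longrightarrow> ord_ge 0 y \<and> y $$ 0 = 1"
proof -
  assume a: "ord_ge 1 (y - 1)"
  have "(y - 1) $$ 0 = 0" using a by (simp add: ord_ge_def)
  moreover have "ord_ge 0 ((y - 1) + 1)" by (intro ord_ge_add ord_ge_mono[OF a]) auto
  ultimately show ?thesis by simp
qed

text \<open>
  Extracting \<open>p\<close>-th roots divides the order of \<open>y - 1\<close> by \<open>p\<close>, so the process stops.
\<close>

lemma maximal_frobenius_power:
  fixes y :: "'b::alg_closed_field fls"
  assumes "ord_ge 1 (y - 1)" "y \<noteq> 1"
  obtains e \<psi> where "e = 0 \<or> prime CHAR('b)" "y = \<psi> ^ (CHAR('b) ^ e)" "ord_ge 1 (\<psi> - 1)" "euler \<psi> \<noteq> 0"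
proof -
  have "\<exists>e \<psi>. (e = 0 \<or> prime CHAR('b)) \<and> y = \<psi> ^ (CHAR('b) ^ e) \<and> ord_ge 1 (\<psi> - 1) \<and> euler \<psi> \<noteq> 0"
    using assms
  proof (induction "nat (fls_subdegree (y - 1))" arbitrary: y rule: less_induct)
    case less
    show ?case
    proof (cases "euler y = 0")
      case False
      then show ?thesis using less.prems by (intro exI[of _ 0] exI[of _ y]) simp
    next
      case True
      have y0: "ord_ge 0 y" "y $$ 0 = 1" using ord_ge_sub_one_nth[OF less.prems(1)] by auto
      have "CHAR('b) \<noteq> 0"
      proof
        assume c: "CHAR('b) = 0"
        have "y = 1"
        proof (rule fls_eqI)
          fix i
          have "euler y $$ i = 0" using True by simp
          then have "of_int i * y $$ i = 0" by (simp add: euler_nth)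
          then have "i = 0 \<or> y $$ i = 0" using c by (auto simp: of_int_eq_0_iff_char_dvd)
          then show "y $$ i = 1 $$ i" using y0 by auto
        qed
        then show False using less.prems by simp
      qed
      then have p: "prime CHAR('b)" using prime_CHAR[where ?'b = 'b] by auto
      let ?p = "CHAR('b)"
      have p1: "?p > 1" using p by (rule prime_gt_1_nat)
      have pf: "prime CHAR('b fls)" "CHAR('b fls) = ?p" using p by simp_all
      obtain g where g: "y = g ^ ?p" by (rule pth_power_of_euler_eq_0[OF p True])
      have diff: "(g - 1) ^ ?p = y - 1" using frobenius_diff[OF pf(1), of g 1] by (simp add: g)
      have g1: "ord_ge 1 (g - 1)"
        using less.prems(1) p1 unfolding diff[symmetric] by (rule_tac ord_ge_prime_power_cancel) auto
      have gne: "g \<noteq> 1" using less.prems g by auto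
      have "fls_subdegree (y - 1) = int ?p * fls_subdegree (g - 1)"
        unfolding diff[symmetric] by (simp add: fls_subdegree_pow)
      moreover have "fls_subdegree (g - 1) \<ge> 1" using g1 gne by (simp add: ord_ge_iff_subdegree)
      ultimately have "fls_subdegree (g - 1) < fls_subdegree (y - 1)" using p1 by simp
      then have "nat (fls_subdegree (g - 1)) < nat (fls_subdegree (y - 1))"
        using \<open>fls_subdegree (g - 1) \<ge> 1\<close> by simp
      from less.hyps[OF this g1 gne] obtain e \<psi> where
        "g = \<psi> ^ (?p ^ e)" "ord_ge 1 (\<psi> - 1)" "euler \<psi> \<noteq> 0" by blast
      then show ?thesis using p g
        by (intro exI[of _ "Suc e"] exI[of _ \<psi>]) (simp add: mult.commute flip: power_mult)
    qed
  qed
  then show ?thesis using that by blast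
qed

context normalized_coordinate
begin

lemma euler_x_nonzero: "euler x \<noteq> 0"
proof -
  have "euler x $$ (-1) = 1" by (simp add: euler_nth)
  then show ?thesis by auto
qed

text \<open>
  A \<open>q\<close>-th power among the values of polynomials is the value of a \<open>q\<close>-th power: its derivative
  vanishes, and \<open>\<theta> P(x) = P'(x) \<theta> x\<close> with \<open>\<theta> x \<noteq> 0\<close> transports this to \<open>P\<close>.
\<close>

lemma polynomial_root_of_frobenius_power:
  assumes "e = 0 \<or> prime CHAR('a)" "ev x P = g ^ (CHAR('a) ^ e)"
  obtains R where "P = R ^ (CHAR('a) ^ e)" "ev x R = g"
proof -
  have "\<exists>R. P = R ^ (CHAR('a) ^ e) \<and> ev x R = g"
    using assms
  proof (induction e arbitrary: P)
    case (Suc e)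
    then have p: "prime CHAR('a)" by simp
    have pf: "prime CHAR('a fls)" "CHAR('a fls) = CHAR('a)" using p by simp_all
    have eq: "ev x P = (g ^ (CHAR('a) ^ e)) ^ CHAR('a)"
      using Suc.prems(2) by (simp add: mult.commute flip: power_mult)
    have "of_nat CHAR('a) = (0 :: 'a fls)" using pf(2) of_nat_CHAR[where ?'a = "'a fls"] by simp
    then have "euler (ev x P) = 0" unfolding eq euler_power by simp
    then have "ev x (pderiv P) = 0" using euler_x_nonzero by (simp add: euler_ev)
    then have "pderiv P = 0" using ev_eq_0I[of x "pderiv P"] by simp
    then obtain Q where Q: "P = Q ^ CHAR('a)" using pth_power_of_pderiv_eq_0[OF p] by blast
    have "ev x Q ^ CHAR('a fls) = (g ^ (CHAR('a) ^ e)) ^ CHAR('a fls)"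
      using eq by (simp add: Q ev_power)
    then have "ev x Q = g ^ (CHAR('a) ^ e)" by (rule frobenius_inj[OF pf(1)])
    then obtain R where "Q = R ^ (CHAR('a) ^ e)" "ev x R = g" using Suc.IH p by blast
    then show ?case by (intro exI[of _ R]) (simp add: Q mult.commute flip: power_mult)
  qed simp
  then show ?thesis using that by blast
qed

text \<open>
  Scaling polynomials whose degrees are relatively close (\<open>\<kappa>\<close>) and large (\<open>b\<close>). The final congruence makes the difference of
  the degrees vanish in the field when the characteristic is positive.
\<close>

definition close_pairs :: bool where
  "close_pairs \<longleftrightarrow> (\<forall>\<kappa> b. \<exists>A \<zeta> M B \<xi> N. scales A \<zeta> M \<and> scales B \<xi> N \<and> M < N \<and> \<kappa> * (N - M) \<le> M \<and>
     b \<le> M \<and> of_nat M \<noteq> (0::'a) \<and> of_nat N \<noteq> (0::'a) \<and> (CHAR('a) = 0 \<or> of_nat N = (of_nat M :: 'a)))"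

text \<open>
  Words \<open>F\<^sup>e\<^sup>i\<close> and \<open>G\<^sup>e\<^sup>j\<close> with degrees from \<open>close_powers\<close>. In characteristic \<open>p\<close> the exponent
  \<open>e = p - 1\<close> makes both degrees congruent to \<open>1\<close> modulo \<open>p\<close>. Composing both with a high iterate of \<open>F\<close>
  makes them large.
\<close>

lemma close_pairs_of_independent_degrees:
  assumes F: "scales F z m" and G: "scales G y n" and mn: "m > 1" "n > 1"
    and nz: "of_nat m \<noteq> (0::'a)" "of_nat n \<noteq> (0::'a)"
    and indep: "\<And>i j. i > 0 \<Longrightarrow> j > 0 \<Longrightarrow> m ^ i \<noteq> n ^ j"
  shows close_pairs
  unfolding close_pairs_def
proof safe
  fix \<kappa> b :: nat
  define e where "e = (if CHAR('a) = 0 then 1 else CHAR('a) - 1)"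
  have p: "CHAR('a) \<noteq> 0 \<Longrightarrow> prime CHAR('a)" using prime_CHAR[where ?'b = 'a] by auto
  have e: "e > 0" using p prime_gt_1_nat[of "CHAR('a)"] by (auto simp: e_def)
  have one: "CHAR('a) \<noteq> 0 \<Longrightarrow> of_nat (m ^ e) = (1::'a)" "CHAR('a) \<noteq> 0 \<Longrightarrow> of_nat (n ^ e) = (1::'a)"
    using fermat_in_char p nz by (auto simp: e_def simp del: of_nat_power)
  have mn': "m ^ e > 1" "n ^ e > 1" by (rule one_less_power[OF mn(1) e], rule one_less_power[OF mn(2) e])
  have indep': "(m ^ e) ^ i \<noteq> (n ^ e) ^ j" if "i > 0" "j > 0" for i j
    using indep[of "e * i" "e * j"] that e by (simp add: power_mult)
  obtain i j where ij: "i > 0" "j > 0"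
    "(m ^ e) ^ i < (n ^ e) ^ j \<and> Suc \<kappa> * ((n ^ e) ^ j - (m ^ e) ^ i) \<le> (m ^ e) ^ i \<or>
     (n ^ e) ^ j < (m ^ e) ^ i \<and> Suc \<kappa> * ((m ^ e) ^ i - (n ^ e) ^ j) \<le> (n ^ e) ^ j"
    using close_powers[OF mn' indep', of "Suc \<kappa>"] by blast
  \<comment> \<open>The degree of an auxiliary iterate of \<open>F\<close> that makes both degrees at least \<open>b\<close>.\<close>
  define c where "c = m ^ b"
  have c: "c > 0" "b \<le> c" using mn by (simp_all add: c_def less_imp_le[OF less_exp])
  obtain \<zeta> where "scales (comp_pow F (e * i)) \<zeta> (m ^ (e * i))" using scales_comp_pow[OF F] by blast
  moreover obtain w where w: "scales (comp_pow F b) w c" using scales_comp_pow[OF F] unfolding c_def by blast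
  moreover obtain \<xi> where "scales (comp_pow G (e * j)) \<xi> (n ^ (e * j))" using scales_comp_pow[OF G] by blast
  ultimately obtain A B \<zeta> \<xi> where AB: "scales A \<zeta> ((m ^ e) ^ i * c)" "scales B \<xi> ((n ^ e) ^ j * c)"
    using scales_pcompose by (metis power_mult)
  have nz': "of_nat ((m ^ e) ^ i * c) \<noteq> (0::'a)" "of_nat ((n ^ e) ^ j * c) \<noteq> (0::'a)"
    using nz by (simp_all add: c_def)
  have eq: "CHAR('a) = 0 \<or> of_nat ((n ^ e) ^ j * c) = (of_nat ((m ^ e) ^ i * c) :: 'a)"
    using one by (auto simp del: of_nat_power simp: of_nat_power[of "m ^ e"] of_nat_power[of "n ^ e"])
  have scale: "\<kappa> * (N * c - M * c) \<le> M * c \<and> b \<le> M * c \<and> M * c < N * c"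
    if "M < N" "Suc \<kappa> * (N - M) \<le> M" for M N
  proof -
    have "\<kappa> * (N - M) \<le> M" using that by simp
    then have "\<kappa> * (N - M) * c \<le> M * c" by (rule mult_le_mono1)
    moreover have "M > 0" using that by (cases M) auto
    then have "c \<le> M * c" by simp
    then have "b \<le> M * c" using c by linarith
    ultimately show ?thesis using c that by (simp add: diff_mult_distrib mult.assoc)
  qed
  show "\<exists>A \<zeta> M B \<xi> N. scales A \<zeta> M \<and> scales B \<xi> N \<and> M < N \<and> \<kappa> * (N - M) \<le> M \<and>
     b \<le> M \<and> of_nat M \<noteq> (0::'a) \<and> of_nat N \<noteq> (0::'a) \<and> (CHAR('a) = 0 \<or> of_nat N = (of_nat M :: 'a))"
  proof (cases "(m ^ e) ^ i < (n ^ e) ^ j")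
    case True
    then show ?thesis using AB nz' eq scale ij(3) by (metis less_asym)
  next
    case False
    then show ?thesis using AB nz' eq[THEN disj_forward] scale ij(3) by metis
  qed
qed

end

section \<open>Leading terms of the coordinate\<close>

context normalized_coordinate
begin

lemma subdegree_ev:
  assumes "P \<noteq> 0" shows "fls_subdegree (ev x P) = - int (degree P)" "ev x P \<noteq> 0"
  using fls_subdegree_ev[of x 1 P] assms by simp_all

text \<open>
  Write \<open>x = t\<^sup>-\<^sup>1 \<psi>\<^sup>q\<close>. With \<open>c\<close> chosen so that \<open>q\<close> divides \<open>c + M\<close>, the polynomial \<open>X\<^sup>c P\<close> takes at
  \<open>x\<close> a value that is a \<open>q\<close>-th power, hence is itself \<open>R\<^sup>q\<close>. Taking the logarithmic derivative
  of \<open>R(x)\<close> gives the identity; it shows that \<open>X R' - d R\<close> measures \<open>\<nu>(z t\<^sup>M) - \<nu>(t)\<close>, where \<open>\<nu>\<close> is the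
  logarithmic derivative of \<open>\<psi>\<close>.
\<close>

lemma frobenius_root_of_scaling_polynomial:
  assumes e: "e = 0 \<or> prime CHAR('a)" and q: "q = CHAR('a) ^ e"
    and x: "x = fls_X_inv * \<psi> ^ q" and \<psi>: "ord_ge 1 (\<psi> - 1)"
    and P: "scales P z M"
  defines "\<nu> \<equiv> euler \<psi> / \<psi>"
  obtains R d where "q * d \<le> M + q - 1" "R \<noteq> 0" "degree R = d"
    "ev x (pCons 0 (pderiv R) - smult (of_nat d) R) * (1 + of_nat q * \<nu>)
      = ev x R * (of_nat M * (power_subst z M \<nu> - \<nu>))"
proof -
  have z: "z \<noteq> 0" "M > 0" "ev x P = power_subst z M x" using P by (auto simp: scales_def)
  have q0: "q > 0" using e q prime_gt_0_nat by (cases "e = 0") auto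
  have \<psi>0: "\<psi> \<noteq> 0" using ord_ge_sub_one_nth[OF \<psi>] by auto
  define s\<psi> where "s\<psi> = power_subst z M \<psi>"
  have s\<psi>0: "s\<psi> \<noteq> 0" using \<psi>0 z by (simp add: s\<psi>_def power_subst_eq_0_iff)
  \<comment> \<open>The residue of \<open>- M\<close> modulo \<open>q\<close>, written without negative numbers.\<close>
  define c where "c = (M * (q - 1)) mod q"
  have "c < q" using q0 by (simp add: c_def)
  then have c: "c \<le> q - 1" by linarith
  have "(c + M) mod q = (M * (q - 1) + M) mod q" by (simp add: c_def mod_add_left_eq)
  also have "M * (q - 1) + M = M * q" using q0 by (cases q) auto
  finally have "q dvd c + M" by auto
  then obtain d where d: "c + M = q * d" by blast
  obtain y where y: "y ^ q = inverse z" using nth_root_exists[of q "inverse z"] q0 by blast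
  define g where "g = fls_const y * fls_X_inv ^ d * \<psi> ^ c * s\<psi>"
  have y0: "y \<noteq> 0" using y z q0 by (auto simp: power_0_left)
  have sx: "power_subst z M x = fls_const (inverse z) * fls_X_inv ^ M * s\<psi> ^ q"
  proof -
    have "power_subst z M x = power_subst z M fls_X_inv * power_subst z M (\<psi> ^ q)"
      by (subst x, rule power_subst_mult[OF z(1,2)])
    then show ?thesis by (simp only: power_subst_X_inv[OF z(1,2)] power_subst_power[OF z(1,2)] s\<psi>_def)
  qed
  have yq: "fls_const y ^ q = fls_const (inverse z)" using y by (metis fls_const_power)
  have "g ^ q = fls_const (inverse z) * fls_X_inv ^ (c + M) * \<psi> ^ (c * q) * s\<psi> ^ q"
    unfolding g_def power_mult_distrib yq
    by (simp only: d mult.commute[of q d] power_mult)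
  also have "\<dots> = x ^ c * power_subst z M x"
  proof -
    have "x ^ c = fls_X_inv ^ c * \<psi> ^ (c * q)"
      by (subst x) (simp only: power_mult_distrib power_mult[symmetric] mult.commute[of c q])
    then show ?thesis unfolding sx by (simp only: power_add mult_ac)
  qed
  also have "\<dots> = ev x (monom 1 c * P)" by (simp add: ev_mult ev_monom z)
  finally have "ev x (monom 1 c * P) = g ^ (CHAR('a) ^ e)" by (simp only: q)
  then obtain R where R: "monom 1 c * P = R ^ (CHAR('a) ^ e)" "ev x R = g"
    by (rule polynomial_root_of_frobenius_power[OF e])
  have g0: "g \<noteq> 0" using y0 \<psi>0 s\<psi>0 by (simp add: g_def)
  then have R0: "R \<noteq> 0" using R(2) by auto
  have P0: "P \<noteq> 0" using degree_scales[OF P] z by auto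
  have "q * degree R = c + M"
    using arg_cong[OF R(1), of degree] P0 R0 degree_scales[OF P]
    by (simp add: degree_mult_eq degree_monom_eq degree_power_eq q)
  then have dR: "degree R = d" using d q0 by simp
  have e\<psi>: "euler \<psi> = \<psi> * \<nu>" using \<psi>0 by (simp add: \<nu>_def)
  have es: "euler s\<psi> = s\<psi> * (of_nat M * power_subst z M \<nu>)"
    using z by (simp add: s\<psi>_def euler_power_subst e\<psi> power_subst_mult mult_ac)
  have epow: "euler (\<psi> ^ n) = \<psi> ^ n * (of_nat n * \<nu>)" for n
  proof (cases n)
    case (Suc j)
    have "euler (\<psi> ^ n) = of_nat n * \<psi> ^ j * (\<psi> * \<nu>)"
      unfolding euler_power e\<psi> by (simp only: Suc diff_Suc_1)
    then show ?thesis by (simp only: Suc power_Suc mult_ac)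
  qed simp
  have eg: "euler g = g * (of_nat d + of_nat c * \<nu> + of_nat M * power_subst z M \<nu>)"
  proof -
    have "euler g = fls_const y * (euler (fls_X_inv ^ d) * \<psi> ^ c * s\<psi>
        + fls_X_inv ^ d * euler (\<psi> ^ c) * s\<psi> + fls_X_inv ^ d * \<psi> ^ c * euler s\<psi>)"
      unfolding g_def by (simp add: euler_mult distrib_left mult.assoc add_ac)
    then show ?thesis unfolding g_def euler_X_inv_power epow es
      by (simp only: distrib_left mult_ac)
  qed
  have ex: "euler x = x * (1 + of_nat q * \<nu>)"
  proof -
    have "euler x = fls_X_inv * euler (\<psi> ^ q) + fls_X_inv * \<psi> ^ q"
      by (subst x) (simp only: euler_mult euler_X_inv)
    also have "\<dots> = fls_X_inv * \<psi> ^ q * (1 + of_nat q * \<nu>)"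
      unfolding epow by (simp only: distrib_left mult_ac mult_1_left mult_1_right add.commute)
    finally show ?thesis by (simp only: x[symmetric])
  qed
  let ?\<nu>M = "power_subst z M \<nu>"
  have eq1: "ev x (pderiv R) * x * (1 + of_nat q * \<nu>) = ev x R * (of_nat d + of_nat c * \<nu> + of_nat M * ?\<nu>M)"
    using euler_ev[of x R] by (simp only: R(2) eg ex mult.assoc)
  have eq2: "ev x (pCons 0 (pderiv R) - smult (of_nat d) R) = ev x (pderiv R) * x - of_nat d * ev x R"
    by (simp add: ev_diff ev_pCons ev_smult fls_of_nat mult.commute)
  have eq3: "of_nat d * (of_nat q * \<nu>) = (of_nat c + of_nat M) * \<nu>"
    using d by (metis mult.assoc mult.commute of_nat_add of_nat_mult)
  have "(ev x (pderiv R) * x - of_nat d * ev x R) * (1 + of_nat q * \<nu>)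
      = ev x (pderiv R) * x * (1 + of_nat q * \<nu>) - ev x R * (of_nat d + of_nat d * (of_nat q * \<nu>))"
    by (simp add: algebra_simps)
  also have "\<dots> = ev x R * (of_nat M * (?\<nu>M - \<nu>))"
    unfolding eq1 eq3 by (simp add: algebra_simps)
  finally have "ev x (pCons 0 (pderiv R) - smult (of_nat d) R) * (1 + of_nat q * \<nu>)
      = ev x R * (of_nat M * (?\<nu>M - \<nu>))" by (simp only: eq2)
  moreover have "q * d \<le> M + q - 1" using c d q0 by linarith
  ultimately show ?thesis using that R0 dR by blast
qed

text \<open>
  Let \<open>q\<close> be the largest power of the characteristic for which \<open>x t = \<psi>\<^sup>q\<close>, and let \<open>k\<close> be the order of the logarithmic derivative
  \<open>\<nu>\<close> of \<open>\<psi>\<close>. For a close pair of degrees \<open>M < N\<close>, eliminating \<open>\<nu>(t)\<close> from the two identities of the previous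
  lemma leaves a polynomial \<open>D\<close> for which \<open>D(x)\<close> is, up to a unit, the product of \<open>R(x) S(x)\<close>, with a pole of order about
  \<open>(M + N) / q\<close>, and a nonzero series of order \<open>M k\<close>. A nonzero polynomial value has order at most zero, so \<open>q k M \<le> M + N + O(q)\<close> and \<open>q k \<le> 2\<close>. Since \<open>x t = 1 + O(t\<^sup>2)\<close>, only \<open>q = 1, k = 2\<close>
  and \<open>q = 2, k = 1\<close> are left.
\<close>

theorem leading_terms_of_coordinate:
  assumes close: close_pairs and x: "x \<noteq> fls_X_inv"
  shows "((2::'a) \<noteq> 0 \<and> x $$ 1 \<noteq> 0) \<or>
    (CHAR('a) = 2 \<and> (\<exists>\<psi>. x = fls_X_inv * \<psi>\<^sup>2 \<and> ord_ge 1 (\<psi> - 1) \<and> \<psi> $$ 1 \<noteq> 0))"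
proof -
  define y where "y = x * fls_X"
  have XX: "fls_X_inv * fls_X = (1 :: 'a fls)"
    by (metis fls_X_nonzero fls_inverse_X left_inverse)
  have xy: "x = fls_X_inv * y" by (simp add: y_def mult.left_commute[of _ x] XX)
  have y1: "y - 1 = (x - fls_X_inv) * fls_X" by (simp add: y_def left_diff_distrib XX)
  have "ord_ge (1 + 1) (y - 1)" unfolding y1 using x_form by (rule ord_ge_mult) (simp add: ord_ge_def)
  then have yo: "ord_ge 2 (y - 1)" by simp
  have yne: "y \<noteq> 1" using x xy by auto
  obtain e \<psi> where e: "e = 0 \<or> prime CHAR('a)" and y\<psi>: "y = \<psi> ^ (CHAR('a) ^ e)"
    and \<psi>: "ord_ge 1 (\<psi> - 1)" "euler \<psi> \<noteq> 0"
    using maximal_frobenius_power[OF ord_ge_mono[OF yo] yne] by auto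
  define q where "q = CHAR('a) ^ e"
  have q0: "q > 0" using e prime_gt_0_nat by (cases "e = 0") (auto simp: q_def)
  have x\<psi>: "x = fls_X_inv * \<psi> ^ q" using xy y\<psi> by (simp add: q_def)
  have \<psi>n: "ord_ge 0 \<psi>" "\<psi> $$ 0 = 1" "\<psi> \<noteq> 0" using ord_ge_sub_one_nth[OF \<psi>(1)] by auto
  then have s\<psi>: "fls_subdegree \<psi> = 0" by (intro fls_subdegree_eq_of_ord_ge) auto
  define \<nu> where "\<nu> = euler \<psi> / \<psi>"
  have \<nu>0: "\<nu> \<noteq> 0" using \<psi> \<psi>n by (simp add: \<nu>_def)
  have "ord_ge 1 (euler (\<psi> - 1))" by (rule ord_ge_euler[OF \<psi>(1)])
  then have e\<psi>1: "ord_ge 1 (euler \<psi>)" by (simp add: euler_diff)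
  have \<nu>\<psi>: "euler \<psi> = \<psi> * \<nu>" using \<psi>n by (simp add: \<nu>_def)
  have sub\<nu>: "fls_subdegree \<nu> = fls_subdegree (euler \<psi>)"
    unfolding \<nu>\<psi> using \<nu>0 \<psi>n s\<psi> by simp
  define k where "k = nat (fls_subdegree \<nu>)"
  have k: "int k = fls_subdegree \<nu>" "k \<ge> 1"
    using e\<psi>1 \<psi>(2) by (auto simp: k_def sub\<nu> ord_ge_iff_subdegree)
  have \<nu>k: "ord_ge (int k) \<nu>" "\<nu> $$ int k \<noteq> 0" using \<nu>0 by (simp_all add: k ord_ge_subdegree)
  have "q * k < 3"
  proof -
    obtain A \<zeta> M B \<xi> N where AB: "scales A \<zeta> M" "scales B \<xi> N" "M < N" "2 * (N - M) \<le> M" "4 * q \<le> M"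
      "of_nat M \<noteq> (0::'a)" "of_nat N \<noteq> (0::'a)"
      using close unfolding close_pairs_def by metis
    obtain R d where R: "q * d \<le> M + q - 1" "R \<noteq> 0" "degree R = d"
      "ev x (pCons 0 (pderiv R) - smult (of_nat d) R) * (1 + of_nat q * \<nu>)
        = ev x R * (of_nat M * (power_subst \<zeta> M \<nu> - \<nu>))"
      unfolding \<nu>_def by (rule frobenius_root_of_scaling_polynomial[OF e q_def x\<psi> \<psi>(1) AB(1)])
    obtain S f where S: "q * f \<le> N + q - 1" "S \<noteq> 0" "degree S = f"
      "ev x (pCons 0 (pderiv S) - smult (of_nat f) S) * (1 + of_nat q * \<nu>)
        = ev x S * (of_nat N * (power_subst \<xi> N \<nu> - \<nu>))"
      unfolding \<nu>_def by (rule frobenius_root_of_scaling_polynomial[OF e q_def x\<psi> \<psi>(1) AB(2)])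
    \<comment> \<open>The terms \<open>M N R(x) S(x) \<nu>\<close> cancel in this combination.\<close>
    define D where "D = of_nat N * (pCons 0 (pderiv R) - smult (of_nat d) R) * S
      - of_nat M * (pCons 0 (pderiv S) - smult (of_nat f) S) * R"
    have D: "ev x D * (1 + of_nat q * \<nu>) =
      of_nat M * (of_nat N * (ev x R * (ev x S * (power_subst \<zeta> M \<nu> - power_subst \<xi> N \<nu>))))"
    proof -
      let ?r = "ev x (pCons 0 (pderiv R) - smult (of_nat d) R)"
      let ?s = "ev x (pCons 0 (pderiv S) - smult (of_nat f) S)"
      have "ev x D * (1 + of_nat q * \<nu>) = of_nat N * (?r * (1 + of_nat q * \<nu>)) * ev x S
          - of_nat M * (?s * (1 + of_nat q * \<nu>)) * ev x R"
        unfolding D_def ev_diff[of x "of_nat N * _ * _"] ev_mult ev_of_nat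
        by (simp only: left_diff_distrib right_diff_distrib mult_ac)
      then show ?thesis unfolding R(4) S(4) by (simp only: right_diff_distrib mult_ac diff_diff_eq) simp
    qed
    define \<mu> where "\<mu> = power_subst \<zeta> M \<nu> - power_subst \<xi> N \<nu>"
    have MN: "\<zeta> \<noteq> 0" "M > 0" "\<xi> \<noteq> 0" "N > 0" using AB by (auto simp: scales_def)
    have "ord_ge (int M * int k) (power_subst \<zeta> M \<nu>)" using MN \<nu>k by (intro ord_ge_power_subst)
    moreover have sN: "ord_ge (int N * int k) (power_subst \<xi> N \<nu>)" using MN \<nu>k by (intro ord_ge_power_subst)
    moreover have lt: "int M * int k < int N * int k" using AB k by simp
    ultimately have o\<mu>: "ord_ge (int M * int k) \<mu>"
      unfolding \<mu>_def by (intro ord_ge_diff) (auto elim: ord_ge_mono)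
    have "power_subst \<xi> N \<nu> $$ (int M * int k) = 0" using sN lt by (simp add: ord_ge_def)
    then have "\<mu> $$ (int M * int k) \<noteq> 0"
      using MN \<nu>k by (simp add: \<mu>_def power_subst_nth)
    with o\<mu> have \<mu>: "fls_subdegree \<mu> = int M * int k" "\<mu> \<noteq> 0"
      by (auto intro: fls_subdegree_eq_of_ord_ge)
    have unit: "fls_subdegree (1 + of_nat q * \<nu>) = 0" "1 + of_nat q * \<nu> \<noteq> 0"
    proof -
      have l0: "(of_nat q * \<nu>) $$ 0 = 0" "ord_ge 0 (of_nat q * \<nu>)"
        using \<nu>k k by (auto simp: fls_of_nat_mult_nth ord_ge_def)
      then have one: "(1 + of_nat q * \<nu>) $$ 0 = 1" by simp
      moreover have "ord_ge 0 (1 + of_nat q * \<nu>)" using l0 by (intro ord_ge_add) auto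
      ultimately show "fls_subdegree (1 + of_nat q * \<nu>) = 0"
        by (auto intro: fls_subdegree_eq_of_ord_ge)
      show "1 + of_nat q * \<nu> \<noteq> 0" using one by (metis fls_zero_nth zero_neq_one)
    qed
    have nzf: "(of_nat M :: 'a fls) \<noteq> 0" "(of_nat N :: 'a fls) \<noteq> 0"
      using AB(6,7) by (metis fls_const_nonzero fls_of_nat)+
    have rhs: "of_nat M * (of_nat N * (ev x R * (ev x S * \<mu>))) \<noteq> 0"
      "fls_subdegree (of_nat M * (of_nat N * (ev x R * (ev x S * \<mu>)))) = int M * int k - int d - int f"
      using nzf subdegree_ev[OF R(2)] subdegree_ev[OF S(2)] R(3) S(3) \<mu> by simp_all
    have "ev x D \<noteq> 0" using D rhs(1) by (auto simp: \<mu>_def)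
    then have "D \<noteq> 0" by auto
    then have "fls_subdegree (ev x D * (1 + of_nat q * \<nu>)) \<le> 0"
      using subdegree_ev[of D] unit by simp
    then have "int M * int k \<le> int d + int f" using D rhs(2) by (simp add: \<mu>_def)
    then have "M * k \<le> d + f" by (metis of_nat_add of_nat_le_iff of_nat_mult)
    then have "q * (M * k) \<le> q * d + q * f" by (metis distrib_left mult_le_mono2)
    then have le: "(q * k) * M \<le> M + N + 2 * q - 2" using R(1) S(1) q0 by (simp add: mult_ac)
    show ?thesis
    proof (rule ccontr)
      assume "\<not> ?thesis"
      then have "3 * M \<le> (q * k) * M" by simp
      then show False using le AB q0 by linarith
    qed
  qed
  then have "q * k \<le> 2" by simp
  show ?thesis
  proof (cases "q = 1")
    case True
    then have "\<psi> = y" by (simp add: y\<psi> q_def)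
    then have "ord_ge 2 (euler \<psi>)" using ord_ge_euler[OF yo] by (simp add: euler_diff)
    then have "k \<ge> 2" using \<psi>(2) k sub\<nu> by (simp add: ord_ge_iff_subdegree)
    then have "k = 2" using \<open>q * k \<le> 2\<close> True by simp
    then have "euler \<psi> $$ 2 \<noteq> 0" using k sub\<nu> \<psi>(2) by (metis nth_fls_subdegree_nonzero of_nat_numeral)
    then have "2 * y $$ 2 \<noteq> 0" by (simp add: \<open>\<psi> = y\<close> euler_nth)
    moreover have "y $$ 2 = x $$ 1" by (simp add: y_def fls_X_times_conv_shift mult.commute)
    ultimately show ?thesis by auto
  next
    case False
    then have "e \<noteq> 0" by (auto simp: q_def)
    then have p: "prime CHAR('a)" using e by simp
    have "q \<ge> 2" using False q0 by simp
    moreover have "q * 1 \<le> q * k" using k by (intro mult_le_mono2)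
    ultimately have q2: "q = 2" using \<open>q * k \<le> 2\<close> by linarith
    have qk: "q = 2" "k = 1" using \<open>q * k \<le> 2\<close> k q2 by auto
    have "CHAR('a) dvd 2" using \<open>e \<noteq> 0\<close> qk by (metis dvd_power not_gr_zero q_def)
    then have "CHAR('a) = 2" using p by (metis primes_dvd_imp_eq two_is_prime_nat)
    moreover have "euler \<psi> $$ 1 \<noteq> 0" using k qk sub\<nu> \<psi>(2) by (metis nth_fls_subdegree_nonzero of_nat_1)
    then have "\<psi> $$ 1 \<noteq> 0" by (auto simp: euler_nth)
    ultimately show ?thesis using x\<psi> \<psi>(1) qk by auto
  qed
qed

end

section \<open>The conic of the coordinate away from characteristic two\<close>

text \<open>
  The Euclidean algorithm, giving the Bezout identity that survives composition with \<open>F\<close>.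
\<close>

lemma reduce_to_coprime:
  fixes A B :: "'b::field poly"
  assumes "A \<noteq> 0 \<or> B \<noteq> 0"
  obtains g A0 B0 u v where "g \<noteq> 0" "A = g * A0" "B = g * B0" "u * A0 + v * B0 = 1"
proof -
  have "\<exists>g A0 B0 u v. g \<noteq> 0 \<and> A = g * A0 \<and> B = g * B0 \<and> u * A0 + v * B0 = 1"
    using assms
  proof (induction "if B = 0 then 0 else Suc (degree B)" arbitrary: A B rule: less_induct)
    case less
    show ?case
    proof (cases "B = 0")
      case True
      then show ?thesis using less.prems by (intro exI[of _ A] exI[of _ 1] exI[of _ 0]) auto
    next
      case False
      define R where "R = A mod B"
      define Q where "Q = A div B"
      have A: "A = B * Q + R" by (simp add: Q_def R_def)
      have "(if R = 0 then 0 else Suc (degree R)) < (if B = 0 then 0 else Suc (degree B))"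
        using False degree_mod_less'[of B A] by (auto simp: R_def)
      from less.hyps[OF this] False obtain g B0 R0 u v where
        *: "g \<noteq> 0" "B = g * B0" "R = g * R0" "u * B0 + v * R0 = 1" by blast
      have "A = g * (B0 * Q + R0)" using A *(2,3) by (simp add: distrib_left mult.assoc)
      moreover have "v * (B0 * Q + R0) + (u - v * Q) * B0 = u * B0 + v * R0"
        by (simp add: algebra_simps)
      ultimately show ?thesis using * by metis
    qed
  qed
  then show ?thesis using that by blast
qed

text \<open>
  Coprimality of \<open>A\<close> and \<open>B\<close> is inherited by \<open>A \<circ> F\<close> and \<open>B \<circ> F\<close>.
\<close>

lemma dvd_of_pcompose_relation:
  fixes A B F S :: "'b::field poly"
  assumes bez: "u * A + v * B = 1" and dvd: "B \<circ>\<^sub>p F dvd S * (A \<circ>\<^sub>p F)"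
  shows "B \<circ>\<^sub>p F dvd S"
proof -
  have "(u * A + v * B) \<circ>\<^sub>p F = 1" by (simp add: bez pcompose_1)
  then have "(u \<circ>\<^sub>p F) * (A \<circ>\<^sub>p F) + (v \<circ>\<^sub>p F) * (B \<circ>\<^sub>p F) = 1"
    by (simp add: pcompose_add pcompose_mult)
  then have "S = (u \<circ>\<^sub>p F) * (S * (A \<circ>\<^sub>p F)) + S * (v \<circ>\<^sub>p F) * (B \<circ>\<^sub>p F)"
    by (metis (no_types, lifting) distrib_left mult.assoc mult.left_commute mult_1_right)
  moreover have "B \<circ>\<^sub>p F dvd (u \<circ>\<^sub>p F) * (S * (A \<circ>\<^sub>p F)) + S * (v \<circ>\<^sub>p F) * (B \<circ>\<^sub>p F)"
    by (intro dvd_add dvd_mult[OF dvd] dvd_triv_right)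
  ultimately show ?thesis by simp
qed

lemma pderiv_sum: "pderiv (sum f A) = (\<Sum>i\<in>A. pderiv (f i))"
  by (induction A rule: infinite_finite_induct) (simp_all add: pderiv_add)

lemma antiderivative_exists:
  fixes P :: "'b::field poly"
  assumes "CHAR('b) = 0" obtains C where "pderiv C = P"
proof -
  have nz: "of_nat (Suc i) \<noteq> (0::'b)" for i
    using assms by (simp only: of_nat_eq_0_iff_char_dvd) simp
  define C where "C = (\<Sum>i\<le>degree P. monom (coeff P i / of_nat (Suc i)) (Suc i))"
  have "pderiv C = (\<Sum>i\<le>degree P. monom (coeff P i) i)"
    unfolding C_def pderiv_sum
    by (intro sum.cong refl) (use nz in \<open>simp add: pderiv_monom del: of_nat_Suc\<close>)
  then have "pderiv C = P" by (simp add: poly_as_sum_of_monoms)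
  then show ?thesis using that by blast
qed

context normalized_coordinate
begin

lemma coordinate_expansion:
  obtains r where "x = fls_X_inv + fls_const (x $$ 1) * fls_X + r" "ord_ge 2 r"
    "euler x = fls_X_inv - fls_const (x $$ 1) * fls_X + euler r" "ord_ge 2 (euler r)"
proof -
  define r where "r = x - fls_X_inv - fls_const (x $$ 1) * fls_X"
  have "ord_ge (1 + 1) r"
  proof (rule ord_ge_Suc)
    show "ord_ge 1 r" unfolding r_def by (rule ord_ge_diff[OF x_form]) (simp add: ord_ge_def)
    show "r $$ 1 = 0" by (simp add: r_def)
  qed
  then have r: "ord_ge 2 r" by simp
  have "euler (fls_const (x $$ 1) * fls_X) = - (fls_const (x $$ 1) * fls_X)"
    by (intro fls_eqI) (auto simp: euler_nth)
  then have "euler r = euler x - fls_X_inv + fls_const (x $$ 1) * fls_X"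
    by (simp add: r_def euler_diff)
  then show ?thesis using that[of r] r ord_ge_euler[OF r] by (simp add: r_def)
qed

lemma subdegree_euler_x: "fls_subdegree (euler x) = -1"
  using ord_ge_euler[OF ord_ge_x] by (rule fls_subdegree_eq_of_ord_ge) (simp add: euler_nth)

text \<open>
  Substitute \<open>z t\<^sup>M\<close> into \<open>x = t\<^sup>-\<^sup>1 + a t + O(t\<^sup>2)\<close> and \<open>\<theta> x = t\<^sup>-\<^sup>1 - a t + O(t\<^sup>2)\<close>, with \<open>U = z\<^sup>-\<^sup>1 t\<^sup>-\<^sup>M\<close>.
\<close>

lemma scales_expansion:
  assumes P: "scales P z M"
  defines "a \<equiv> fls_const (x $$ 1)"
  obtains U where "U \<noteq> 0" "fls_subdegree U = - int M" "euler U = of_nat M * U"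
    "ord_ge (2 * int M) (ev x P - (U + a / U))"
    "ord_ge (2 * int M) (power_subst z M (euler x) - (U - a / U))"
proof -
  have z: "z \<noteq> 0" "M > 0" "ev x P = power_subst z M x" using P by (auto simp: scales_def)
  obtain r where r: "x = fls_X_inv + a * fls_X + r" "ord_ge 2 r"
    "euler x = fls_X_inv - a * fls_X + euler r" "ord_ge 2 (euler r)"
    unfolding a_def by (rule coordinate_expansion)
  define U where "U = power_subst z M fls_X_inv"
  have U: "U \<noteq> 0" using z by (simp add: U_def power_subst_eq_0_iff)
  have sa: "power_subst z M a = a" using z by (simp add: a_def power_subst_const)
  have sX: "power_subst z M fls_X = 1 / U"
  proof -
    have "U = inverse (power_subst z M fls_X)"
      unfolding U_def fls_inverse_X[symmetric] by (rule power_subst_inverse[OF z(1,2)])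
    then show ?thesis by (simp add: inverse_eq_divide)
  qed
  have "power_subst z M x = U + a / U + power_subst z M r"
    by (subst r(1)) (simp add: power_subst_add z power_subst_mult sa sX U_def)
  moreover have "power_subst z M (euler x) = U - a / U + power_subst z M (euler r)"
    by (subst r(3)) (simp add: power_subst_add power_subst_diff z power_subst_mult sa sX U_def)
  moreover have "ord_ge (2 * int M) (power_subst z M r)" "ord_ge (2 * int M) (power_subst z M (euler r))"
    using ord_ge_power_subst[OF z(1,2) r(2)] ord_ge_power_subst[OF z(1,2) r(4)] by (simp_all add: mult.commute)
  moreover have "euler U = of_nat M * U"
    using z by (simp add: U_def euler_power_subst)
  moreover have "fls_subdegree U = - int M"
    using z fls_subdegree_power_subst(1)[of z M fls_X_inv] by (simp add: U_def)
  ultimately show ?thesis using that[of U] U z by simp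
qed

text \<open>
  Up to errors, \<open>A(x) = Z + a / Z\<close> and \<open>B(x) = Y + a / Y\<close> for monomials \<open>Z, Y\<close> of degrees \<open>M, N\<close> in \<open>t\<^sup>-\<^sup>1\<close>. The combination
  \<open>N A' B - M A B'\<close> is the addition formula for the hyperbolic sine of a difference: times \<open>\<theta> x\<close> it is a multiple
  of \<open>\<rho> - 1 / \<rho>\<close> with \<open>\<rho> = Y / Z\<close>. Thus a polynomial of degree only \<open>N - M - 1\<close> is controlled to order \<open>2 M - N\<close>.
\<close>

lemma sinh_polynomial:
  assumes A: "scales A \<zeta> M" and B: "scales B \<xi> N" and MN: "M < N"
    and nz: "of_nat M \<noteq> (0::'a)" "of_nat N \<noteq> (0::'a)" "(2::'a) \<noteq> 0" "x $$ 1 \<noteq> 0"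
    and close: "2 * (N - M) < M"
  obtains V \<rho> where "\<rho> \<noteq> 0" "fls_subdegree \<rho> = - int (N - M)" "euler \<rho> = of_nat (N - M) * \<rho>"
    "ord_ge (2 * int M - int N) (euler x * ev x V - (\<rho> - 1 / \<rho>))" "V \<noteq> 0" "degree V = N - M - 1"
proof -
  define a where "a = fls_const (x $$ 1)"
  define w where "w = euler x"
  obtain Z where Z: "Z \<noteq> 0" "fls_subdegree Z = - int M" "euler Z = of_nat M * Z"
    "ord_ge (2 * int M) (ev x A - (Z + a / Z))"
    "ord_ge (2 * int M) (power_subst \<zeta> M w - (Z - a / Z))"
    unfolding a_def w_def by (rule scales_expansion[OF A])
  obtain Y where Y: "Y \<noteq> 0" "fls_subdegree Y = - int N" "euler Y = of_nat N * Y"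
    "ord_ge (2 * int N) (ev x B - (Y + a / Y))"
    "ord_ge (2 * int N) (power_subst \<xi> N w - (Y - a / Y))"
    unfolding a_def w_def by (rule scales_expansion[OF B])
  have deriv: "w * ev x (pderiv P) = of_nat k * power_subst z k w" if "scales P z k" for P z k
    using that euler_ev[of x P] by (simp add: scales_def euler_power_subst w_def mult.commute)
  define a1 a2 b1 b2 where "a1 = ev x A - (Z + a / Z)" and "a2 = power_subst \<zeta> M w - (Z - a / Z)"
    and "b1 = ev x B - (Y + a / Y)" and "b2 = power_subst \<xi> N w - (Y - a / Y)"
  note o = Z(4,5)[folded a1_def a2_def] Y(4,5)[folded b1_def b2_def]
  define E where "E = a2 * ev x B + (Z - a / Z) * b1 - a1 * power_subst \<xi> N w - (Z + a / Z) * b2"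
  have inv: "fls_subdegree (1 / f) = - fls_subdegree f" if "f \<noteq> 0" for f :: "'a fls"
  proof -
    have "fls_subdegree (f * (1 / f)) = fls_subdegree f + fls_subdegree (1 / f)"
      using that by (intro fls_subdegree_mult) auto
    then show ?thesis using that by simp
  qed
  have oa: "ord_ge 0 a" by (simp add: a_def)
  have oZ: "ord_ge (- int M) Z" "ord_ge (int M) (1 / Z)" "ord_ge (- int N) Y" "ord_ge (int N) (1 / Y)"
    using inv Z Y by (auto simp: ord_ge_iff_subdegree)
  have oaZ: "ord_ge (- int M) (a / Z)" "ord_ge (- int N) (a / Y)"
    using ord_ge_mult[OF oa oZ(2)] ord_ge_mult[OF oa oZ(4)] by (auto elim!: ord_ge_mono)
  have oZa: "ord_ge (- int M) (Z - a / Z)" "ord_ge (- int M) (Z + a / Z)"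
    using oZ(1) oaZ(1) by (auto intro: ord_ge_add ord_ge_diff)
  have oB: "ord_ge (- int N) (ev x B)" "ord_ge (- int N) (power_subst \<xi> N w)"
  proof -
    have "ord_ge (- int N) (b1 + (Y + a / Y))" "ord_ge (- int N) (b2 + (Y - a / Y))"
      using oZ(3) oaZ(2) by (intro ord_ge_add ord_ge_diff ord_ge_mono[OF o(3)] ord_ge_mono[OF o(4)]; simp)+
    then show "ord_ge (- int N) (ev x B)" "ord_ge (- int N) (power_subst \<xi> N w)"
      by (simp_all add: b1_def b2_def)
  qed
  have oE: "ord_ge (2 * int M - int N) E"
    unfolding E_def
  proof (intro ord_ge_add ord_ge_diff)
    show "ord_ge (2 * int M - int N) (a2 * ev x B)" using ord_ge_mult[OF o(2) oB(1)] by simp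
    show "ord_ge (2 * int M - int N) (a1 * power_subst \<xi> N w)" using ord_ge_mult[OF o(1) oB(2)] by simp
    show "ord_ge (2 * int M - int N) ((Z - a / Z) * b1)"
      using MN by (intro ord_ge_mono[OF ord_ge_mult[OF oZa(1) o(3)]]) simp
    show "ord_ge (2 * int M - int N) ((Z + a / Z) * b2)"
      using MN by (intro ord_ge_mono[OF ord_ge_mult[OF oZa(2) o(4)]]) simp
  qed
  define \<rho> where "\<rho> = Y / Z"
  have \<rho>0: "\<rho> \<noteq> 0" using Y Z by (simp add: \<rho>_def)
  have main: "power_subst \<zeta> M w * ev x B - ev x A * power_subst \<xi> N w = E - 2 * a * (\<rho> - 1 / \<rho>)"
  proof -
    have "power_subst \<zeta> M w * ev x B - ev x A * power_subst \<xi> N w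
      = E + ((Z - a / Z) * (Y + a / Y) - (Z + a / Z) * (Y - a / Y))"
      by (simp add: E_def a1_def a2_def b1_def b2_def) (simp add: algebra_simps)
    also have "(Z - a / Z) * (Y + a / Y) - (Z + a / Z) * (Y - a / Y) = - (2 * a * (\<rho> - 1 / \<rho>))"
      using Y(1) Z(1) by (simp add: \<rho>_def field_simps)
    finally show ?thesis by simp
  qed
  \<comment> \<open>The dominant product \<open>Z Y\<close> cancels in this combination, which makes the degree drop to \<open>N - M - 1\<close>.\<close>
  define W where "W = of_nat N * pderiv A * B - of_nat M * A * pderiv B"
  define V where "V = smult (- 1 / (2 * x $$ 1 * of_nat M * of_nat N)) W"
  have "w * ev x W = of_nat M * (of_nat N * (power_subst \<zeta> M w * ev x B - ev x A * power_subst \<xi> N w))"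
  proof -
    have "w * ev x W = of_nat N * (w * ev x (pderiv A)) * ev x B - of_nat M * ev x A * (w * ev x (pderiv B))"
      by (simp add: W_def ev_diff ev_mult ev_of_nat algebra_simps)
    then show ?thesis unfolding deriv[OF A] deriv[OF B] by (simp add: algebra_simps)
  qed
  then have wW: "w * ev x W = of_nat M * (of_nat N * (E - 2 * a * (\<rho> - 1 / \<rho>)))" by (simp only: main)
  have c1: "fls_const (- 1 / (2 * x $$ 1 * of_nat M * of_nat N)) * (of_nat M * (of_nat N * (2 * a))) = -1"
  proof -
    have eqs: "(of_nat k :: 'a fls) = fls_const (of_nat k)" "(2 :: 'a fls) = fls_const 2" for k
      by (simp_all add: fls_of_nat fls_const_numeral)
    have "fls_const (- 1) = (- 1 :: 'a fls)" by (intro fls_eqI) simp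
    then show ?thesis unfolding eqs a_def fls_const_mult_const using nz by simp
  qed
  define E' where "E' = fls_const (- 1 / (2 * x $$ 1 * of_nat M * of_nat N)) * (of_nat M * (of_nat N * E))"
  have oE': "ord_ge (2 * int M - int N) E'"
    unfolding E'_def by (intro ord_ge_cmult ord_ge_of_nat_mult oE)
  have wV: "w * ev x V = (\<rho> - 1 / \<rho>) + E'"
  proof -
    let ?c = "fls_const (- 1 / (2 * x $$ 1 * of_nat M * of_nat N))"
    have "w * ev x V = ?c * (w * ev x W)" unfolding V_def ev_smult by (simp only: mult.left_commute)
    also have "\<dots> = E' - ?c * (of_nat M * (of_nat N * (2 * a))) * (\<rho> - 1 / \<rho>)"
      unfolding wW E'_def by (simp only: right_diff_distrib mult.assoc)
    finally show ?thesis unfolding c1 by simp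
  qed
  have s\<rho>: "fls_subdegree \<rho> = - int (N - M)"
  proof -
    have "fls_subdegree (\<rho> * Z) = fls_subdegree \<rho> + fls_subdegree Z"
      using \<rho>0 Z(1) by (rule fls_subdegree_mult)
    moreover have "\<rho> * Z = Y" using Z(1) by (simp add: \<rho>_def)
    ultimately have "fls_subdegree \<rho> = - int N + int M" using Y Z by simp
    then show ?thesis using MN by simp
  qed
  have e\<rho>: "euler \<rho> = of_nat (N - M) * \<rho>"
  proof -
    have "of_nat N * Y = euler (\<rho> * Z)" using Y Z by (simp add: \<rho>_def)
    also have "\<dots> = \<rho> * (of_nat M * Z) + euler \<rho> * Z" by (simp add: euler_mult Z)
    finally have "euler \<rho> * Z = (of_nat N - of_nat M) * (\<rho> * Z)" using Y Z
      by (simp add: \<rho>_def algebra_simps)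
    then have "euler \<rho> = (of_nat N - of_nat M) * \<rho>" using Z by simp
    then show ?thesis using MN by (simp add: of_nat_diff)
  qed
  have top: "fls_subdegree (w * ev x V) = - int (N - M)" "w * ev x V \<noteq> 0"
  proof -
    have oi: "ord_ge (int (N - M)) (1 / \<rho>)" using inv[OF \<rho>0] s\<rho> by (simp add: ord_ge_iff_subdegree)
    have o1: "ord_ge (- int (N - M) + 1) (E' - 1 / \<rho>)"
      using MN close by (intro ord_ge_diff ord_ge_mono[OF oE'] ord_ge_mono[OF oi]) auto
    have "w * ev x V = \<rho> + (E' - 1 / \<rho>)" by (simp add: wV)
    moreover have "\<rho> $$ (- int (N - M)) \<noteq> 0" using s\<rho> \<rho>0 by (metis nth_fls_subdegree_nonzero)
    moreover have "(E' - 1 / \<rho>) $$ (- int (N - M)) = 0" using o1 by (simp add: ord_ge_def)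
    ultimately have "(w * ev x V) $$ (- int (N - M)) \<noteq> 0" by simp
    moreover have "ord_ge (- int (N - M)) (w * ev x V)"
      unfolding \<open>w * ev x V = \<rho> + (E' - 1 / \<rho>)\<close>
      using s\<rho> by (intro ord_ge_add ord_ge_mono[OF o1]) (auto simp: ord_ge_iff_subdegree)
    ultimately show "fls_subdegree (w * ev x V) = - int (N - M)" "w * ev x V \<noteq> 0"
      by (auto intro: fls_subdegree_eq_of_ord_ge)
  qed
  have V0: "V \<noteq> 0" using top(2) by auto
  have "fls_subdegree (w * ev x V) = -1 - int (degree V)"
    using subdegree_ev[OF V0] subdegree_euler_x euler_x_nonzero by (simp add: w_def)
  then have "degree V = N - M - 1" using top(1) by simp
  then show ?thesis using that[of \<rho> V] \<rho>0 s\<rho> e\<rho> oE' V0 by (simp add: wV[unfolded w_def])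
qed

end

lemma fls_numeral_mult_const: "numeral k * fls_const c = fls_const (numeral k * c :: 'b::field)"
  by (metis fls_const_numeral fls_const_mult_const)

context normalized_coordinate
begin

lemma ord_ge_ev_degree: "degree P \<le> d \<Longrightarrow> ord_ge (- int d) (ev x P)"
  using ord_ge_ev[of 1 x P d] ord_ge_x by simp

lemma ev_pcompose_scales: "scales F z m \<Longrightarrow> ev x (P \<circ>\<^sub>p F) = power_subst z m (ev x P)"
  by (simp add: scales_def ev_pcompose power_subst_ev)

text \<open>
  Apply \<open>\<theta>\<close> to \<open>F(x) = x(z t\<^sup>m)\<close>.
\<close>

lemma euler_functional_equation:
  assumes "scales F z m"
  shows "ev x (pderiv F) * euler x = of_nat m * power_subst z m (euler x)"
  using assms euler_ev[of x F] by (simp add: scales_def euler_power_subst)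

lemma quadratic_functional_equation:
  assumes "scales F z m"
  shows "ev x ((pderiv F)\<^sup>2) * (euler x)\<^sup>2 = (of_nat m)\<^sup>2 * power_subst z m ((euler x)\<^sup>2)"
proof -
  have z: "z \<noteq> 0" "m > 0" using assms by (auto simp: scales_def)
  have "ev x ((pderiv F)\<^sup>2) * (euler x)\<^sup>2 = (ev x (pderiv F) * euler x)\<^sup>2"
    by (simp add: ev_power power_mult_distrib)
  then show ?thesis
    by (simp only: euler_functional_equation[OF assms] power_mult_distrib power_subst_power[OF z])
qed

text \<open>
  Named after the curve \<open>w\<^sup>2 = x\<^sup>2 - 4 a\<close>, where \<open>a\<close> is the coefficient of \<open>t\<close> in the coordinate \<open>x\<close>; the equations below say that \<open>F\<close> together with
  \<open>F'\<close> maps this curve to itself.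
\<close>

definition conic :: "'a poly" where
  "conic = [:- 4 * x $$ 1, 0, 1:]"

text \<open>
  For the model coordinate \<open>x = u + a / u\<close> with \<open>u = t\<^sup>-\<^sup>1\<close> one has \<open>\<theta> x = u - a / u\<close> and exactly
  \<open>(\<theta> x)\<^sup>2 = x\<^sup>2 - 4 a\<close>. In general the two sides agree up to positive order, which pins down the polynomial.
\<close>

lemma ord_ge_conic: "ord_ge 1 ((euler x)\<^sup>2 - ev x conic)"
proof -
  define a where "a = fls_const (x $$ 1)"
  obtain r where r: "x = fls_X_inv + a * fls_X + r" "ord_ge 2 r"
    "euler x = fls_X_inv - a * fls_X + euler r" "ord_ge 2 (euler r)"
    unfolding a_def by (rule coordinate_expansion)
  have XX: "fls_X_inv * fls_X = (1 :: 'a fls)"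
    by (metis fls_X_nonzero fls_inverse_X left_inverse)
  have four: "ev x conic = x\<^sup>2 - 4 * a"
  proof -
    have "fls_const (- 4 * x $$ 1) = - (4 * a)"
      unfolding a_def fls_numeral_mult_const by (intro fls_eqI) simp
    then show ?thesis by (simp add: conic_def ev_pCons power2_eq_square)
  qed
  have "(euler x)\<^sup>2 - x\<^sup>2 = (euler x - x) * (euler x + x)"
    by (simp add: power2_eq_square algebra_simps)
  also have "euler x - x = - 2 * a * fls_X + (euler r - r)"
    by (subst r(1), subst r(3)) (simp add: algebra_simps)
  also have "euler x + x = 2 * fls_X_inv + (euler r + r)"
    by (subst (2) r(1), subst r(3)) (simp add: algebra_simps)
  also have "(- 2 * a * fls_X + (euler r - r)) * (2 * fls_X_inv + (euler r + r))
    = - 4 * a * (fls_X_inv * fls_X) + (- 2 * a * fls_X * (euler r + r) + (euler r - r) * (2 * fls_X_inv + (euler r + r)))"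
    by (simp add: algebra_simps)
  finally have "(euler x)\<^sup>2 - x\<^sup>2 = - 4 * a +
     (- 2 * a * fls_X * (euler r + r) + (euler r - r) * (2 * fls_X_inv + (euler r + r)))"
    by (simp only: XX mult_1_right)
  then have eq: "(euler x)\<^sup>2 - ev x conic =
     - 2 * a * fls_X * (euler r + r) + (euler r - r) * (2 * fls_X_inv + (euler r + r))"
    by (simp add: four) (simp add: algebra_simps)
  have "ord_ge 0 (of_nat 2 * a)" unfolding a_def by (intro ord_ge_of_nat_mult) simp
  moreover have "ord_ge 1 (fls_X :: 'a fls)" by (simp add: ord_ge_def)
  ultimately have "ord_ge (0 + 1) (of_nat 2 * a * fls_X)" by (rule ord_ge_mult)
  then have "ord_ge 1 (- 2 * a * fls_X)" using ord_ge_uminus by fastforce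
  then have 1: "ord_ge (1 + 2) (- 2 * a * fls_X * (euler r + r))"
    by (intro ord_ge_mult ord_ge_add r)
  have "ord_ge (-1) (of_nat 2 * fls_X_inv :: 'a fls)" by (intro ord_ge_of_nat_mult ord_ge_X_inv)
  then have 2: "ord_ge (2 + (-1)) ((euler r - r) * (2 * fls_X_inv + (euler r + r)))"
    by (intro ord_ge_mult ord_ge_add ord_ge_diff r ord_ge_mono[OF r(2)] ord_ge_mono[OF r(4)]) simp_all
  show ?thesis unfolding eq
    using ord_ge_mono[OF 1, of 1] ord_ge_mono[OF 2, of 1] by (intro ord_ge_add) simp_all
qed

lemma conic_unique:
  assumes "ord_ge 1 ((euler x)\<^sup>2 - ev x Y)" shows "Y = conic"
proof -
  have "ord_ge 1 (((euler x)\<^sup>2 - ev x conic) - ((euler x)\<^sup>2 - ev x Y))"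
    by (rule ord_ge_diff[OF ord_ge_conic assms])
  then have "ord_ge 1 (ev x (Y - conic))" by (simp add: ev_diff)
  then have "Y - conic = 0" by (rule ev_eq_0I[rotated]) simp
  then show ?thesis by simp
qed

text \<open>
  Clearing denominators in \<open>F'(x)\<^sup>2 (\<theta> x)\<^sup>2 = m\<^sup>2 (\<theta> x)\<^sup>2(z t\<^sup>m)\<close> with \<open>A / B\<close> in place of \<open>(\<theta> x)\<^sup>2\<close>
  leaves a polynomial value of positive order, so the identity \<open>m\<^sup>2 A(F) B = F'\<^sup>2 A B(F)\<close> is exact. In lowest
  terms \<open>B \<circ> F\<close> divides \<open>B\<close>, so \<open>B\<close> is constant.
\<close>

lemma rational_approximation_imp_polynomial:
  assumes F: "scales F z m" and m: "m > 1" "of_nat m \<noteq> (0::'a)"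
    and B: "B \<noteq> 0" and appr: "ord_ge J ((euler x)\<^sup>2 * ev x B - ev x A)"
    and J: "J \<ge> 2 * int m + int m * int (degree B)"
  obtains Y where "ord_ge 1 ((euler x)\<^sup>2 - ev x Y)" "smult ((of_nat m)\<^sup>2) (Y \<circ>\<^sub>p F) = (pderiv F)\<^sup>2 * Y"
proof -
  define q where "q = (euler x)\<^sup>2"
  have z: "z \<noteq> 0" "m > 0" using F by (auto simp: scales_def)
  define \<epsilon> where "\<epsilon> = q * ev x B - ev x A"
  have \<epsilon>: "ord_ge J \<epsilon>" using appr by (simp add: \<epsilon>_def q_def)
  have evA: "ev x A = q * ev x B - \<epsilon>" by (simp add: \<epsilon>_def)
  have J0: "J \<ge> 0" using J by (rule order_trans[rotated]) simp
  define m2 where "m2 = fls_const ((of_nat m)\<^sup>2 :: 'a)"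
  have m2: "m2 = (of_nat m)\<^sup>2" by (simp add: m2_def fls_const_power fls_of_nat)
  have fe: "ev x ((pderiv F)\<^sup>2) * q = m2 * power_subst z m q"
    using quadratic_functional_equation[OF F] by (simp add: q_def m2)
  define D where "D = smult ((of_nat m)\<^sup>2) ((A \<circ>\<^sub>p F) * B) - (pderiv F)\<^sup>2 * (A * (B \<circ>\<^sub>p F))"
  let ?sB = "power_subst z m (ev x B)"
  have "ev x D = m2 * ((power_subst z m q * ?sB - power_subst z m \<epsilon>) * ev x B)
      - ev x ((pderiv F)\<^sup>2) * ((q * ev x B - \<epsilon>) * ?sB)"
    unfolding D_def ev_diff ev_smult ev_mult ev_pcompose_scales[OF F] evA
      power_subst_diff[OF z] power_subst_mult[OF z] m2_def by (simp only: ev_mult)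
  also have "\<dots> = (m2 * power_subst z m q - ev x ((pderiv F)\<^sup>2) * q) * ?sB * ev x B
      - m2 * (power_subst z m \<epsilon> * ev x B) + ev x ((pderiv F)\<^sup>2) * (\<epsilon> * ?sB)"
    by (simp add: left_diff_distrib right_diff_distrib mult_ac)
  finally have evD: "ev x D = ev x ((pderiv F)\<^sup>2) * (\<epsilon> * ?sB) - m2 * (power_subst z m \<epsilon> * ev x B)"
    by (simp add: fe)
  have oB: "ord_ge (- int (degree B)) (ev x B)" by (rule ord_ge_ev_degree) simp
  have osB: "ord_ge (int m * - int (degree B)) ?sB" by (rule ord_ge_power_subst[OF z oB])
  have "degree ((pderiv F)\<^sup>2) \<le> 2 * (m - 1)"
    using degree_power_le[of "pderiv F" 2] degree_pderiv_le[of F] degree_scales[OF F] by simp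
  then have oF: "ord_ge (- int (2 * (m - 1))) (ev x ((pderiv F)\<^sup>2))" by (rule ord_ge_ev_degree)
  have "ord_ge 1 (ev x D)"
    unfolding evD
  proof (rule ord_ge_diff)
    show "ord_ge 1 (ev x ((pderiv F)\<^sup>2) * (\<epsilon> * ?sB))"
      using ord_ge_mult[OF oF ord_ge_mult[OF \<epsilon> osB]]
      by (rule ord_ge_mono) (use J m in \<open>simp add: of_nat_diff\<close>)
    have "int m * J \<ge> J" using J0 m(1) mult_right_mono[of 1 "int m" J] by simp
    moreover have "int m * int (degree B) \<ge> int (degree B)" using m(1) mult_right_mono[of 1 "int m" "int (degree B)"] by simp
    ultimately have le: "1 \<le> int m * J + - int (degree B)" using J m(1) by linarith
    show "ord_ge 1 (m2 * (power_subst z m \<epsilon> * ev x B))"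
      unfolding m2_def
      by (intro ord_ge_cmult ord_ge_mono[OF ord_ge_mult[OF ord_ge_power_subst[OF z \<epsilon>] oB]] le)
  qed
  then have D0: "D = 0" by (rule ev_eq_0I[rotated]) simp
  obtain g A0 B0 u v where g: "g \<noteq> 0" "A = g * A0" "B = g * B0" "u * A0 + v * B0 = 1"
    using reduce_to_coprime[OF disjI2[OF B], of A] by metis
  have dF: "degree F = m" by (rule degree_scales[OF F])
  have gF: "g \<circ>\<^sub>p F \<noteq> 0" using g(1) dF m pcompose_eq_0[of g F] by auto
  have "(g * (g \<circ>\<^sub>p F)) * (smult ((of_nat m)\<^sup>2) ((A0 \<circ>\<^sub>p F) * B0)) = (g * (g \<circ>\<^sub>p F)) * ((pderiv F)\<^sup>2 * (A0 * (B0 \<circ>\<^sub>p F)))"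
    using D0 by (simp add: D_def g(2,3) pcompose_mult mult_ac)
  then have eq: "smult ((of_nat m)\<^sup>2) ((A0 \<circ>\<^sub>p F) * B0) = (pderiv F)\<^sup>2 * (A0 * (B0 \<circ>\<^sub>p F))"
    by (rule mult_left_cancel[THEN iffD1, rotated]) (use g(1) gF in simp)
  have "B0 \<circ>\<^sub>p F dvd smult ((of_nat m)\<^sup>2) ((A0 \<circ>\<^sub>p F) * B0)" unfolding eq by simp
  then have "B0 \<circ>\<^sub>p F dvd B0 * (A0 \<circ>\<^sub>p F)" using m(2) by (simp add: dvd_smult_iff mult.commute)
  then have "B0 \<circ>\<^sub>p F dvd B0" by (rule dvd_of_pcompose_relation[OF g(4)])
  moreover have B00: "B0 \<noteq> 0" using B g by auto
  ultimately have "degree B0 * m \<le> degree B0" using dvd_imp_degree_le degree_pcompose dF by metis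
  moreover have "degree B0 * 2 \<le> degree B0 * m" using m(1) by (intro mult_le_mono2) simp
  ultimately have "degree B0 = 0" by linarith
  then obtain b where b: "B0 = [:b:]" by (metis degree_eq_zeroE)
  then have b0: "b \<noteq> 0" using B00 by simp
  define Y where "Y = smult (inverse b) A0"
  have "smult ((of_nat m)\<^sup>2) (Y \<circ>\<^sub>p F) = (pderiv F)\<^sup>2 * Y"
  proof -
    have "smult b (smult ((of_nat m)\<^sup>2) (A0 \<circ>\<^sub>p F)) = smult b ((pderiv F)\<^sup>2 * A0)"
      using eq by (simp add: b mult.commute pcompose_const)
    from arg_cong[OF this, of "smult (inverse b)"]
    have e: "smult ((of_nat m)\<^sup>2) (A0 \<circ>\<^sub>p F) = (pderiv F)\<^sup>2 * A0"
      using b0 by (simp add: mult.assoc[symmetric])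
    show ?thesis unfolding Y_def pcompose_smult mult_smult_right e[symmetric]
      by (simp only: smult_smult mult.commute)
  qed
  moreover have "ord_ge 1 (q - ev x Y)"
  proof -
    have "ev x B = ev x (smult b g)" by (simp add: g b)
    moreover have "ev x A = ev x (smult b g) * ev x Y" using b0 by (simp add: g Y_def flip: ev_mult)
    ultimately have "\<epsilon> = ev x (smult b g) * (q - ev x Y)" by (simp add: \<epsilon>_def left_diff_distrib mult.commute[of "ev x (smult b g)"])
    then have "ord_ge (J - fls_subdegree (ev x (smult b g))) (q - ev x Y)"
      using \<epsilon> subdegree_ev(2)[of "smult b g"] g(1) b0 by (intro ord_ge_cancel) auto
    moreover have "fls_subdegree (ev x (smult b g)) \<le> 0"
      using subdegree_ev(1)[of "smult b g"] g(1) b0 by simp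
    moreover have "J \<ge> 1"
    proof -
      have "0 \<le> int m * int (degree B)" by simp
      then show ?thesis using J m(1) by linarith
    qed
    ultimately show ?thesis by (elim ord_ge_mono) linarith
  qed
  ultimately show ?thesis using that by (simp add: q_def)
qed

text \<open>
  Since \<open>\<theta>(\<rho> + 1 / \<rho>) = d (\<rho> - 1 / \<rho>)\<close>, integrating \<open>d V\<close> gives a polynomial \<open>C\<close> with
  \<open>C(x) = \<rho> + 1 / \<rho>\<close> up to a tiny error. Then \<open>(\<theta> x)\<^sup>2 V(x)\<^sup>2 = C(x)\<^sup>2 - 4\<close> up to a tiny error, so
  \<open>(C\<^sup>2 - 4) / V\<^sup>2\<close> approximates \<open>(\<theta> x)\<^sup>2\<close>.
\<close>

lemma conic_equation_char_0:
  assumes close: close_pairs and F: "scales F z m" and m: "m > 1" "of_nat m \<noteq> (0::'a)"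
    and a: "x $$ 1 \<noteq> 0" "(2::'a) \<noteq> 0" and char: "CHAR('a) = 0"
  shows "smult ((of_nat m)\<^sup>2) (conic \<circ>\<^sub>p F) = (pderiv F)\<^sup>2 * conic"
proof -
  define w where "w = euler x"
  \<comment> \<open>The factor leaves room for the precision \<open>2 m + m degree (V\<^sup>2)\<close> demanded of the approximation, where \<open>degree (V\<^sup>2) < 2 (N - M)\<close>.\<close>
  obtain A \<zeta> M B \<xi> N where AB: "scales A \<zeta> M" "scales B \<xi> N" "M < N" "(4 * m + 8) * (N - M) \<le> M"
     "of_nat M \<noteq> (0::'a)" "of_nat N \<noteq> (0::'a)"
    using close unfolding close_pairs_def by metis
  define d where "d = N - M"
  have d: "d \<ge> 1" "(4 * m + 8) * d \<le> M" using AB by (simp_all add: d_def)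
  have d2: "2 * (N - M) < M"
  proof -
    have "2 * d + 1 \<le> (4 * m + 8) * d" using d(1) by (simp add: distrib_right)
    then show ?thesis using d(2) by (simp add: d_def)
  qed
  define K where "K = 2 * int M - int N"
  have KM: "K = int M - int d" using AB(3) by (simp add: K_def d_def)
  obtain V \<rho> where V: "\<rho> \<noteq> 0" "fls_subdegree \<rho> = - int d" "euler \<rho> = of_nat d * \<rho>"
    "ord_ge K (w * ev x V - (\<rho> - 1 / \<rho>))" "V \<noteq> 0" "degree V = d - 1"
    unfolding w_def d_def K_def by (rule sinh_polynomial[OF AB(1,2,3,5,6) a(2,1) d2])
  obtain C0 where C0: "pderiv C0 = smult (of_nat d) V" using antiderivative_exists[OF char] by blast
  define T where "T = ev x C0 - (\<rho> + 1 / \<rho>)"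
  have einv: "euler (1 / \<rho>) = - (of_nat d * (1 / \<rho>))"
    using V(1) euler_inverse[of \<rho>] by (simp add: V(3) inverse_eq_divide field_simps power2_eq_square)
  have "euler T = of_nat d * (w * ev x V - (\<rho> - 1 / \<rho>))"
    unfolding T_def euler_diff euler_add euler_ev C0 ev_smult V(3) einv
    by (simp add: w_def fls_of_nat right_diff_distrib mult_ac)
  then have eT: "ord_ge K (euler T)" using V(4) by (simp add: ord_ge_of_nat_mult)
  \<comment> \<open>\<open>\<theta> T\<close> controls every coefficient of \<open>T\<close> except the constant one.\<close>
  define C where "C = C0 - [:T $$ 0:]"
  have oT: "ord_ge K (ev x C - (\<rho> + 1 / \<rho>))"
    unfolding ord_ge_def
  proof safe
    fix i assume i: "i < K"
    have "ev x C - (\<rho> + 1 / \<rho>) = T - fls_const (T $$ 0)" by (simp add: C_def T_def ev_diff)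
    moreover have "T $$ i = 0" if "i \<noteq> 0"
    proof -
      have "euler T $$ i = 0" using eT i by (simp add: ord_ge_def)
      then show ?thesis using that char by (simp add: euler_nth of_int_eq_0_iff_char_dvd)
    qed
    ultimately show "(ev x C - (\<rho> + 1 / \<rho>)) $$ i = 0" by (cases "i = 0") auto
  qed
  define E1 where "E1 = w * ev x V - (\<rho> - 1 / \<rho>)"
  define E2 where "E2 = ev x C - (\<rho> + 1 / \<rho>)"
  have oE: "ord_ge K E1" "ord_ge K E2" using V(4) oT by (simp_all add: E1_def E2_def)
  have o\<rho>: "ord_ge (- int d) \<rho>" using V by (simp add: ord_ge_iff_subdegree)
  have "fls_subdegree (\<rho> * (1 / \<rho>)) = fls_subdegree \<rho> + fls_subdegree (1 / \<rho>)"
    using V(1) by (intro fls_subdegree_mult) auto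
  then have o\<rho>': "ord_ge (- int d) (1 / \<rho>)" using V by (simp add: ord_ge_iff_subdegree)
  have K0: "K \<ge> 0" using d2 AB(3) by (simp add: K_def)
  have "ord_ge (K - int d) (w\<^sup>2 * ev x (V\<^sup>2) - ev x (C\<^sup>2 - [:4:]))"
  proof -
    have "w\<^sup>2 * ev x (V\<^sup>2) = (E1 + (\<rho> - 1 / \<rho>))\<^sup>2"
      by (simp add: E1_def ev_power power_mult_distrib)
    moreover have "ev x (C\<^sup>2 - [:4:]) = (E2 + (\<rho> + 1 / \<rho>))\<^sup>2 - 4"
      by (simp add: E2_def ev_diff ev_power)
    moreover have "(E1 + (\<rho> - 1 / \<rho>))\<^sup>2 - ((E2 + (\<rho> + 1 / \<rho>))\<^sup>2 - 4)
       = E1 * (E1 + (\<rho> - 1 / \<rho>) + (\<rho> - 1 / \<rho>)) - E2 * (E2 + (\<rho> + 1 / \<rho>) + (\<rho> + 1 / \<rho>))"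
    proof -
      have "(p - i)\<^sup>2 - ((p + i)\<^sup>2 - 4) = 4 - 4 * (p * i)" for p i :: "'a fls"
        by (simp add: power2_eq_square algebra_simps)
      from this[of \<rho> "1 / \<rho>"] have zero: "(\<rho> - 1 / \<rho>)\<^sup>2 - ((\<rho> + 1 / \<rho>)\<^sup>2 - 4) = 0" using V(1) by simp
      have id: "(e + s)\<^sup>2 - ((f + c)\<^sup>2 - 4) = e * (e + s + s) - f * (f + c + c) + (s\<^sup>2 - (c\<^sup>2 - 4))"
        for e f s c :: "'a fls" by (simp add: power2_eq_square algebra_simps)
      show ?thesis unfolding id zero by (simp only: add_0_right)
    qed
    moreover have "ord_ge (K + - int d) (E1 * (E1 + (\<rho> - 1 / \<rho>) + (\<rho> - 1 / \<rho>)))"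
      using o\<rho> o\<rho>' K0 by (intro ord_ge_mult oE ord_ge_add ord_ge_diff ord_ge_mono[OF oE(1)]) auto
    moreover have "ord_ge (K + - int d) (E2 * (E2 + (\<rho> + 1 / \<rho>) + (\<rho> + 1 / \<rho>)))"
      using o\<rho> o\<rho>' K0 by (intro ord_ge_mult oE ord_ge_add ord_ge_diff ord_ge_mono[OF oE(2)]) auto
    ultimately show ?thesis using ord_ge_diff by fastforce
  qed
  moreover have "2 * int m + int m * int (degree (V\<^sup>2)) \<le> K - int d"
  proof -
    have "degree (V\<^sup>2) \<le> 2 * d" using V(6) by (simp add: degree_power_eq V(5))
    then have "2 * m + m * degree (V\<^sup>2) + 2 * d \<le> 2 * m * d + m * (2 * d) + 8 * d"
      using d(1) by (intro add_mono mult_le_mono2) auto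
    also have "\<dots> \<le> M" using d(2) by (simp add: algebra_simps)
    finally have "int (2 * m + m * degree (V\<^sup>2) + 2 * d) \<le> int M" by (simp only: of_nat_le_iff)
    then show ?thesis by (simp add: KM)
  qed
  moreover have "V\<^sup>2 \<noteq> 0" using V by simp
  ultimately obtain Y where "ord_ge 1 (w\<^sup>2 - ev x Y)" "smult ((of_nat m)\<^sup>2) (Y \<circ>\<^sub>p F) = (pderiv F)\<^sup>2 * Y"
    using rational_approximation_imp_polynomial[OF F m] unfolding w_def by metis
  then show ?thesis using conic_unique by (simp add: w_def)
qed

end

text \<open>
  The substitution multiplies the order of \<open>g - g(0)\<close> by \<open>m > 1\<close>.
\<close>

lemma power_subst_fixed_imp_const:
  fixes g :: "'b::field fls"
  assumes "z \<noteq> 0" "m > 1" "power_subst z m g = g" "ord_ge 0 g"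
  shows "g = fls_const (g $$ 0)"
proof (rule ccontr)
  assume ne: "g \<noteq> fls_const (g $$ 0)"
  define h where "h = g - fls_const (g $$ 0)"
  have h0: "h \<noteq> 0" using ne by (simp add: h_def)
  have "power_subst z m h = h" using assms by (simp add: h_def power_subst_diff power_subst_const)
  moreover have "ord_ge (int m * fls_subdegree h) (power_subst z m h)"
    using assms by (intro ord_ge_power_subst ord_ge_subdegree) auto
  ultimately have "int m * fls_subdegree h \<le> fls_subdegree h" using h0 by (simp add: ord_ge_iff_subdegree)
  moreover have "ord_ge (0 + 1) h"
    unfolding h_def using assms(4) by (intro ord_ge_Suc ord_ge_diff) auto
  then have "fls_subdegree h \<ge> 1" using h0 by (simp add: ord_ge_iff_subdegree)
  moreover have "2 * fls_subdegree h \<le> int m * fls_subdegree h"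
    using assms(2) calculation(2) by (intro mult_right_mono) auto
  ultimately show False by linarith
qed

context normalized_coordinate
begin

text \<open>
  Compare the coefficients of \<open>t\<^sup>-\<^sup>2\<close>, \<open>t\<^sup>-\<^sup>1\<close> and \<open>1\<close>. In the application this says that a rational approximation
  to \<open>\<theta>\<^sup>2 x / (\<theta> x)\<^sup>2\<close> in lowest terms has a denominator \<open>Y\<close> of degree at least two.
\<close>

lemma low_degree_log_derivative:
  assumes Y: "degree Y \<le> 1" "degree B = 0"
    and eq: "ord_ge 1 (ev x Y * euler (euler x) + (euler x)\<^sup>2 * ev x B)"
    and a: "x $$ 1 \<noteq> 0" "(2::'a) \<noteq> 0"
  shows "Y = 0"
proof -
  obtain e0 e1 where Ye: "Y = [:e0, e1:]"
  proof -
    have "Y = [:coeff Y 0, coeff Y 1:]"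
      using Y(1) by (intro poly_eqI) (auto simp: coeff_pCons coeff_eq_0 split: nat.split)
    then show ?thesis using that by blast
  qed
  obtain b where B: "B = [:b:]" using Y(2) by (metis degree_eq_zeroE)
  define f where "f = ev x Y * euler (euler x) + (euler x)\<^sup>2 * ev x B"
  define w v where "w = euler x" and "v = euler w"
  have o: "ord_ge (-1) x" "ord_ge (-1) w" "ord_ge (-1) v"
    using ord_ge_x by (auto simp: w_def v_def intro!: ord_ge_euler)
  have wn: "w $$ i = - (of_int i * x $$ i)" "v $$ i = of_int i * of_int i * x $$ i" for i
    by (simp_all add: w_def v_def euler_nth mult.assoc)
  have sq: "(g * h) $$ (-2) = g $$ (-1) * h $$ (-1)"
      "(g * h) $$ (-1) = g $$ (-1) * h $$ 0 + g $$ 0 * h $$ (-1)"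
      "(g * h) $$ 0 = g $$ (-1) * h $$ 1 + g $$ 0 * h $$ 0 + g $$ 1 * h $$ (-1)"
    if "ord_ge (-1) g" "ord_ge (-1) h" for g h :: "'a fls"
  proof -
    define g0 where "g0 = g - fls_const (g $$ (-1)) * fls_X_inv"
    define h0 where "h0 = h - fls_const (h $$ (-1)) * fls_X_inv"
    have og0: "ord_ge (-1 + 1) g0" unfolding g0_def
      by (intro ord_ge_Suc ord_ge_diff that ord_ge_cmult ord_ge_X_inv) simp
    have oh0: "ord_ge (-1 + 1) h0" unfolding h0_def
      by (intro ord_ge_Suc ord_ge_diff that ord_ge_cmult ord_ge_X_inv) simp
    define g1 where "g1 = g0 - fls_const (g $$ 0)"
    define h1 where "h1 = h0 - fls_const (h $$ 0)"
    have g0n: "g0 $$ i = g $$ i" "h0 $$ i = h $$ i" if "i \<noteq> -1" for i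
      using that by (simp_all add: g0_def h0_def)
    have og1: "ord_ge (0 + 1) g1" unfolding g1_def using og0
      by (intro ord_ge_Suc ord_ge_diff) (auto simp: g0n)
    have oh1: "ord_ge (0 + 1) h1" unfolding h1_def using oh0
      by (intro ord_ge_Suc ord_ge_diff) (auto simp: g0n)
    have g1n: "g1 $$ 1 = g $$ 1" "h1 $$ 1 = h $$ 1" by (simp_all add: g1_def h1_def g0n)
    have gh: "g = fls_const (g $$ (-1)) * fls_X_inv + fls_const (g $$ 0) + g1"
       "h = fls_const (h $$ (-1)) * fls_X_inv + fls_const (h $$ 0) + h1"
      by (simp_all add: g1_def h1_def g0_def h0_def)
    have prod: "g * h = fls_const (g $$ (-1) * h $$ (-1)) * fls_X_inv ^ 2
      + fls_const (g $$ (-1) * h $$ 0 + g $$ 0 * h $$ (-1)) * fls_X_inv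
      + fls_const (g $$ 0 * h $$ 0)
      + (fls_const (g $$ (-1)) * (fls_X_inv * h1) + fls_const (h $$ (-1)) * (fls_X_inv * g1))
      + (fls_const (g $$ 0) * h1 + fls_const (h $$ 0) * g1 + g1 * h1)"
      by (subst gh(1), subst gh(2))
        (simp only: distrib_left distrib_right fls_const_mult_const[symmetric] fls_plus_const[symmetric] power2_eq_square mult_ac add_ac)
    have Xn: "(fls_X_inv * f) $$ i = f $$ (i + 1)" for f :: "'a fls" and i
      by (simp add: fls_X_inv_times_conv_shift)
    have n: "h1 $$ i = 0" "g1 $$ i = 0" if "i \<le> 0" for i using og1 oh1 that by (simp_all add: ord_ge_def)
    have r: "(g1 * h1) $$ i = 0" if "i \<le> 0" for i
      using ord_ge_mult[OF og1 oh1] that by (simp add: ord_ge_def)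
    have X2: "(fls_X_inv ^ 2 :: 'a fls) $$ i = (if i = -2 then 1 else 0)" for i
      by (simp add: fls_X_inv_power_conv_shift_1)
    show "(g * h) $$ (-2) = g $$ (-1) * h $$ (-1)"
      "(g * h) $$ (-1) = g $$ (-1) * h $$ 0 + g $$ 0 * h $$ (-1)"
      "(g * h) $$ 0 = g $$ (-1) * h $$ 1 + g $$ 0 * h $$ 0 + g $$ 1 * h $$ (-1)"
      unfolding prod by (simp_all only: fls_plus_nth fls_mult_const_nth Xn X2 r n g1n fls_const_nth fls_X_inv_nth)
        (simp_all add: n g1n mult.commute)
  qed
  have f_nth: "f $$ i = e0 * v $$ i + e1 * (x * v) $$ i + b * (w * w) $$ i" for i
    by (simp add: f_def Ye B ev_pCons power2_eq_square distrib_right w_def v_def mult.commute[of x] mult.assoc mult.commute[of _ "fls_const b"])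
  have vals: "x $$ (-1) = 1" "x $$ 0 = 0" "w $$ (-1) = 1" "w $$ 0 = 0" "w $$ 1 = - x $$ 1"
    "v $$ (-1) = 1" "v $$ 0 = 0" "v $$ 1 = x $$ 1" "v $$ (-2) = 0"
    using o by (simp_all add: wn ord_ge_def)
  have f0: "f $$ (-2) = 0" "f $$ (-1) = 0" "f $$ 0 = 0" using eq by (simp_all add: f_def ord_ge_def)
  have 1: "e1 + b = 0" using f0(1) o by (simp add: f_nth sq vals)
  have 2: "e0 = 0" using f0(2) o by (simp add: f_nth sq vals)
  have 3: "e1 * (x $$ 1 + x $$ 1) - b * (x $$ 1 + x $$ 1) = 0" using f0(3) o by (simp add: f_nth sq vals algebra_simps)
  have "b = - e1" using 1 by (simp add: add_eq_0_iff)
  then have "2 * (2 * (e1 * x $$ 1)) = 0" using 3 by (simp add: algebra_simps)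
  moreover have "(2::'a) * 2 \<noteq> 0" using a by (simp only: mult_eq_0_iff) simp
  ultimately have "e1 = 0" using a by (simp only: mult_eq_0_iff) simp
  then show ?thesis using 2 by (simp add: Ye)
qed

text \<open>
  Integration is unavailable, but \<open>d = N - M\<close> now vanishes in the field, so \<open>\<theta>(\<rho> - 1 / \<rho>) = 0\<close> and
  differentiating \<open>(\<theta> x) V(x) = \<rho> - 1 / \<rho>\<close> shows that \<open>- V' / V\<close> approximates \<open>\<theta>\<^sup>2 x / (\<theta> x)\<^sup>2\<close>. Combined with the
  functional equation this gives an exact identity \<open>I = 0\<close>. In lowest terms \<open>V' / V = B / Y\<close> it yields that \<open>Y \<circ> F\<close> divides \<open>F'\<^sup>2 Y\<close>,
  so \<open>degree Y \<le> 2\<close>, with equality by the previous lemma, and comparison of leading coefficients gives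
  \<open>m\<^sup>2 Y(F) = F'\<^sup>2 Y\<close>. Thus \<open>(\<theta> x)\<^sup>2 / Y(x)\<close> is fixed by \<open>t \<mapsto> z t\<^sup>m\<close>, hence constant.
\<close>

lemma conic_equation_char_p:
  assumes close: close_pairs and F: "scales F z m" and m: "m > 1" "of_nat m \<noteq> (0::'a)"
    and a: "x $$ 1 \<noteq> 0" "(2::'a) \<noteq> 0" and char: "CHAR('a) \<noteq> 0"
  shows "smult ((of_nat m)\<^sup>2) (conic \<circ>\<^sub>p F) = (pderiv F)\<^sup>2 * conic"
proof -
  define w where "w = euler x"
  define q where "q = w\<^sup>2"
  define m2 where "m2 = (of_nat m :: 'a fls)\<^sup>2"
  have z: "z \<noteq> 0" "m > 0" using F by (auto simp: scales_def)
  obtain A \<zeta> M B \<xi> N where AB: "scales A \<zeta> M" "scales B \<xi> N" "M < N" "(2 * m + 8) * (N - M) \<le> M"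
     "of_nat M \<noteq> (0::'a)" "of_nat N \<noteq> (0::'a)" "of_nat N = (of_nat M :: 'a)"
    using close char unfolding close_pairs_def by metis
  define d where "d = N - M"
  have d: "d \<ge> 1" "(2 * m + 8) * d \<le> M" using AB by (simp_all add: d_def)
  have d2: "2 * (N - M) < M"
  proof -
    have "2 * d + 1 \<le> (2 * m + 8) * d" using d(1) by (simp add: distrib_right)
    then show ?thesis using d(2) by (simp add: d_def)
  qed
  define K where "K = 2 * int M - int N"
  have KM: "K = int M - int d" using AB(3) by (simp add: K_def d_def)
  obtain V \<rho> where V: "\<rho> \<noteq> 0" "fls_subdegree \<rho> = - int d" "euler \<rho> = of_nat d * \<rho>"
    "ord_ge K (w * ev x V - (\<rho> - 1 / \<rho>))" "V \<noteq> 0" "degree V = d - 1"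
    unfolding w_def d_def K_def by (rule sinh_polynomial[OF AB(1,2,3,5,6) a(2,1) d2])
  have "of_nat d = (0::'a)" using AB(3,7) by (simp add: d_def of_nat_diff)
  then have dz: "of_nat d = (0::'a fls)" by (metis fls_const_0 fls_of_nat)
  define \<epsilon> where "\<epsilon> = ev x V * euler w + q * ev x (pderiv V)"
  have "euler (\<rho> - 1 / \<rho>) = 0"
    using V(1) euler_inverse[of \<rho>] by (simp add: euler_diff V(3) dz inverse_eq_divide)
  then have "euler (w * ev x V - (\<rho> - 1 / \<rho>)) = \<epsilon>"
    by (simp add: euler_diff euler_mult euler_ev \<epsilon>_def q_def w_def power2_eq_square mult_ac)
  then have \<epsilon>: "ord_ge K \<epsilon>" using ord_ge_euler[OF V(4)] by simp
  have fe: "ev x (pderiv F) * w = of_nat m * power_subst z m w"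
    using euler_functional_equation[OF F] by (simp add: w_def)
  have feq: "m2 * power_subst z m q = ev x ((pderiv F)\<^sup>2) * q"
    using quadratic_functional_equation[OF F] by (simp add: q_def m2_def w_def)
  have deriv_feq: "m2 * power_subst z m (euler w) = ev x (pderiv (pderiv F)) * q + ev x (pderiv F) * euler w"
  proof -
    have enat: "euler (of_nat k * f) = of_nat k * euler f" for k and f :: "'a fls"
      by (metis euler_const euler_mult fls_of_nat add.right_neutral mult_zero_left)
    have "euler (ev x (pderiv F) * w) = of_nat m * (of_nat m * power_subst z m (euler w))"
      unfolding fe by (simp add: enat euler_power_subst z)
    then show ?thesis
      by (simp add: euler_mult euler_ev m2_def power2_eq_square q_def w_def mult.assoc add.commute)
  qed
  \<comment> \<open>What remains of the derivative of the functional equation after eliminating \<open>\<theta>\<^sup>2 x\<close> by means of \<open>V\<close>.\<close>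
  define I where "I = V * (V \<circ>\<^sub>p F) * pderiv (pderiv F) + (pderiv F)\<^sup>2 * (pderiv V \<circ>\<^sub>p F) * V
      - pderiv F * (V \<circ>\<^sub>p F) * pderiv V"
  let ?F = "ev x (pderiv F)" and ?FF = "ev x (pderiv (pderiv F))" and ?V = "ev x V" and ?V' = "ev x (pderiv V)"
  let ?sV = "power_subst z m ?V" and ?sV' = "power_subst z m ?V'"
  have "q * ev x I = m2 * (?V * power_subst z m \<epsilon>) - ?F * (?sV * \<epsilon>)"
  proof -
    have evI: "ev x I = ?V * ?sV * ?FF + ev x ((pderiv F)\<^sup>2) * ?sV' * ?V - ?F * ?sV * ?V'"
      by (simp add: I_def ev_add ev_diff ev_mult ev_pcompose_scales[OF F])
    have "m2 * (?V * power_subst z m \<epsilon>) = ?V * (?sV * (m2 * power_subst z m (euler w)) + (m2 * power_subst z m q) * ?sV')"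
      unfolding \<epsilon>_def power_subst_add[OF z] power_subst_mult[OF z] by (simp only: distrib_left mult_ac)
    also have "\<dots> = ?V * (?sV * (?FF * q + ?F * euler w) + (ev x ((pderiv F)\<^sup>2) * q) * ?sV')"
      by (simp only: deriv_feq feq)
    finally show ?thesis unfolding evI by (simp add: \<epsilon>_def algebra_simps)
  qed
  moreover have "ord_ge 0 (m2 * (?V * power_subst z m \<epsilon>) - ?F * (?sV * \<epsilon>))"
  proof (rule ord_ge_diff)
    have oV: "ord_ge (- int d) ?V" using V(6) by (intro ord_ge_ev_degree) simp
    have osV: "ord_ge (int m * - int d) ?sV" by (rule ord_ge_power_subst[OF z oV])
    have oF: "ord_ge (- int m) ?F"
      using degree_pderiv_le[of F] degree_scales[OF F] by (intro ord_ge_ev_degree) simp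
    have big: "int K' \<le> K" if "K' + d \<le> M" for K' using that by (simp add: KM)
    have K1: "int (m * d + m) \<le> K"
    proof (rule big)
      have "m * d + m + d \<le> m * d + m * d + 8 * d" using d(1) by (intro add_mono) auto
      also have "\<dots> \<le> M" using d(2) by (simp add: algebra_simps)
      finally show "m * d + m + d \<le> M" .
    qed
    then have K2: "int d \<le> int m * K"
    proof -
      have "0 \<le> K" using K1 by (rule order_trans[rotated]) simp
      then have "1 * K \<le> int m * K" using m(1) by (intro mult_right_mono) auto
      moreover have "int d \<le> int (m * d + m)" using m(1) by (cases m) auto
      ultimately show ?thesis using K1 by linarith
    qed
    have "ord_ge (int m * K) (power_subst z m \<epsilon>)" by (rule ord_ge_power_subst[OF z \<epsilon>])
    then have "ord_ge (- int d + int m * K) (?V * power_subst z m \<epsilon>)" by (rule ord_ge_mult[OF oV])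
    then have "ord_ge 0 (?V * power_subst z m \<epsilon>)" using K2 by (elim ord_ge_mono) simp
    then show "ord_ge 0 (m2 * (?V * power_subst z m \<epsilon>))"
      unfolding m2_def by (simp add: power2_eq_square mult.assoc ord_ge_of_nat_mult)
    show "ord_ge 0 (?F * (?sV * \<epsilon>))"
      using ord_ge_mult[OF oF ord_ge_mult[OF osV \<epsilon>]] K1 by (elim ord_ge_mono) simp
  qed
  ultimately have "ord_ge 0 (q * ev x I)" by simp
  moreover have q: "q \<noteq> 0" "fls_subdegree q = -2"
    using euler_x_nonzero subdegree_euler_x by (simp_all add: q_def w_def fls_subdegree_pow)
  ultimately have "ord_ge (0 - - 2) (ev x I)" using ord_ge_cancel[of 0 q "ev x I"] by simp
  then have "ord_ge 1 (ev x I)" by (rule ord_ge_mono) simp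
  then have I0: "I = 0" by (rule ev_eq_0I[rotated]) simp
  obtain g B Y u v where g: "g \<noteq> 0" "pderiv V = g * B" "V = g * Y" "u * B + v * Y = 1"
    using reduce_to_coprime[OF disjI2[OF V(5)], of "pderiv V"] by metis
  have dF: "degree F = m" by (rule degree_scales[OF F])
  have gF: "g \<circ>\<^sub>p F \<noteq> 0" using g(1) dF m pcompose_eq_0[of g F] by auto
  have Y0: "Y \<noteq> 0" using V(5) g by auto
  have "(g * (g \<circ>\<^sub>p F)) * ((pderiv F)\<^sup>2 * Y * (B \<circ>\<^sub>p F)) = (g * (g \<circ>\<^sub>p F)) * ((Y \<circ>\<^sub>p F) * (pderiv F * B - Y * pderiv (pderiv F)))"
  proof -
    have "V * (V \<circ>\<^sub>p F) * pderiv (pderiv F) + (pderiv F)\<^sup>2 * (pderiv V \<circ>\<^sub>p F) * V = pderiv F * (V \<circ>\<^sub>p F) * pderiv V"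
      using I0 by (simp add: I_def)
    then show ?thesis unfolding g(2) by (subst (asm) (1 2 3 4) g(3)) (simp add: pcompose_mult algebra_simps)
  qed
  then have "(pderiv F)\<^sup>2 * Y * (B \<circ>\<^sub>p F) = (Y \<circ>\<^sub>p F) * (pderiv F * B - Y * pderiv (pderiv F))"
    by (rule mult_left_cancel[THEN iffD1, rotated]) (use g(1) gF in simp)
  then have "Y \<circ>\<^sub>p F dvd ((pderiv F)\<^sup>2 * Y) * (B \<circ>\<^sub>p F)" by simp
  then have dvd: "Y \<circ>\<^sub>p F dvd (pderiv F)\<^sup>2 * Y" by (rule dvd_of_pcompose_relation[OF g(4)])
  have dF': "coeff (pderiv F) (m - 1) = of_nat m * lead_coeff F" using m(1) by (simp add: coeff_pderiv dF)
  have lF: "lead_coeff F \<noteq> 0" using dF m(1) by auto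
  have degF': "degree (pderiv F) = m - 1"
    using dF' lF m(2) degree_pderiv_le[of F] by (intro antisym le_degree) (auto simp: dF)
  have F'0: "pderiv F \<noteq> 0" using dF' lF m(2) by auto
  have degs: "degree ((pderiv F)\<^sup>2 * Y) = 2 * (m - 1) + degree Y"
    using F'0 Y0 by (simp add: degree_mult_eq degree_power_eq degF')
  have "degree Y * m \<le> 2 * (m - 1) + degree Y"
    using dvd_imp_degree_le[OF dvd] F'0 Y0 by (simp add: degs degree_pcompose dF)
  then have tle: "degree Y \<le> 2"
  proof -
    obtain k where k: "m = Suc k" "k > 0" using m(1) by (cases m) auto
    have "degree Y * k \<le> 2 * k" using \<open>degree Y * m \<le> 2 * (m - 1) + degree Y\<close> by (simp add: k)
    then show ?thesis using k by simp
  qed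
  have "degree Y = 2"
  proof (rule ccontr)
    assume "degree Y \<noteq> 2"
    then have dY: "degree Y \<le> 1" using tle by simp
    have dB: "degree B = 0"
    proof (cases "B = 0")
      case False
      then have "degree g + degree B \<le> (degree g + degree Y) - 1"
        using degree_pderiv_le[of V] V(5) g Y0 unfolding g(2) by (simp add: degree_mult_eq)
      then show ?thesis using dY by simp
    qed simp
    have "ev x g * (ev x Y * euler w + q * ev x B) = \<epsilon>"
    proof -
      have "ev x V = ev x g * ev x Y" "ev x (pderiv V) = ev x g * ev x B" by (metis ev_mult g(3), metis ev_mult g(2))
      then show ?thesis by (simp only: \<epsilon>_def distrib_left mult_ac)
    qed
    then have "ord_ge (K - fls_subdegree (ev x g)) (ev x Y * euler w + q * ev x B)"
      using \<epsilon> subdegree_ev(2)[OF g(1)] by (intro ord_ge_cancel) auto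
    moreover have "1 \<le> K - fls_subdegree (ev x g)"
      using subdegree_ev(1)[OF g(1)] d2 AB(3) by (simp add: K_def)
    ultimately have "ord_ge 1 (ev x Y * euler w + q * ev x B)" by (rule ord_ge_mono)
    then have "Y = 0" using low_degree_log_derivative[OF dY dB _ a] by (simp add: w_def q_def)
    then show False using Y0 by simp
  qed
  obtain k where k: "(pderiv F)\<^sup>2 * Y = (Y \<circ>\<^sub>p F) * k" using dvd by blast
  have k0: "k \<noteq> 0" using k F'0 Y0 by auto
  have YF0: "Y \<circ>\<^sub>p F \<noteq> 0" using k F'0 Y0 by auto
  have "degree k = 0"
  proof -
    have "2 * (m - 1) + 2 = 2 * m + degree k"
      using arg_cong[OF k, of degree] degs k0 YF0 \<open>degree Y = 2\<close> by (simp add: degree_mult_eq degree_pcompose dF)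
    then show ?thesis using m(1) by simp
  qed
  then obtain c where c: "k = [:c:]" by (metis degree_eq_zeroE)
  have "lead_coeff ((pderiv F)\<^sup>2 * Y) = (of_nat m)\<^sup>2 * (lead_coeff F)\<^sup>2 * lead_coeff Y"
  proof -
    have "lead_coeff (pderiv F) = of_nat m * lead_coeff F" unfolding degF' by (rule dF')
    then show ?thesis by (simp add: lead_coeff_mult lead_coeff_power power_mult_distrib)
  qed
  moreover have "lead_coeff ((Y \<circ>\<^sub>p F) * k) = lead_coeff Y * (lead_coeff F)\<^sup>2 * c"
    using lead_coeff_comp[of F Y] dF m \<open>degree Y = 2\<close> by (simp add: lead_coeff_mult c)
  ultimately have "c = (of_nat m)\<^sup>2" using k lF Y0 by simp
  then have eqY: "smult ((of_nat m)\<^sup>2) (Y \<circ>\<^sub>p F) = (pderiv F)\<^sup>2 * Y" using k by (simp add: c)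
  \<comment> \<open>Both \<open>f = (\<theta> x)\<^sup>2\<close> and \<open>f = Y(x)\<close> satisfy \<open>m\<^sup>2 f(z t\<^sup>m) = F'(x)\<^sup>2 f\<close>.\<close>
  define h where "h = q / ev x Y"
  have evY: "ev x Y \<noteq> 0" "fls_subdegree (ev x Y) = -2" using subdegree_ev[OF Y0] \<open>degree Y = 2\<close> by simp_all
  have m2z: "m2 \<noteq> 0"
  proof -
    have "(of_nat m :: 'a fls) \<noteq> 0" using m(2) by (metis fls_const_nonzero fls_of_nat)
    then show ?thesis by (simp add: m2_def)
  qed
  have eqY': "ev x ((pderiv F)\<^sup>2) * ev x Y = m2 * power_subst z m (ev x Y)"
    using arg_cong[OF eqY, of "ev x"]
    by (simp add: ev_smult ev_mult ev_pcompose_scales[OF F] m2_def fls_const_power fls_of_nat)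
  have "m2 * (power_subst z m q * ev x Y) = (m2 * power_subst z m q) * ev x Y"
    by (simp only: mult.assoc)
  also have "\<dots> = q * (ev x ((pderiv F)\<^sup>2) * ev x Y)"
    by (simp only: feq mult_ac)
  also have "\<dots> = m2 * (q * power_subst z m (ev x Y))"
    by (simp only: eqY' mult.left_commute)
  finally have "m2 * (power_subst z m q * ev x Y) = m2 * (q * power_subst z m (ev x Y))" .
  then have "power_subst z m q * ev x Y = q * power_subst z m (ev x Y)" using m2z by simp
  moreover have "power_subst z m (ev x Y) \<noteq> 0" using evY z by (simp add: power_subst_eq_0_iff)
  ultimately have "power_subst z m h = h"
    unfolding h_def power_subst_divide[OF z] using evY(1) by (simp add: frac_eq_eq)
  moreover have "ord_ge 0 h"
  proof -
    have "fls_subdegree (h * ev x Y) = fls_subdegree h + fls_subdegree (ev x Y)"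
      using evY q by (intro fls_subdegree_mult) (auto simp: h_def)
    then show ?thesis using evY q by (simp add: h_def ord_ge_iff_subdegree)
  qed
  ultimately have "h = fls_const (h $$ 0)" by (intro power_subst_fixed_imp_const[OF z(1) m(1)])
  then have "q = fls_const (h $$ 0) * ev x Y" using evY by (metis h_def nonzero_mult_div_cancel_right times_divide_eq_left)
  then have "q = ev x (smult (h $$ 0) Y)" by (simp add: ev_smult)
  then have "smult (h $$ 0) Y = conic" by (intro conic_unique) (simp add: q_def w_def)
  moreover have "smult ((of_nat m)\<^sup>2) (smult (h $$ 0) Y \<circ>\<^sub>p F) = (pderiv F)\<^sup>2 * smult (h $$ 0) Y"
    unfolding pcompose_smult mult_smult_right eqY[symmetric] by (simp only: smult_smult mult.commute)
  ultimately show ?thesis by simp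
qed

end

section \<open>The coordinate in characteristic two\<close>

lemma char_2_identities:
  fixes f :: "'b::comm_ring_1"
  assumes "CHAR('b) = 2"
  shows "f + f = 0" "f + (f + g) = g" "- f = f" "f - g = f + g" "(f + g)\<^sup>2 = f\<^sup>2 + g\<^sup>2"
proof -
  have "of_nat CHAR('b) = (0::'b)" by (rule of_nat_CHAR)
  then have two: "(2::'b) = 0" by (simp add: assms)
  have add: "h + h = 0" for h :: 'b using two by (metis mult_2 mult_zero_left)
  then show "f + f = 0" .
  show "f + (f + g) = g" using add by (metis add.assoc add_0)
  have neg: "- h = h" for h :: 'b using add[of h] by (simp add: add_eq_0_iff)
  then show "- f = f" .
  show "f - g = f + g" by (metis neg diff_conv_add_uminus)
  show "(f + g)\<^sup>2 = f\<^sup>2 + g\<^sup>2" by (simp add: power2_sum two)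
qed

lemma char_2_of_nat_power2:
  assumes "CHAR('b::comm_ring_1) = 2" shows "(of_nat k :: 'b)\<^sup>2 + of_nat k = 0"
proof (induction k)
  case (Suc k)
  note c2 = char_2_identities[where ?'b = 'b, OF assms]
  have "(of_nat (Suc k) :: 'b)\<^sup>2 + of_nat (Suc k) = (1 + (of_nat k)\<^sup>2) + (1 + of_nat k)"
    by (simp add: c2(5))
  also have "\<dots> = (1 + 1) + ((of_nat k)\<^sup>2 + of_nat k)" by (simp only: add_ac)
  finally show ?case by (simp only: Suc c2(1) add_0)
qed simp

text \<open>
  The second alternative of \<open>leading_terms_of_coordinate\<close>. Here \<open>\<theta> x = x\<close>, so \<open>\<theta> x\<close> carries no
  information, and the logarithmic derivative of \<open>\<psi>\<close> takes its place.
\<close>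

locale char_2_coordinate = normalized_coordinate x
  for x :: "'a::alg_closed_field fls" +
  fixes \<psi> :: "'a fls"
  assumes char: "CHAR('a) = 2" and x\<psi>: "x = fls_X_inv * \<psi>\<^sup>2" and \<psi>: "ord_ge 1 (\<psi> - 1)"
    and \<alpha>: "\<psi> $$ 1 \<noteq> 0"
begin

lemma char_fls: "CHAR('a fls) = 2" using char by simp

lemmas c2 = char_2_identities[where ?'b = "'a fls", OF char_fls]

lemma psi_facts: "ord_ge 0 \<psi>" "\<psi> $$ 0 = 1" "\<psi> \<noteq> 0" "fls_subdegree \<psi> = 0"
proof -
  show 1: "ord_ge 0 \<psi>" "\<psi> $$ 0 = 1" using ord_ge_sub_one_nth[OF \<psi>] by auto
  then show "\<psi> \<noteq> 0" by auto
  show "fls_subdegree \<psi> = 0" using 1 by (intro fls_subdegree_eq_of_ord_ge) auto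
qed

lemma two_zero: "(2::'a fls) = 0" using c2(1)[of 1] by simp

lemma euler_square: "euler (f\<^sup>2) = (0 :: 'a fls)"
  by (simp add: euler_power two_zero)

lemma euler_x_char_2: "euler x = x"
  by (subst (1 2) x\<psi>) (simp add: euler_mult euler_square)

definition \<nu> :: "'a fls" where "\<nu> = euler \<psi> / \<psi>"

lemma euler_psi: "euler \<psi> = \<psi> * \<nu>" using psi_facts by (simp add: \<nu>_def)

lemma nu_facts: "ord_ge 1 \<nu>" "\<nu> $$ 1 = \<psi> $$ 1"
proof -
  have "ord_ge 1 (euler (\<psi> - 1))" by (rule ord_ge_euler[OF \<psi>])
  then have o: "ord_ge 1 (\<psi> * \<nu>)" by (simp add: euler_diff euler_psi)
  show n: "ord_ge 1 \<nu>" using ord_ge_cancel[OF o] psi_facts by simp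
  have "(\<psi> * \<nu>) $$ (0 + 1) = \<psi> $$ 0 * \<nu> $$ 1" by (rule nth_mult_ord_ge[OF psi_facts(1) n])
  then have "euler \<psi> $$ 1 = \<nu> $$ 1" using psi_facts by (simp add: euler_psi)
  moreover have "euler \<psi> $$ 1 = \<psi> $$ 1"
  proof -
    have "(- f) $$ 1 = f $$ 1" for f :: "'a fls" by (simp only: c2(3))
    then show ?thesis by (simp add: euler_nth)
  qed
  ultimately show "\<nu> $$ 1 = \<psi> $$ 1" by simp
qed

lemma square_polynomial:
  assumes "ev x P = g\<^sup>2" obtains R where "P = R\<^sup>2" "ev x R = g"
proof -
  have "ev x P = g ^ (CHAR('a) ^ 1)" using assms char by simp
  from polynomial_root_of_frobenius_power[OF _ this] that show ?thesis using char two_is_prime_nat by auto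
qed

lemma square_of_pderiv_0:
  assumes "pderiv P = (0::'a poly)" obtains R where "P = R\<^sup>2"
  using pth_power_of_pderiv_eq_0[OF _ assms] char two_is_prime_nat by (metis that)

text \<open>
  The value \<open>x P(x)\<close> is a square because \<open>M\<close> is odd, so \<open>X P\<close> is the square of a polynomial. The last identity is
  the logarithmic derivative of \<open>R(x)\<close>.
\<close>

lemma scales_char_2:
  assumes P: "scales P z M" and nz: "of_nat M \<noteq> (0::'a)"
  obtains R y k where "M = 2 * k + 1" "P = pCons 0 (R\<^sup>2)" "y\<^sup>2 = inverse z"
    "ev x R = fls_const y * fls_X_inv ^ k * (power_subst z M \<psi> / \<psi>)"
    "ev x (pCons 0 (pderiv R)) = ev x R * (of_nat k + power_subst z M \<nu> + \<nu>)"
proof -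
  have z: "z \<noteq> 0" "M > 0" "ev x P = power_subst z M x" using P by (auto simp: scales_def)
  have "odd M" using nz by (simp add: of_nat_eq_0_iff_char_dvd char)
  then obtain k where k: "M = 2 * k + 1" by (rule oddE)
  obtain y where y: "y\<^sup>2 = inverse z" using nth_root_exists[of 2 "inverse z"] by auto
  have yy: "fls_const y * fls_const y = fls_const (inverse z)" using y by (simp add: power2_eq_square fls_const_mult_const)
  define s where "s = power_subst z M \<psi>"
  have s0: "s \<noteq> 0" using psi_facts z by (simp add: s_def power_subst_eq_0_iff)
  define g where "g = fls_const y * fls_X_inv ^ k * (s / \<psi>)"
  have sx: "power_subst z M x = fls_const (inverse z) * fls_X_inv ^ M * s\<^sup>2"
  proof -
    have "power_subst z M x = power_subst z M fls_X_inv * power_subst z M (\<psi>\<^sup>2)"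
      by (subst x\<psi>, rule power_subst_mult[OF z(1,2)])
    then show ?thesis by (simp only: power_subst_X_inv[OF z(1,2)] power_subst_power[OF z(1,2)] s_def)
  qed
  have xg: "x * g\<^sup>2 = ev x P"
  proof -
    have "x * g\<^sup>2 = (fls_const y * fls_const y) * (fls_X_inv * fls_X_inv ^ k * fls_X_inv ^ k) * (\<psi> * (s / \<psi>))\<^sup>2"
      by (subst x\<psi>) (simp only: g_def power2_eq_square mult_ac)
    also have "fls_X_inv * fls_X_inv ^ k * fls_X_inv ^ k = (fls_X_inv ^ M :: 'a fls)"
      by (simp add: k mult_2 power_add)
    finally show ?thesis using psi_facts(3) unfolding z(3) sx yy by simp
  qed
  have "ev x (pCons 0 P) = (x * g)\<^sup>2"
    by (simp add: ev_pCons flip: xg) (simp add: power2_eq_square mult_ac)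
  then obtain R1 where R1: "pCons 0 P = R1\<^sup>2" "ev x R1 = x * g" by (rule square_polynomial)
  have "coeff (R1\<^sup>2) 0 = 0" by (simp flip: R1(1))
  then have "coeff R1 0 = 0" by (simp add: power2_eq_square coeff_mult)
  then obtain R where R: "R1 = pCons 0 R" by (cases R1) auto
  have "pCons 0 P = pCons 0 (pCons 0 (R\<^sup>2))" using R1(1) by (simp add: R power2_eq_square)
  then have PR: "P = pCons 0 (R\<^sup>2)" by simp
  have evR: "ev x R = g" using R1(2) by (simp add: R ev_pCons)
  have es: "euler s = s * power_subst z M \<nu>"
  proof -
    have "(of_nat M :: 'a fls) = 1" by (simp add: k two_zero)
    then show ?thesis using z by (simp add: s_def euler_power_subst euler_psi power_subst_mult)
  qed
  have "euler (s / \<psi>) = s / \<psi> * (power_subst z M \<nu> + \<nu>)"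
  proof -
    have "euler s = euler (\<psi> * (s / \<psi>))" using psi_facts(3) by simp
    also have "\<dots> = \<psi> * euler (s / \<psi>) + \<nu> * s" unfolding euler_mult euler_psi using psi_facts(3) by (simp add: mult.assoc)
    finally have "\<psi> * euler (s / \<psi>) + \<nu> * s = s * power_subst z M \<nu>" using es by simp
    then have "\<psi> * euler (s / \<psi>) = s * power_subst z M \<nu> + \<nu> * s" by (metis c2(2) add.commute)
    then show ?thesis using psi_facts(3) by (simp add: field_simps)
  qed
  then have "euler g = g * (of_nat k + power_subst z M \<nu> + \<nu>)"
    unfolding g_def euler_mult[of "fls_const y * fls_X_inv ^ k"] euler_mult[of "fls_const y"]
      euler_X_inv_power euler_const
    by (simp only: distrib_left mult_ac add_ac mult_zero_left add_0_right add_0_left)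
  then have "ev x (pCons 0 (pderiv R)) = ev x R * (of_nat k + power_subst z M \<nu> + \<nu>)"
    using euler_ev[of x R] by (simp add: evR ev_pCons euler_x_char_2 mult.commute)
  then show ?thesis using that[OF k PR y] evR by (simp add: g_def s_def)
qed

text \<open>
  The analogue of \<open>sinh_polynomial\<close>, built from the square roots \<open>R, S\<close> of a close pair. The polynomial \<open>V\<close> is
  the Wronskian-type combination whose value is \<open>R(x) S(x) (\<nu>(\<zeta> t\<^sup>M) + \<nu>(\<xi> t\<^sup>N))\<close>: all other terms occur twice and
  cancel. Expanding \<open>\<psi> = 1 + \<alpha> t + O(t\<^sup>2)\<close> turns \<open>x V(x)\<close> into \<open>\<alpha> (\<sigma> + 1 / \<sigma>)\<close>. The
  error is small because \<open>\<theta> \<psi>\<close> has no coefficient at \<open>t\<^sup>2\<close> in characteristic two.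
\<close>

lemma cosh_polynomial_char_2:
  assumes close: close_pairs
  obtains C c e where "c \<noteq> 0" "e \<ge> 1"
    "ord_ge (int \<kappa> * int e) (ev x C - (fls_const c * fls_X_inv ^ e + 1 / (fls_const c * fls_X_inv ^ e)))"
proof -
  obtain A \<zeta> M B \<xi> N where AB: "scales A \<zeta> M" "scales B \<xi> N" "M < N" "(\<kappa> + 2) * (N - M) \<le> M"
     "of_nat M \<noteq> (0::'a)" "of_nat N \<noteq> (0::'a)"
    using close unfolding close_pairs_def by metis
  obtain R y k where R: "M = 2 * k + 1" "y\<^sup>2 = inverse \<zeta>"
    "ev x R = fls_const y * fls_X_inv ^ k * (power_subst \<zeta> M \<psi> / \<psi>)"
    "ev x (pCons 0 (pderiv R)) = ev x R * (of_nat k + power_subst \<zeta> M \<nu> + \<nu>)"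
    using scales_char_2[OF AB(1,5)] by metis
  obtain S y' l where S: "N = 2 * l + 1" "y'\<^sup>2 = inverse \<xi>"
    "ev x S = fls_const y' * fls_X_inv ^ l * (power_subst \<xi> N \<psi> / \<psi>)"
    "ev x (pCons 0 (pderiv S)) = ev x S * (of_nat l + power_subst \<xi> N \<nu> + \<nu>)"
    using scales_char_2[OF AB(2,6)] by metis
  have z: "\<zeta> \<noteq> 0" "M > 0" "\<xi> \<noteq> 0" "N > 0" using AB by (auto simp: scales_def)
  define e where "e = l - k"
  have e: "e \<ge> 1" "l = k + e" using AB(3) R(1) S(1) by (auto simp: e_def)
  define \<alpha> where "\<alpha> = fls_const (\<psi> $$ 1)"
  define sM sN where "sM = power_subst \<zeta> M" and "sN = power_subst \<xi> N"
  define V where "V = pCons 0 (pderiv R) * S + R * pCons 0 (pderiv S) + of_nat (k + l) * (R * S)"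
  have evV: "ev x V = ev x R * ev x S * (sM \<nu> + sN \<nu>)"
  proof -
    have "ev x V = ev x R * ev x S * ((of_nat k + sM \<nu> + \<nu>) + (of_nat l + sN \<nu> + \<nu>) + of_nat (k + l))"
      unfolding V_def ev_add ev_mult R(4) S(4) sM_def sN_def ev_of_nat by (simp only: distrib_left mult_ac)
    also have "(of_nat k + sM \<nu> + \<nu>) + (of_nat l + sN \<nu> + \<nu>) + of_nat (k + l)
       = (sM \<nu> + sN \<nu>) + (\<nu> + \<nu>) + ((of_nat k + of_nat l) + (of_nat k + of_nat l))"
      by (simp add: add_ac)
    finally show ?thesis by (simp only: c2(1) add_0_right)
  qed
  define G where "G = fls_const (y * y') * fls_X_inv ^ (k + l + 1)"
  have xV: "x * ev x V = G * (sM (euler \<psi>) * sN \<psi> + sM \<psi> * sN (euler \<psi>))"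
  proof -
    have "x * ev x V = fls_X_inv * (\<psi>\<^sup>2 * (ev x R * ev x S * (sM \<nu> + sN \<nu>)))"
      unfolding evV by (subst x\<psi>) (simp only: mult.assoc)
    also have "\<dots> = fls_const y * fls_const y' * (fls_X_inv * fls_X_inv ^ k * fls_X_inv ^ l) *
       ((\<psi> * (sM \<psi> / \<psi>)) * (\<psi> * (sN \<psi> / \<psi>))) * (sM \<nu> + sN \<nu>)"
      unfolding R(3) S(3) sM_def sN_def by (simp only: power2_eq_square mult_ac)
    also have "\<dots> = G * (sM \<psi> * sN \<psi> * (sM \<nu> + sN \<nu>))"
      using psi_facts(3) by (simp add: G_def fls_const_mult_const power_add mult_ac)
    finally show ?thesis
      unfolding euler_psi sM_def sN_def power_subst_mult[OF z(1,2)] power_subst_mult[OF z(3,4)]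
      by (simp only: distrib_left mult_ac add_ac)
  qed
  define Z Y where "Z = sM fls_X_inv" and "Y = sN fls_X_inv"
  have ZY: "Z = fls_const (inverse \<zeta>) * fls_X_inv ^ M" "Y = fls_const (inverse \<xi>) * fls_X_inv ^ N"
    using z by (simp_all add: Z_def Y_def sM_def sN_def power_subst_X_inv)
  have ZY0: "Z \<noteq> 0" "Y \<noteq> 0" using z by (simp_all add: Z_def Y_def sM_def sN_def power_subst_eq_0_iff)
  have tX: "sM fls_X = 1 / Z" "sN fls_X = 1 / Y"
    unfolding Z_def Y_def sM_def sN_def fls_inverse_X[symmetric] power_subst_inverse[OF z(1,2)] power_subst_inverse[OF z(3,4)]
    by (simp_all add: inverse_eq_divide)
  define e2 e3 where "e2 = \<psi> - 1 - \<alpha> * fls_X" and "e3 = euler \<psi> - \<alpha> * fls_X"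
  have o2: "ord_ge (1 + 1) e2"
    unfolding e2_def \<alpha>_def by (intro ord_ge_Suc ord_ge_diff \<psi>) (auto simp: ord_ge_def)
  have e3_nth: "e3 $$ i = of_int i * \<psi> $$ i - (if i = 1 then \<psi> $$ 1 else 0)" for i
  proof -
    have "euler \<psi> $$ i = (- euler \<psi>) $$ i" by (simp only: c2(3))
    also have "\<dots> = of_int i * \<psi> $$ i" by (simp add: euler_nth)
    finally show ?thesis by (simp add: e3_def \<alpha>_def)
  qed
  have o3: "ord_ge 3 e3"
    unfolding ord_ge_def
  proof safe
    fix i :: int assume "i < 3"
    then consider "i < 0" | "i = 0" | "i = 1" | "i = 2" by linarith
    then show "e3 $$ i = 0"
    proof cases
      case 4
      have "(of_nat CHAR('a) :: 'a) = 0" by (rule of_nat_CHAR)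
      then have "(2::'a) = 0" by (simp add: char)
      then show ?thesis using 4 by (simp add: e3_nth)
    qed (use psi_facts(1) in \<open>auto simp: e3_nth ord_ge_def\<close>)
  qed
  have exp: "sM \<psi> = 1 + \<alpha> / Z + sM e2" "sN \<psi> = 1 + \<alpha> / Y + sN e2"
    "sM (euler \<psi>) = \<alpha> / Z + sM e3" "sN (euler \<psi>) = \<alpha> / Y + sN e3"
    using z tX by (simp_all add: e2_def e3_def sM_def sN_def power_subst_diff power_subst_mult power_subst_1 \<alpha>_def power_subst_const)
  define W where "W = \<alpha> / Z * sN e2 + sM e3 * sN \<psi> + sM e2 * (\<alpha> / Y) + sM \<psi> * sN e3"
  have sum: "sM (euler \<psi>) * sN \<psi> + sM \<psi> * sN (euler \<psi>) = \<alpha> * (1 / Z + 1 / Y) + W"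
  proof -
    have alg: "(p + r3) * b + a * (q + s3) = (p + q) + (p * s2 + r3 * b + r2 * q + a * s3) + (p * q + p * q)"
      if "a = 1 + p + r2" "b = 1 + q + s2" for a b p q r2 r3 s2 s3 :: "'a fls"
    proof -
      have "p * b = p + p * q + p * s2" "a * q = q + p * q + r2 * q"
        unfolding that by (simp_all add: algebra_simps)
      then show ?thesis by (simp add: distrib_left distrib_right add_ac)
    qed
    show ?thesis unfolding exp(3,4) alg[OF exp(1,2)] W_def c2(1)
      by (simp add: distrib_left)
  qed
  have inv: "ord_ge (- fls_subdegree f) (1 / f)" if "f \<noteq> 0" for f :: "'a fls"
  proof -
    have "fls_subdegree (f * (1 / f)) = fls_subdegree f + fls_subdegree (1 / f)"
      using that by (intro fls_subdegree_mult) auto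
    then show ?thesis using that by (simp add: ord_ge_iff_subdegree)
  qed
  have subX: "fls_subdegree (fls_const c * fls_X_inv ^ n) = - int n" if "c \<noteq> 0" for c :: 'a and n
    using that by (simp add: fls_subdegree_pow)
  have oZY: "ord_ge (int M) (1 / Z)" "ord_ge (int N) (1 / Y)"
    using inv[OF ZY0(1)] inv[OF ZY0(2)] z by (simp_all add: ZY subX)
  have o\<alpha>: "ord_ge (int M) (\<alpha> / Z)" "ord_ge (int N) (\<alpha> / Y)"
    using ord_ge_cmult[OF oZY(1), of "\<psi> $$ 1"] ord_ge_cmult[OF oZY(2), of "\<psi> $$ 1"] by (simp_all add: \<alpha>_def)
  have os: "ord_ge (int M * 0) (sM \<psi>)" "ord_ge (int N * 0) (sN \<psi>)" "ord_ge (int M * 2) (sM e2)"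
    "ord_ge (int N * 2) (sN e2)" "ord_ge (int M * 3) (sM e3)" "ord_ge (int N * 3) (sN e3)"
    unfolding sM_def sN_def
    using ord_ge_power_subst[OF z(1,2) psi_facts(1)] ord_ge_power_subst[OF z(3,4) psi_facts(1)]
      ord_ge_power_subst[OF z(1,2) o2] ord_ge_power_subst[OF z(3,4) o2]
      ord_ge_power_subst[OF z(1,2) o3] ord_ge_power_subst[OF z(3,4) o3] by simp_all
  have oW: "ord_ge (3 * int M) W"
    unfolding W_def
  proof (intro ord_ge_add)
    show "ord_ge (3 * int M) (\<alpha> / Z * sN e2)" using AB(3) by (intro ord_ge_mono[OF ord_ge_mult[OF o\<alpha>(1) os(4)]]) simp
    show "ord_ge (3 * int M) (sM e3 * sN \<psi>)" by (intro ord_ge_mono[OF ord_ge_mult[OF os(5,2)]]) simp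
    show "ord_ge (3 * int M) (sM e2 * (\<alpha> / Y))" using AB(3) by (intro ord_ge_mono[OF ord_ge_mult[OF os(3) o\<alpha>(2)]]) simp
    show "ord_ge (3 * int M) (sM \<psi> * sN e3)" using AB(3) by (intro ord_ge_mono[OF ord_ge_mult[OF os(1,6)]]) simp
  qed
  define c where "c = y * y' * \<zeta>"
  have yn: "y \<noteq> 0" "y' \<noteq> 0" using R(2) S(2) z by auto
  have c0: "c \<noteq> 0" using yn z by (simp add: c_def)
  define \<sigma> where "\<sigma> = fls_const c * fls_X_inv ^ e"
  have G\<sigma>: "G = \<sigma> * Z"
  proof -
    have "k + l + 1 = e + M" using e R(1) by simp
    moreover have "y * y' = c * inverse \<zeta>" using z by (simp add: c_def)
    ultimately have "G = fls_const (c * inverse \<zeta>) * fls_X_inv ^ (e + M)" by (simp only: G_def)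
    then show ?thesis by (simp only: \<sigma>_def ZY power_add fls_const_mult_const[symmetric] mult_ac)
  qed
  have \<sigma>0: "\<sigma> \<noteq> 0" using c0 by (simp add: \<sigma>_def)
  have \<sigma>Y: "\<sigma> * G = Y"
  proof -
    have "e + (k + l + 1) = N" using e S(1) by simp
    moreover have "c * (y * y') = inverse \<xi>"
    proof -
      have "c * (y * y') = y\<^sup>2 * y'\<^sup>2 * \<zeta>" by (simp add: c_def power2_eq_square mult_ac)
      then show ?thesis using z by (simp add: R S)
    qed
    ultimately have "fls_const (c * (y * y')) * fls_X_inv ^ (e + (k + l + 1)) = Y" by (simp only: ZY)
    then show ?thesis by (simp only: \<sigma>_def G_def power_add fls_const_mult_const[symmetric] mult_ac)
  qed
  have GZY: "G * (1 / Z) = \<sigma>" "G * (1 / Y) = 1 / \<sigma>"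
    using ZY0 \<sigma>0 by (simp add: G\<sigma>) (use ZY0 \<sigma>0 in \<open>simp add: field_simps flip: \<sigma>Y\<close>)
  have "x * ev x V = \<alpha> * (G * (1 / Z) + G * (1 / Y)) + G * W"
    unfolding xV sum by (simp only: distrib_left mult_ac)
  then have xV': "x * ev x V = \<alpha> * (\<sigma> + 1 / \<sigma>) + G * W" by (simp only: GZY)
  define C where "C = smult (inverse (\<psi> $$ 1)) (pCons 0 V)"
  have "ev x C - (\<sigma> + 1 / \<sigma>) = fls_const (inverse (\<psi> $$ 1)) * (G * W)"
  proof -
    have "ev x C = fls_const (inverse (\<psi> $$ 1)) * (\<alpha> * (\<sigma> + 1 / \<sigma>) + G * W)"
      by (simp add: C_def ev_smult ev_pCons xV')
    also have "\<dots> = (fls_const (inverse (\<psi> $$ 1)) * \<alpha>) * (\<sigma> + 1 / \<sigma>) + fls_const (inverse (\<psi> $$ 1)) * (G * W)"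
      by (simp only: distrib_left mult.assoc)
    also have "fls_const (inverse (\<psi> $$ 1)) * \<alpha> = 1" using \<alpha> by (simp add: \<alpha>_def fls_const_mult_const)
    finally show ?thesis by simp
  qed
  moreover have "ord_ge (int \<kappa> * int e) (fls_const (inverse (\<psi> $$ 1)) * (G * W))"
  proof (intro ord_ge_cmult)
    have "ord_ge (- int (k + l + 1)) G" unfolding G_def using yn subX[of "y * y'" "k + l + 1"]
      by (simp add: ord_ge_iff_subdegree del: of_nat_Suc)
    then have o: "ord_ge (- int (k + l + 1) + 3 * int M) (G * W)" by (rule ord_ge_mult[OF _ oW])
    have "\<kappa> * e \<le> (\<kappa> + 2) * (N - M)" using R(1) S(1) e by (intro mult_le_mono) auto
    then have "\<kappa> * e \<le> M" using AB(4) by linarith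
    then have 1: "int \<kappa> * int e \<le> int M" by (metis of_nat_le_iff of_nat_mult)
    have "N - M \<le> (\<kappa> + 2) * (N - M)" by simp
    then have "N - M \<le> M" using AB(4) by linarith
    then have "l + 1 \<le> M + M" "k \<le> M" using R(1) S(1) by linarith+
    then have "k + l + 1 \<le> 2 * M" using R(1) S(1) \<open>N - M \<le> M\<close> by linarith
    then have "int M \<le> - int (k + l + 1) + 3 * int M" by linarith
    then show "ord_ge (int \<kappa> * int e) (G * W)" using 1 by (intro ord_ge_mono[OF o]) linarith
  qed
  ultimately show ?thesis using that[OF c0 e(1), of C] by (simp add: \<sigma>_def)
qed

lemma sigma_facts:
  assumes "(c::'a) \<noteq> 0" "e \<ge> 1"
  defines "\<sigma> \<equiv> fls_const c * fls_X_inv ^ e"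
  shows "\<sigma> \<noteq> 0" "ord_ge (- int e) \<sigma>" "ord_ge (int e) (1 / \<sigma>)" "fls_subdegree (\<sigma> + 1 / \<sigma>) = - int e"
    "\<sigma> + 1 / \<sigma> \<noteq> 0" "1 + 1 / \<sigma> \<noteq> 0" "fls_subdegree (1 + 1 / \<sigma>) = 0" "euler \<sigma> = of_nat e * \<sigma>"
    "euler (1 / \<sigma>) = of_nat e * (1 / \<sigma>)"
proof -
  show \<sigma>0: "\<sigma> \<noteq> 0" using assms by simp
  have s: "fls_subdegree \<sigma> = - int e" using assms by (simp add: fls_subdegree_pow)
  then show o: "ord_ge (- int e) \<sigma>" by (simp add: ord_ge_iff_subdegree)
  have "fls_subdegree (\<sigma> * (1 / \<sigma>)) = fls_subdegree \<sigma> + fls_subdegree (1 / \<sigma>)"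
    using \<sigma>0 by (intro fls_subdegree_mult) auto
  then show oi: "ord_ge (int e) (1 / \<sigma>)" using \<sigma>0 s by (simp add: ord_ge_iff_subdegree)
  have z: "(1 / \<sigma>) $$ i = 0" if "i \<le> 0" for i using oi that assms(2) by (simp add: ord_ge_def)
  have "\<sigma> $$ (- int e) \<noteq> 0" using s \<sigma>0 by (metis nth_fls_subdegree_nonzero)
  then have n: "(\<sigma> + 1 / \<sigma>) $$ (- int e) \<noteq> 0" using z[of "- int e"] by simp
  show "fls_subdegree (\<sigma> + 1 / \<sigma>) = - int e"
    using n o oi by (intro fls_subdegree_eq_of_ord_ge ord_ge_add ord_ge_mono[OF oi]) auto
  show "\<sigma> + 1 / \<sigma> \<noteq> 0" using n by (metis fls_zero_nth)
  have n1: "(1 + 1 / \<sigma>) $$ 0 = 1" using z[of 0] by simp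
  show "fls_subdegree (1 + 1 / \<sigma>) = 0"
    using n1 by (intro fls_subdegree_eq_of_ord_ge ord_ge_add ord_ge_mono[OF oi]) auto
  show "1 + 1 / \<sigma> \<noteq> 0" using n1 by (metis fls_zero_nth zero_neq_one)
  show e\<sigma>: "euler \<sigma> = of_nat e * \<sigma>"
    by (simp add: \<sigma>_def euler_mult euler_X_inv_power mult.left_commute)
  have "euler (1 / \<sigma>) = - (of_nat e * (1 / \<sigma>))"
    using \<sigma>0 euler_inverse[of \<sigma>] by (simp add: e\<sigma> inverse_eq_divide field_simps power2_eq_square)
  then show "euler (1 / \<sigma>) = of_nat e * (1 / \<sigma>)"
    using c2(3)[of "of_nat e * (1 / \<sigma>)"] by (rule trans)
qed

text \<open>
  If \<open>e\<close> is even, then \<open>\<theta>\<close> kills \<open>\<sigma> + 1 / \<sigma>\<close>, so \<open>C' = 0\<close> and \<open>C\<close> is a square. Its square root has the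
  same shape with \<open>e / 2\<close>, and the relative precision \<open>\<kappa>\<close> is preserved.
\<close>

lemma cosh_polynomial_odd:
  assumes "c \<noteq> 0" "e \<ge> 1" "\<kappa> \<ge> 1"
    "ord_ge (int \<kappa> * int e) (ev x C - (fls_const c * fls_X_inv ^ e + 1 / (fls_const c * fls_X_inv ^ e)))"
  shows "\<exists>C c e. c \<noteq> 0 \<and> odd e \<and>
    ord_ge (int \<kappa> * int e) (ev x C - (fls_const c * fls_X_inv ^ e + 1 / (fls_const c * fls_X_inv ^ e)))"
  using assms
proof (induction e arbitrary: C c rule: less_induct)
  case (less e)
  show ?case
  proof (cases "odd e")
    case True
    then show ?thesis using less.prems by blast
  next
    case False
    then obtain f where f: "e = 2 * f" by (auto elim: evenE)
    have f1: "f \<ge> 1" "f < e" using less.prems(2) f by auto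
    let ?\<sigma> = "fls_const c * fls_X_inv ^ e"
    note \<sigma> = sigma_facts[OF less.prems(1,2)]
    have "euler (?\<sigma> + 1 / ?\<sigma>) = 0"
      unfolding euler_add \<sigma>(8,9) by (simp add: f two_zero)
    then have "euler (ev x C - (?\<sigma> + 1 / ?\<sigma>)) = x * ev x (pderiv C)"
      unfolding euler_diff euler_ev euler_x_char_2 by (simp only: diff_0_right mult.commute)
    then have "ord_ge (int \<kappa> * int e) (x * ev x (pderiv C))" using ord_ge_euler[OF less.prems(4)] by simp
    then have "ord_ge (int \<kappa> * int e - -1) (ev x (pderiv C))" using ord_ge_cancel[of _ x] by fastforce
    then have "ord_ge 1 (ev x (pderiv C))" by (rule ord_ge_mono) simp
    then have "pderiv C = 0" by (rule ev_eq_0I[rotated]) simp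
    then obtain Z where Z: "C = Z\<^sup>2" by (rule square_of_pderiv_0)
    obtain c' where c': "c'\<^sup>2 = c" using nth_root_exists[of 2 c] by auto
    have c'0: "c' \<noteq> 0" using c' less.prems(1) by auto
    let ?\<tau> = "fls_const c' * fls_X_inv ^ f"
    have "?\<tau>\<^sup>2 = ?\<sigma>"
    proof -
      have "fls_const c' * fls_const c' = fls_const c" using c' by (simp add: fls_const_mult_const power2_eq_square)
      then have "(fls_const c' * fls_const c') * (fls_X_inv ^ f * fls_X_inv ^ f) = ?\<sigma>"
        by (simp add: f mult_2 power_add)
      then show ?thesis by (simp only: power2_eq_square mult_ac)
    qed
    then have "(?\<tau> + 1 / ?\<tau>)\<^sup>2 = ?\<sigma> + 1 / ?\<sigma>" by (simp only: c2(5) power_divide power_one)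
    then have "(ev x Z - (?\<tau> + 1 / ?\<tau>))\<^sup>2 = ev x C - (?\<sigma> + 1 / ?\<sigma>)"
      by (simp only: Z c2(4,5) ev_power)
    then have "ord_ge (int \<kappa> * int e) ((ev x Z - (?\<tau> + 1 / ?\<tau>))\<^sup>2)" using less.prems(4) by simp
    then have "ord_ge (int \<kappa> * int f) (ev x Z - (?\<tau> + 1 / ?\<tau>))"
      by (rule ord_ge_prime_power_cancel) (simp_all add: f)
    then show ?thesis using less.IH[OF f1(2) c'0 f1(1) less.prems(3)] by blast
  qed
qed

text \<open>
  The Artin-Schreier combination \<open>\<nu>\<^sup>2 + \<nu>\<close>, unlike \<open>\<nu>\<close> itself, is a rational function of \<open>x\<close> in the model case:
  for \<open>x = u + \<alpha>\<^sup>2 / u\<close> one has \<open>\<psi> = 1 + \<alpha> / u\<close>, \<open>\<nu> = \<alpha> / (u + \<alpha>)\<close> and \<open>\<beta> = \<alpha> / x\<close>.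
\<close>

definition \<beta> :: "'a fls" where "\<beta> = \<nu>\<^sup>2 + \<nu>"

lemma beta_facts: "ord_ge 1 \<beta>" "\<beta> $$ 1 = \<psi> $$ 1"
proof -
  have o: "ord_ge (1 + 1) (\<nu> * \<nu>)" by (intro ord_ge_mult nu_facts)
  then show "ord_ge 1 \<beta>" unfolding \<beta>_def power2_eq_square
    by (intro ord_ge_add nu_facts ord_ge_mono[OF o]) simp
  have "(\<nu> * \<nu>) $$ 1 = 0" using o by (simp add: ord_ge_def)
  then show "\<beta> $$ 1 = \<psi> $$ 1" by (simp add: \<beta>_def power2_eq_square nu_facts)
qed

text \<open>
  Start from \<open>C(x) = \<sigma> + 1 / \<sigma>\<close> up to an error, with \<open>e\<close> odd. Here \<open>\<theta>\<close> fixes the right side, so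
  \<open>X C' = C\<close> exactly and \<open>C = X Z\<^sup>2\<close>. The logarithmic derivative of \<open>Z(x)\<close> is \<open>\<nu> + s\<close> up to
  the constant \<open>k\<close> and a small error, where \<open>s = 1 / (1 + \<sigma>)\<close> satisfies \<open>(s\<^sup>2 + s) (\<sigma> + 1 / \<sigma>) = 1\<close>.
  Hence \<open>X (H\<^sup>2 + H Z) + 1\<close>, where \<open>H / Z\<close> has value \<open>\<nu> + s\<close>, is a numerator for \<open>\<beta> = \<nu>\<^sup>2 + \<nu>\<close> over the denominator \<open>C\<close>.
\<close>

lemma rational_approximation_of_beta:
  assumes close: close_pairs
  obtains A C e where "e \<ge> 1" "C \<noteq> 0" "degree C = e" "ord_ge (int \<kappa> * int e) (\<beta> * ev x C - ev x A)"
proof -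
  \<comment> \<open>The extra precision absorbs the poles of \<open>Z(x)\<close> and \<open>x\<close>; it is doubled below because a square root is taken.\<close>
  define \<kappa>' where "\<kappa>' = \<kappa> + 3"
  obtain C0 c0 e0 where "c0 \<noteq> 0" "e0 \<ge> 1"
    "ord_ge (int (2 * \<kappa>') * int e0) (ev x C0 - (fls_const c0 * fls_X_inv ^ e0 + 1 / (fls_const c0 * fls_X_inv ^ e0)))"
    by (rule cosh_polynomial_char_2[OF close])
  then obtain C c e where c: "c \<noteq> 0" "odd e"
    "ord_ge (int (2 * \<kappa>') * int e) (ev x C - (fls_const c * fls_X_inv ^ e + 1 / (fls_const c * fls_X_inv ^ e)))"
    using cosh_polynomial_odd[of c0 e0 "2 * \<kappa>'" C0] by (auto simp: \<kappa>'_def)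
  define J where "J = int \<kappa>' * int e"
  have e1: "e \<ge> 1" using c(2) by (cases e) auto
  have Je: "J \<ge> 3 * int e + int \<kappa> * int e" by (simp add: J_def \<kappa>'_def distrib_right)
  define \<sigma> where "\<sigma> = fls_const c * fls_X_inv ^ e"
  note \<sigma> = sigma_facts[OF c(1) e1, folded \<sigma>_def]
  have ofe: "(of_nat e :: 'a fls) = 1" using c(2) by (auto elim!: oddE simp: two_zero)
  define \<eta>0 where "\<eta>0 = ev x C - (\<sigma> + 1 / \<sigma>)"
  have \<eta>0: "ord_ge (2 * J) \<eta>0" using c(3) by (simp add: \<eta>0_def \<sigma>_def J_def mult.assoc)
  have J0: "J \<ge> 1" using Je e1 by (smt (verit) of_nat_0_le_iff mult_nonneg_nonneg of_nat_1 of_nat_le_iff)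
  have evC: "ev x C = (\<sigma> + 1 / \<sigma>) + \<eta>0" by (simp add: \<eta>0_def)
  have C: "C \<noteq> 0" "degree C = e"
  proof -
    have s: "fls_subdegree (ev x C) = - int e" "ev x C \<noteq> 0"
    proof -
      have "\<eta>0 $$ (- int e) = 0" using \<eta>0 J0 e1 by (simp add: ord_ge_def)
      moreover have "(\<sigma> + 1 / \<sigma>) $$ (- int e) \<noteq> 0" using \<sigma>(4,5) by (metis nth_fls_subdegree_nonzero)
      ultimately have n: "ev x C $$ (- int e) \<noteq> 0" unfolding evC by simp
      have "ord_ge (- int e) (ev x C)" unfolding evC
        using J0 \<sigma>(4) by (intro ord_ge_add[OF _ ord_ge_mono[OF \<eta>0]]) (auto simp: ord_ge_iff_subdegree)
      with n show "fls_subdegree (ev x C) = - int e" by (intro fls_subdegree_eq_of_ord_ge)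
      show "ev x C \<noteq> 0" using n by (metis fls_zero_nth)
    qed
    then show "C \<noteq> 0" by auto
    then show "degree C = e" using subdegree_ev(1)[of C] s by simp
  qed
  have "euler \<eta>0 = x * ev x (pderiv C) - (\<sigma> + 1 / \<sigma>)"
    unfolding \<eta>0_def euler_diff euler_add euler_ev euler_x_char_2 \<sigma>(8,9) ofe by (simp add: mult.commute)
  then have "ev x (pCons 0 (pderiv C) - C) = euler \<eta>0 - \<eta>0"
    by (simp add: ev_diff ev_pCons \<eta>0_def)
  moreover have "ord_ge (2 * J) (euler \<eta>0 - \<eta>0)" by (intro ord_ge_diff ord_ge_euler \<eta>0)
  ultimately have "ord_ge 1 (ev x (pCons 0 (pderiv C) - C))" using J0 by (auto elim!: ord_ge_mono)
  then have "pCons 0 (pderiv C) - C = 0" by (rule ev_eq_0I[rotated]) simp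
  then have C': "C = pCons 0 (pderiv C)" by simp
  have "pderiv C = pderiv C + pCons 0 (pderiv (pderiv C))"
    by (subst C') (simp add: pderiv_pCons)
  then have "pderiv (pderiv C) = 0" by simp
  then obtain Z where Z: "pderiv C = Z\<^sup>2" by (rule square_of_pderiv_0)
  have CZ: "ev x C = x * (ev x Z)\<^sup>2" by (subst C') (simp add: Z ev_pCons ev_power)
  obtain k where k: "e = 2 * k + 1" using c(2) by (rule oddE)
  obtain y where y: "y\<^sup>2 = c" using nth_root_exists[of 2 c] by auto
  define Z1 where "Z1 = fls_const y * fls_X_inv ^ k * ((1 + 1 / \<sigma>) / \<psi>)"
  have "x * Z1\<^sup>2 = \<sigma> + 1 / \<sigma>"
  proof -
    have yy: "fls_const y * fls_const y = fls_const c" using y by (simp add: power2_eq_square fls_const_mult_const)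
    have "x * Z1\<^sup>2 = (fls_const y * fls_const y) * (fls_X_inv * fls_X_inv ^ k * fls_X_inv ^ k) * (\<psi> * ((1 + 1 / \<sigma>) / \<psi>))\<^sup>2"
      by (subst x\<psi>) (simp only: Z1_def power2_eq_square mult_ac)
    also have "fls_X_inv * fls_X_inv ^ k * fls_X_inv ^ k = (fls_X_inv ^ e :: 'a fls)"
      by (simp add: k mult_2 power_add)
    also have "\<psi> * ((1 + 1 / \<sigma>) / \<psi>) = 1 + 1 / \<sigma>" using psi_facts(3) by simp
    finally have "x * Z1\<^sup>2 = \<sigma> * (1 + 1 / \<sigma>)\<^sup>2" by (simp only: yy \<sigma>_def)
    also have "\<dots> = \<sigma> * (1 + (1 / \<sigma>)\<^sup>2)" by (simp only: c2(5) power_one)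
    also have "\<dots> = \<sigma> + 1 / \<sigma>" using \<sigma>(1) by (simp add: distrib_left power2_eq_square)
    finally show ?thesis .
  qed
  then have "x * (ev x Z - Z1)\<^sup>2 = \<eta>0"
    using CZ by (simp add: \<eta>0_def c2(4,5) distrib_left)
  then have "ord_ge (2 * J - -1) ((ev x Z - Z1)\<^sup>2)" using \<eta>0 ord_ge_cancel[of "2 * J" x] by fastforce
  then have \<eta>: "ord_ge J (ev x Z - Z1)" by (rule ord_ge_prime_power_cancel) auto
  define \<eta> where "\<eta> = ev x Z - Z1"
  define s where "s = 1 / \<sigma> / (1 + 1 / \<sigma>)"
  define H where "H = pCons 0 (pderiv Z) + of_nat k * Z"
  have eZ1: "euler Z1 = Z1 * (of_nat k + s + \<nu>)"
  proof -
    let ?f = "(1 + 1 / \<sigma>) / \<psi>"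
    have f: "\<psi> * ?f = 1 + 1 / \<sigma>" using psi_facts(3) by simp
    have "1 / \<sigma> = euler (1 + 1 / \<sigma>)" by (simp add: euler_add \<sigma>(9) ofe)
    also have "\<dots> = \<psi> * euler ?f + \<psi> * \<nu> * ?f" by (subst f[symmetric]) (simp only: euler_mult euler_psi)
    finally have "\<psi> * euler ?f + \<psi> * \<nu> * ?f = (1 + 1 / \<sigma>) * s" using \<sigma>(6) by (simp add: s_def)
    also have "\<dots> = \<psi> * (?f * s)" using psi_facts(3) by simp
    finally have "\<psi> * euler ?f = \<psi> * (?f * s) + \<psi> * \<nu> * ?f" by (metis c2(2) add.commute)
    then have "\<psi> * euler ?f = \<psi> * (?f * (s + \<nu>))" by (simp only: distrib_left distrib_right mult_ac)
    then have ef: "euler ?f = ?f * (s + \<nu>)" by (rule mult_left_cancel[OF psi_facts(3), THEN iffD1])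
    show ?thesis
      unfolding Z1_def euler_mult[of "fls_const y * fls_X_inv ^ k"] euler_mult[of "fls_const y"]
        euler_X_inv_power euler_const ef
      by (simp only: distrib_left distrib_right mult_ac add_ac mult_zero_left add_0_right add_0_left)
  qed
  have os: "ord_ge 0 s" "ord_ge 0 \<nu>" "ord_ge 0 (of_nat k :: 'a fls)"
  proof -
    have "ord_ge (int e) ((1 + 1 / \<sigma>) * s)" using \<sigma>(3,6) by (simp add: s_def)
    then have "ord_ge (int e - 0) s" using ord_ge_cancel[of "int e" "1 + 1 / \<sigma>"] \<sigma>(6,7) by fastforce
    then show "ord_ge 0 s" by (rule ord_ge_mono) simp
    show "ord_ge 0 \<nu>" using nu_facts(1) by (rule ord_ge_mono) simp
  qed simp
  define \<theta> where "\<theta> = \<eta> * (of_nat k + s + \<nu>) + euler \<eta>"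
  have "ord_ge (J + 0) (\<eta> * (of_nat k + s + \<nu>))"
    using \<eta> os unfolding \<eta>_def by (intro ord_ge_mult ord_ge_add)
  then have o\<theta>: "ord_ge J \<theta>" unfolding \<theta>_def using \<eta> by (intro ord_ge_add ord_ge_euler) (simp_all add: \<eta>_def)
  have HZ: "ev x H = (\<nu> + s) * ev x Z + \<theta>"
  proof -
    have "x * ev x (pderiv Z) = euler (Z1 + \<eta>)" by (simp add: \<eta>_def euler_ev euler_x_char_2 mult.commute)
    also have "\<dots> = Z1 * (of_nat k + s + \<nu>) + euler \<eta>" by (simp add: euler_add eZ1)
    also have "\<dots> = (ev x Z + \<eta>) * (of_nat k + s + \<nu>) + euler \<eta>"
      by (simp only: \<eta>_def c2(4) c2(2))
    finally have "x * ev x (pderiv Z) = ev x Z * (of_nat k + s + \<nu>) + \<theta>"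
      by (simp add: \<theta>_def distrib_right add_ac)
    then have "ev x H = (ev x Z * (of_nat k + s + \<nu>) + \<theta>) + of_nat k * ev x Z"
      by (simp add: H_def ev_add ev_mult ev_pCons ev_of_nat)
    also have "\<dots> = (\<nu> + s) * ev x Z + \<theta> + (of_nat k * ev x Z + of_nat k * ev x Z)"
      by (simp add: distrib_left distrib_right mult_ac add_ac)
    finally show ?thesis by (simp only: c2(1) add_0_right)
  qed
  define A where "A = pCons 0 (H\<^sup>2 + H * Z) + 1"
  have ss: "(s\<^sup>2 + s) * (\<sigma> + 1 / \<sigma>) = 1"
  proof -
    have "s\<^sup>2 + s = s * (s + 1)" by (simp add: power2_eq_square distrib_left)
    also have "s + 1 = 1 / (1 + 1 / \<sigma>)"
    proof -
      have "(s + 1) * (1 + 1 / \<sigma>) = 1 / \<sigma> + (1 + 1 / \<sigma>)" using \<sigma>(6) by (simp add: s_def distrib_right)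
      also have "\<dots> = 1"
        by (simp only: add.left_commute[of "1 / \<sigma>" 1 "1 / \<sigma>"] c2(1) add_0_right)
      finally show ?thesis using \<sigma>(6) by (metis nonzero_eq_divide_eq)
    qed
    finally have "(s\<^sup>2 + s) * (1 + 1 / \<sigma>)\<^sup>2 = 1 / \<sigma>" using \<sigma>(6) by (simp add: s_def power2_eq_square)
    then have "(s\<^sup>2 + s) * (1 + 1 / \<sigma>)\<^sup>2 * \<sigma> = 1" using \<sigma>(1) by simp
    moreover have "(1 + 1 / \<sigma>)\<^sup>2 * \<sigma> = \<sigma> + 1 / \<sigma>"
      using \<sigma>(1) by (simp only: c2(5)) (simp add: distrib_right power2_eq_square)
    ultimately show ?thesis by (simp only: mult.assoc)
  qed
  have key: "\<beta> * ev x C - ev x A = x * (\<theta>\<^sup>2 + \<theta> * ev x Z) + (s\<^sup>2 + s) * \<eta>0"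
  proof -
    have "ev x A = x * ((ev x H)\<^sup>2 + ev x H * ev x Z) + 1"
      by (simp add: A_def ev_add ev_pCons ev_power ev_mult)
    also have "(ev x H)\<^sup>2 + ev x H * ev x Z = ((\<nu> + s) * ev x Z)\<^sup>2 + \<theta>\<^sup>2 + ((\<nu> + s) * ev x Z + \<theta>) * ev x Z"
      by (simp only: HZ c2(5))
    also have "\<dots> = (\<beta> + (s\<^sup>2 + s)) * (ev x Z)\<^sup>2 + (\<theta>\<^sup>2 + \<theta> * ev x Z)"
      unfolding power_mult_distrib c2(5) \<beta>_def
      by (simp add: distrib_left distrib_right mult_ac add_ac power2_eq_square)
    finally have "ev x A = \<beta> * ev x C + ((s\<^sup>2 + s) * ev x C + 1) + x * (\<theta>\<^sup>2 + \<theta> * ev x Z)"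
      by (simp add: CZ distrib_left distrib_right mult_ac add_ac)
    also have "(s\<^sup>2 + s) * ev x C = 1 + (s\<^sup>2 + s) * \<eta>0" by (simp only: evC distrib_left[of "s\<^sup>2 + s" "\<sigma> + 1 / \<sigma>"] ss)
    finally have "ev x A = \<beta> * ev x C + ((s\<^sup>2 + s) * \<eta>0 + x * (\<theta>\<^sup>2 + \<theta> * ev x Z)) + (1 + 1)"
      by (simp only: add_ac)
    then show ?thesis by (simp only: c2(1,2,4) add_0_right) (simp only: add_ac)
  qed
  have oZ: "ord_ge (- int e) (ev x Z)"
  proof -
    have "degree Z \<le> e"
    proof -
      have "degree (Z\<^sup>2) \<le> e" using degree_pderiv_le[of C] C(2) by (simp flip: Z)
      then show ?thesis by (cases "Z = 0") (simp_all add: degree_power_eq)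
    qed
    then show ?thesis by (rule ord_ge_ev_degree)
  qed
  have "ord_ge (int \<kappa> * int e) (\<beta> * ev x C - ev x A)"
    unfolding key
  proof (rule ord_ge_add)
    have "0 \<le> int \<kappa> * int e" by simp
    then have J': "J - int e - 1 \<ge> int \<kappa> * int e" "J + J - 1 \<ge> int \<kappa> * int e" using Je e1 by linarith+
    have o: "ord_ge (J - int e) (\<theta>\<^sup>2 + \<theta> * ev x Z)"
      unfolding power2_eq_square
      using J0 e1 ord_ge_mult[OF o\<theta> o\<theta>] ord_ge_mult[OF o\<theta> oZ] by (intro ord_ge_add) (auto elim!: ord_ge_mono)
    show "ord_ge (int \<kappa> * int e) (x * (\<theta>\<^sup>2 + \<theta> * ev x Z))"
      using ord_ge_mult[OF ord_ge_x o] J' by (auto elim!: ord_ge_mono)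
    have "ord_ge 0 (s\<^sup>2 + s)" unfolding power2_eq_square
      using ord_ge_mult[OF os(1) os(1)] os(1) by (intro ord_ge_add) simp_all
    from ord_ge_mult[OF this \<eta>0] show "ord_ge (int \<kappa> * int e) ((s\<^sup>2 + s) * \<eta>0)"
      by (rule ord_ge_mono) (use Je J0 \<open>0 \<le> int \<kappa> * int e\<close> in linarith)
  qed
  then show ?thesis using that e1 C by blast
qed

text \<open>
  With \<open>h = \<nu>(z t\<^sup>m) + \<nu>\<close> one has \<open>\<beta>(z t\<^sup>m) + \<beta> = h\<^sup>2 + h\<close>, and \<open>R(x)\<^sup>2 (h\<^sup>2 + h)\<close> is the value of a
  polynomial \<open>N\<^sub>0\<close>. Inserting the approximation \<open>A / C\<close> of \<open>\<beta>\<close> and clearing denominators gives an exact identity.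
  In lowest terms \<open>A\<^sub>0 / B\<^sub>0\<close> the polynomial \<open>B\<^sub>0 \<circ> F\<close> divides \<open>R\<^sup>2 B\<^sub>0\<close>, so \<open>degree B\<^sub>0 \<le> 1\<close>. Comparison of
  leading terms and a second divisibility argument leave \<open>A\<^sub>0 / B\<^sub>0 = \<psi>\<^sub>1 / X\<close>, for which the identity is the asserted equation.
\<close>

theorem artin_schreier_equation:
  assumes close: close_pairs and F: "scales F z m" and m: "m > 1" "of_nat m \<noteq> (0::'a)"
  obtains R where "F = pCons 0 (R\<^sup>2)"
    "smult (\<psi> $$ 1) (1 + R\<^sup>2) = pCons 0 (pCons 0 (pderiv R)) * (pCons 0 (pderiv R) + R)"
proof -
  have z: "z \<noteq> 0" "m > 0" using F by (auto simp: scales_def)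
  obtain R y k where R: "m = 2 * k + 1" "F = pCons 0 (R\<^sup>2)"
    "ev x (pCons 0 (pderiv R)) = ev x R * (of_nat k + power_subst z m \<nu> + \<nu>)"
    using scales_char_2[OF F m(2)] by metis
  have R0: "R \<noteq> 0" using degree_scales[OF F] m R(2) by auto
  have dF: "degree F = m" by (rule degree_scales[OF F])
  have dR: "degree (R\<^sup>2) = m - 1" using dF R0 R(2) by (simp split: if_splits)
  define H where "H = pCons 0 (pderiv R) + of_nat k * R"
  have evH: "ev x H = ev x R * (power_subst z m \<nu> + \<nu>)"
  proof -
    have "ev x H = ev x R * (of_nat k + power_subst z m \<nu> + \<nu>) + of_nat k * ev x R"
      unfolding H_def ev_add ev_mult ev_of_nat R(3) ..
    also have "\<dots> = ev x R * (power_subst z m \<nu> + \<nu>) + (of_nat k * ev x R + of_nat k * ev x R)"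
      by (simp add: distrib_left mult_ac add_ac)
    finally show ?thesis by (simp only: c2(1) add_0_right)
  qed
  define N0 where "N0 = H\<^sup>2 + H * R"
  let ?s\<beta> = "power_subst z m \<beta>"
  have fe: "(?s\<beta> + \<beta>) * (ev x R)\<^sup>2 = ev x N0"
  proof -
    have "?s\<beta> = (power_subst z m \<nu>)\<^sup>2 + power_subst z m \<nu>"
      by (simp add: \<beta>_def power_subst_add[OF z] power_subst_power[OF z])
    then have "?s\<beta> + \<beta> = (power_subst z m \<nu> + \<nu>)\<^sup>2 + (power_subst z m \<nu> + \<nu>)"
      by (simp only: \<beta>_def c2(5) add_ac)
    moreover have "(t\<^sup>2 + t) * r\<^sup>2 = (r * t)\<^sup>2 + r * t * r" for t r :: "'a fls"
      by (simp add: distrib_left distrib_right power2_eq_square mult_ac)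
    ultimately show ?thesis by (simp only: N0_def ev_add ev_power ev_mult evH)
  qed
  obtain A C e where C: "e \<ge> 1" "C \<noteq> 0" "degree C = e" "ord_ge (int (2 * m + 3) * int e) (\<beta> * ev x C - ev x A)"
    by (rule rational_approximation_of_beta[OF close])
  define J where "J = int (2 * m + 3) * int e"
  have J: "J \<ge> 2 * int (m * e) + 3" "int (m * e) \<ge> int m" "int (m * e) \<ge> int e"
  proof -
    have n: "2 * (m * e) + 3 \<le> (2 * m + 3) * e" "m \<le> m * e" "e \<le> m * e"
      using C(1) m(1) by (simp_all add: distrib_right)
    have "int (2 * (m * e) + 3) \<le> int ((2 * m + 3) * e)" using n(1) by (simp only: of_nat_le_iff)
    then show "J \<ge> 2 * int (m * e) + 3" by (simp only: J_def of_nat_add of_nat_mult of_nat_numeral)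
    show "int (m * e) \<ge> int m" "int (m * e) \<ge> int e" using n(2,3) by (simp_all only: of_nat_le_iff)
  qed
  define \<delta> where "\<delta> = \<beta> * ev x C - ev x A"
  have \<delta>: "ord_ge J \<delta>" using C(4) by (simp add: \<delta>_def J_def)
  have evA: "ev x A = \<beta> * ev x C - \<delta>" by (simp add: \<delta>_def)
  define D where "D = R\<^sup>2 * ((A \<circ>\<^sub>p F) * C + A * (C \<circ>\<^sub>p F)) - N0 * (C * (C \<circ>\<^sub>p F))"
  let ?C = "ev x C" and ?sC = "power_subst z m (ev x C)" and ?s\<delta> = "power_subst z m \<delta>"
  have "ev x D = (ev x R)\<^sup>2 * ((?s\<beta> * ?sC - ?s\<delta>) * ?C + (\<beta> * ?C - \<delta>) * ?sC) - (?s\<beta> + \<beta>) * (ev x R)\<^sup>2 * (?C * ?sC)"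
    unfolding D_def ev_diff ev_mult ev_add ev_power ev_pcompose_scales[OF F] evA fe[symmetric]
      power_subst_diff[OF z] power_subst_mult[OF z] ..
  also have "\<dots> = - ((ev x R)\<^sup>2 * (?s\<delta> * ?C + \<delta> * ?sC))"
    by (simp add: algebra_simps)
  finally have evD: "ev x D = - ((ev x R)\<^sup>2 * (?s\<delta> * ?C + \<delta> * ?sC))" .
  have oC: "ord_ge (- int e) ?C" using C(3) by (intro ord_ge_ev_degree) simp
  have osC: "ord_ge (int m * - int e) ?sC" by (rule ord_ge_power_subst[OF z oC])
  have oR: "ord_ge (- int m) ((ev x R)\<^sup>2)" using ord_ge_ev_degree[of "R\<^sup>2" m] dR by (simp add: ev_power)
  have "ord_ge (int m + 1) (?s\<delta> * ?C + \<delta> * ?sC)"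
  proof (rule ord_ge_add)
    have "0 \<le> 2 * int (m * e)" by simp
    then have "0 \<le> J" using J(1) by linarith
    then have "J \<le> int m * J" using mult_right_mono[of 1 "int m" J] m(1) by simp
    then show "ord_ge (int m + 1) (?s\<delta> * ?C)"
      using ord_ge_mult[OF ord_ge_power_subst[OF z \<delta>] oC] J by (elim ord_ge_mono) linarith
    show "ord_ge (int m + 1) (\<delta> * ?sC)"
    proof -
      have "int m * - int e = - int (m * e)" by simp
      then have "int m + 1 \<le> J + int m * - int e" using J by linarith
      then show ?thesis by (rule ord_ge_mono[OF ord_ge_mult[OF \<delta> osC]])
    qed
  qed
  from ord_ge_mult[OF oR this] have "ord_ge 1 (ev x D)" unfolding evD by (intro ord_ge_uminus) simp
  then have D0: "D = 0" by (rule ev_eq_0I[rotated]) simp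
  obtain g A0 B0 u v where g: "g \<noteq> 0" "A = g * A0" "C = g * B0" "u * A0 + v * B0 = 1"
    using reduce_to_coprime[OF disjI2[OF C(2)], of A] by metis
  have gF: "g \<circ>\<^sub>p F \<noteq> 0" using g(1) dF m pcompose_eq_0[of g F] by auto
  have B00: "B0 \<noteq> 0" using C(2) g by auto
  have "(g * (g \<circ>\<^sub>p F)) * (R\<^sup>2 * ((A0 \<circ>\<^sub>p F) * B0 + A0 * (B0 \<circ>\<^sub>p F))) = (g * (g \<circ>\<^sub>p F)) * (N0 * (B0 * (B0 \<circ>\<^sub>p F)))"
    using D0 by (simp add: D_def g(2,3) pcompose_mult algebra_simps)
  then have eq: "R\<^sup>2 * ((A0 \<circ>\<^sub>p F) * B0 + A0 * (B0 \<circ>\<^sub>p F)) = N0 * (B0 * (B0 \<circ>\<^sub>p F))"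
    by (rule mult_left_cancel[THEN iffD1, rotated]) (use g(1) gF in simp)
  have "(R\<^sup>2 * B0) * (A0 \<circ>\<^sub>p F) = (B0 \<circ>\<^sub>p F) * (N0 * B0 - R\<^sup>2 * A0)"
    using eq by (simp add: algebra_simps)
  then have "B0 \<circ>\<^sub>p F dvd (R\<^sup>2 * B0) * (A0 \<circ>\<^sub>p F)" by simp
  then have dvd: "B0 \<circ>\<^sub>p F dvd R\<^sup>2 * B0" by (rule dvd_of_pcompose_relation[OF g(4)])
  have "degree B0 * m \<le> (m - 1) + degree B0"
    using dvd_imp_degree_le[OF dvd] R0 B00 by (simp add: degree_pcompose dF degree_mult_eq dR)
  then have d1: "degree B0 \<le> 1"
  proof -
    obtain l where l: "m = Suc l" "l > 0" using m(1) by (cases m) auto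
    have "degree B0 * l \<le> 1 * l" using \<open>degree B0 * m \<le> (m - 1) + degree B0\<close> by (simp add: l)
    then show ?thesis using l by simp
  qed
  have "ev x g * (\<beta> * ev x B0 - ev x A0) = \<delta>"
    by (simp add: \<delta>_def g(2,3) ev_mult right_diff_distrib mult_ac)
  then have "ord_ge (J - fls_subdegree (ev x g)) (\<beta> * ev x B0 - ev x A0)"
    using \<delta> subdegree_ev(2)[OF g(1)] by (intro ord_ge_cancel) auto
  then have small: "ord_ge 2 (\<beta> * ev x B0 - ev x A0)"
    using subdegree_ev(1)[OF g(1)] J by (elim ord_ge_mono) linarith
  obtain b0 b1 where B0: "B0 = [:b0, b1:]"
  proof -
    have "B0 = [:coeff B0 0, coeff B0 1:]"
      using d1 by (intro poly_eqI) (auto simp: coeff_pCons coeff_eq_0 split: nat.split)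
    then show ?thesis using that by blast
  qed
  have evB0: "ev x B0 = fls_const b0 + fls_const b1 * x" by (simp add: B0 ev_pCons mult.commute)
  have \<beta>x: "ord_ge (1 + -1) (\<beta> * x)" "(\<beta> * x) $$ (1 + -1) = \<psi> $$ 1"
    using ord_ge_mult[OF beta_facts(1) ord_ge_x] nth_mult_ord_ge[OF beta_facts(1) ord_ge_x] by (simp_all add: beta_facts)
  have \<beta>B: "\<beta> * ev x B0 = fls_const b0 * \<beta> + fls_const b1 * (\<beta> * x)"
    by (simp add: evB0 distrib_left mult.left_commute mult.commute)
  have A0: "A0 = [:b1 * \<psi> $$ 1:]"
  proof -
    have o1: "ord_ge 1 (fls_const b0 * \<beta>)" by (intro ord_ge_cmult beta_facts)
    have "ord_ge (0 + 1) (fls_const b1 * (\<beta> * x) - fls_const (b1 * \<psi> $$ 1))"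
      using \<beta>x by (intro ord_ge_Suc ord_ge_diff ord_ge_cmult) simp_all
    then have o2: "ord_ge 1 (fls_const b1 * (\<beta> * x) - fls_const (b1 * \<psi> $$ 1))" by simp
    have "ord_ge 1 (fls_const b0 * \<beta> + (fls_const b1 * (\<beta> * x) - fls_const (b1 * \<psi> $$ 1)) - (\<beta> * ev x B0 - ev x A0))"
      by (rule ord_ge_diff[OF ord_ge_add[OF o1 o2] ord_ge_mono[OF small]]) simp
    then have "ord_ge 1 (ev x (A0 - [:b1 * \<psi> $$ 1:]))" by (simp add: \<beta>B ev_diff)
    then have "A0 - [:b1 * \<psi> $$ 1:] = 0" by (rule ev_eq_0I[rotated]) simp
    then show ?thesis by simp
  qed
  have b1: "b1 \<noteq> 0"
  proof
    assume b1: "b1 = 0"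
    have "(fls_const b0 * \<beta>) $$ 1 = 0" using small by (simp add: \<beta>B b1 A0 ord_ge_def)
    then have "b0 = 0" using \<alpha> by (simp add: beta_facts)
    then show False using B00 by (simp add: B0 b1)
  qed
  have B0F: "B0 \<circ>\<^sub>p F = [:b0:] + smult b1 (pCons 0 (R\<^sup>2))" by (simp add: B0 pcompose_pCons R(2))
  have b0: "b0 = 0"
  proof (rule ccontr)
    assume b0: "b0 \<noteq> 0"
    have "smult b0 B0 = (B0 \<circ>\<^sub>p F) * B0 - smult b1 (pCons 0 (R\<^sup>2 * B0))"
      by (simp add: B0F distrib_right)
    moreover have "smult b1 (pCons 0 (R\<^sup>2 * B0)) = (R\<^sup>2 * B0) * smult b1 [:0, 1:]" by simp
    ultimately have "B0 \<circ>\<^sub>p F dvd smult b0 B0" using dvd by (metis dvd_diff dvd_mult2 dvd_triv_left)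
    then have "B0 \<circ>\<^sub>p F dvd B0" using b0 by (simp add: dvd_smult_iff)
    then have "degree B0 * m \<le> degree B0" using dvd_imp_degree_le B00 degree_pcompose dF by metis
    then show False using m(1) b1 by (simp add: B0)
  qed
  have "smult (b1 * b1) (pCons 0 (R\<^sup>2) * smult (\<psi> $$ 1) (1 + R\<^sup>2)) = smult (b1 * b1) (pCons 0 (R\<^sup>2) * (pCons 0 N0))"
  proof -
    have "R\<^sup>2 * (smult (b1 * \<psi> $$ 1) (smult b1 [:0, 1:]) + smult (b1 * \<psi> $$ 1) (smult b1 (pCons 0 (R\<^sup>2))))
        = N0 * (smult b1 [:0, 1:] * smult b1 (pCons 0 (R\<^sup>2)))"
      using eq unfolding B0F by (simp add: A0 B0 b0 mult_ac)
    then show ?thesis by (simp add: distrib_left distrib_right smult_add_right mult_ac one_pCons)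
  qed
  then have "pCons 0 (R\<^sup>2) * smult (\<psi> $$ 1) (1 + R\<^sup>2) = pCons 0 (R\<^sup>2) * (pCons 0 N0)"
    using smult_eq_iff[THEN iffD1, of "b1 * b1" "b1 * b1"] b1 by fastforce
  then have main: "smult (\<psi> $$ 1) (1 + R\<^sup>2) = pCons 0 N0"
    by (rule mult_left_cancel[THEN iffD1, rotated]) (use R0 in simp)
  have "CHAR('a poly) = 2" using char by simp
  note p2 = char_2_identities[where ?'b = "'a poly", OF this] and n2 = char_2_of_nat_power2[where ?'b = "'a poly", OF this]
  have "N0 = pCons 0 (pderiv R) * (pCons 0 (pderiv R) + R) + ((of_nat k)\<^sup>2 + of_nat k) * R\<^sup>2"
    unfolding N0_def H_def p2(5) power_mult_distrib by (simp add: power2_eq_square distrib_left distrib_right mult_ac add_ac)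
  then have "N0 = pCons 0 (pderiv R) * (pCons 0 (pderiv R) + R)" by (simp only: n2 mult_zero_left add_0_right)
  then show ?thesis using that[OF R(2)] main by simp
qed

end

section \<open>Chebyshev polynomials\<close>

text \<open>
  The units of the ring of Laurent polynomials are monomials.
\<close>

lemma is_monom_of_mult_eq_monom:
  fixes A B :: "'b::field poly"
  assumes "A * B = monom c l" "c \<noteq> 0"
  obtains a i b j where "A = monom a i" "B = monom b j" "a * b = c" "i + j = l"
proof -
  have "\<exists>a i b j. A = monom a i \<and> B = monom b j" using assms(1)
  proof (induction l arbitrary: A B)
    case 0
    then have "A * B \<noteq> 0" using assms(2) by simp
    then have nz: "A \<noteq> 0" "B \<noteq> 0" by auto
    have "degree (A * B) = 0" using 0 by (simp add: monom_0)
    then have "degree A = 0" "degree B = 0" using nz by (simp_all add: degree_mult_eq)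
    then show ?case by (metis degree_eq_zeroE monom_0)
  next
    case (Suc l)
    have "coeff (A * B) 0 = 0" using Suc.prems by simp
    then have "coeff A 0 = 0 \<or> coeff B 0 = 0" by (simp add: coeff_mult)
    then show ?case
    proof
      assume "coeff A 0 = 0"
      then obtain A' where A: "A = pCons 0 A'" by (cases A) auto
      then have "A' * B = monom c l" using Suc.prems by (simp add: monom_Suc)
      from Suc.IH[OF this] show ?thesis unfolding A by (metis monom_Suc)
    next
      assume "coeff B 0 = 0"
      then obtain B' where B: "B = pCons 0 B'" by (cases B) auto
      then have "A * B' = monom c l" using Suc.prems by (simp add: monom_Suc)
      from Suc.IH[OF this] show ?thesis unfolding B by (metis monom_Suc)
    qed
  qed
  then obtain a i b j where ab: "A = monom a i" "B = monom b j" by blast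
  then have "monom (a * b) (i + j) = monom c l" using assms(1) by (simp add: mult_monom)
  then have "a * b = c \<and> i + j = l" using assms(2) by (metis coeff_monom degree_monom_eq monom_eq_0_iff)
  then show ?thesis using that ab by blast
qed

text \<open>
  An algebraically closed field is infinite, so polynomial identities may be checked pointwise away from zero.
\<close>

lemma poly_eqI_off_zero:
  fixes P Q :: "'b::alg_closed_field poly"
  assumes "\<And>v. v \<noteq> 0 \<Longrightarrow> poly P v = poly Q v" shows "P = Q"
proof (rule ccontr)
  assume "P \<noteq> Q"
  then have "pCons 0 (P - Q) \<noteq> 0" by simp
  then have "finite {v. poly (pCons 0 (P - Q)) v = 0}" by (rule poly_roots_finite)
  moreover have "{v. poly (pCons 0 (P - Q)) v = 0} = UNIV" using assms by fastforce
  moreover have "infinite (UNIV :: 'b set)"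
  proof
    assume fin: "finite (UNIV :: 'b set)"
    define p where "p = (\<Prod>a\<in>UNIV. [:- a, 1:]) + (1 :: 'b poly)"
    have v: "poly p v = 1" for v
    proof -
      have "(\<Prod>a\<in>UNIV. poly [:- a, 1:] v) = 0" using fin by (intro prod_zero) auto
      then show ?thesis by (simp add: p_def poly_prod)
    qed
    have "degree (\<Prod>a\<in>UNIV. [:- a, 1::'b:]) = card (UNIV :: 'b set)"
      by (subst degree_prod_eq_sum_degree) auto
    then have "degree p > 0" unfolding p_def
      using fin finite_UNIV_card_ge_0 by (subst degree_add_eq_left) auto
    then obtain v where "poly p v = 0" using alg_closed_imp_poly_has_root by blast
    then show False using v by simp
  qed
  ultimately show False by (simp only:)
qed

lemma exists_joukowski_preimage:
  fixes w :: "'b::alg_closed_field"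
  obtains v where "v \<noteq> 0" "v + inverse v = w"
proof -
  have "degree [:1, - w, 1:] > 0" by simp
  then obtain v where v: "poly [:1, - w, 1:] v = 0" using alg_closed_imp_poly_has_root by blast
  then have "v \<noteq> 0" by auto
  moreover from this v have "v + inverse v = w" by (simp add: field_simps)
  ultimately show ?thesis using that by blast
qed

lemma poly_eqI_joukowski:
  fixes P Q :: "'b::alg_closed_field poly"
  assumes "\<And>v. v \<noteq> 0 \<Longrightarrow> poly P (v + inverse v) = poly Q (v + inverse v)" shows "P = Q"
  by (rule poly_eqI_off_zero) (metis assms exists_joukowski_preimage)

lemma clear_denominators:
  fixes P :: "'b::field poly"
  assumes "degree P \<le> d"
  obtains Q where "\<And>v. v \<noteq> 0 \<Longrightarrow> poly Q v = v ^ d * poly P (v + inverse v)"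
proof -
  have "\<exists>Q. \<forall>v. v \<noteq> 0 \<longrightarrow> poly Q v = v ^ d * poly P (v + inverse v)" using assms
  proof (induction P arbitrary: d)
    case 0
    show ?case by (intro exI[of _ 0]) simp
  next
    case (pCons c P)
    show ?case
    proof (cases "P = 0")
      case True
      then show ?thesis by (intro exI[of _ "monom c d"]) (simp add: poly_monom)
    next
      case False
      then obtain d' where d: "d = Suc d'" "degree P \<le> d'" using pCons.prems by (cases d) auto
      obtain Q where Q: "\<forall>v. v \<noteq> 0 \<longrightarrow> poly Q v = v ^ d' * poly P (v + inverse v)"
        using pCons.IH[OF d(2)] by blast
      show ?thesis
      proof (intro exI[of _ "monom c d + [:1, 0, 1:] * Q"] allI impI)
        fix v :: 'b assume v: "v \<noteq> 0"
        have "v * (v + inverse v) = 1 + v * v" using v by (simp add: distrib_left)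
        then have "v ^ d * poly (pCons c P) (v + inverse v) = c * v ^ d + (1 + v * v) * (v ^ d' * poly P (v + inverse v))"
          unfolding d(1) by (simp add: distrib_left mult_ac)
        then show "poly (monom c d + [:1, 0, 1:] * Q) v = v ^ d * poly (pCons c P) (v + inverse v)"
          using Q v by (simp add: poly_monom distrib_left distrib_right mult_ac)
      qed
    qed
  qed
  then show ?thesis using that by blast
qed

lemma chebyshev_0: "chebyshev 0 = [:2 :: 'b::field:]"
proof (rule is_chebyshev_unique[OF is_chebyshev_chebyshev])
  have "to_fract [:2 :: 'b:] = 1 + 1"
    by (metis numeral_poly one_add_one to_fract_1 to_fract_add)
  then show "is_chebyshev 0 [:2 :: 'b:]"
    by (simp add: is_chebyshev_def poly_at_fract_pCons poly_at_fract_0)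
qed

lemma chebyshev_1: "chebyshev (Suc 0) = [:0, 1 :: 'b::field:]"
  by (rule is_chebyshev_unique[OF is_chebyshev_chebyshev])
    (simp add: is_chebyshev_def poly_at_fract_1 poly_at_fract_pCons pCons_one)

lemma chebyshev_rec: "chebyshev (Suc (Suc n)) = pCons 0 (chebyshev (Suc n)) - (chebyshev n :: 'b::field poly)"
proof (rule is_chebyshev_unique[OF is_chebyshev_chebyshev])
  show "is_chebyshev (Suc (Suc n)) (pCons 0 (chebyshev (Suc n)) - (chebyshev n :: 'b poly))"
    using is_chebyshev_chebyshev[of n, where ?'a = 'b] is_chebyshev_chebyshev[of "Suc n", where ?'a = 'b]
      fract_X_nonzero[where ?'a = 'b]
    by (simp add: is_chebyshev_def poly_at_fract_pCons poly_at_fract_diff field_simps)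
qed

text \<open>
  Specialisation of the defining identity in rational functions, recovered here through the three-term recursion.
\<close>

lemma poly_chebyshev:
  fixes v :: "'b::field"
  assumes v: "v \<noteq> 0" shows "poly (chebyshev n) (v + inverse v) = v ^ n + inverse v ^ n"
proof (induction n rule: induct_nat_012)
  case (ge2 n)
  have "(v + inverse v) * (v ^ Suc n + inverse v ^ Suc n) - (v ^ n + inverse v ^ n) =
    v ^ Suc (Suc n) + inverse v ^ Suc (Suc n)"
  proof -
    have "v * inverse v = 1" "inverse v * v = 1" using v by simp_all
    then have "v * inverse v ^ Suc n = inverse v ^ n" "inverse v * v ^ Suc n = v ^ n"
      by (simp_all only: power_Suc mult.assoc[symmetric] mult_1_left)
    then show ?thesis by (simp add: distrib_left distrib_right power_Suc[of _ "Suc n"] del: power_Suc)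
  qed
  then show ?case using ge2 by (simp add: chebyshev_rec)
qed (simp_all add: chebyshev_0 chebyshev_1)

lemma degree_chebyshev:
  "n > 0 \<Longrightarrow> degree (chebyshev n :: 'b::field poly) = n"
proof (induction n rule: induct_nat_012)
  case (ge2 n)
  have "degree (chebyshev n :: 'b poly) \<le> n"
    using ge2(1) by (cases "n = 0") (simp_all add: chebyshev_0)
  moreover have "degree (pCons 0 (chebyshev (Suc n)) :: 'b poly) = Suc (Suc n)"
    using ge2(2) by auto
  ultimately have "degree (pCons 0 (chebyshev (Suc n)) - chebyshev n :: 'b poly) = Suc (Suc n)"
    using degree_add_eq_left[of "- chebyshev n" "pCons 0 (chebyshev (Suc n)) :: 'b poly"] by simp
  then show ?case by (simp only: chebyshev_rec)
qed (simp_all add: chebyshev_1)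

lemma chebyshev_pcompose:
  "chebyshev M \<circ>\<^sub>p chebyshev N = (chebyshev (M * N) :: 'b::alg_closed_field poly)"
proof (rule poly_eqI_joukowski)
  fix v :: 'b assume v: "v \<noteq> 0"
  then have "poly (chebyshev M) (v ^ N + inverse (v ^ N)) = (v ^ N) ^ M + inverse (v ^ N) ^ M"
    by (intro poly_chebyshev) simp
  then show "poly (chebyshev M \<circ>\<^sub>p chebyshev N) (v + inverse v) = poly (chebyshev (M * N)) (v + inverse v)"
    using v by (simp add: poly_pcompose poly_chebyshev power_inverse mult.commute[of M] power_mult)
qed

lemma chebyshev_sign:
  assumes "c\<^sup>2 = (1::'b::alg_closed_field)"
  shows "chebyshev M \<circ>\<^sub>p [:0, c:] = smult (c ^ M) (chebyshev M)"
proof (rule poly_eqI_joukowski)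
  fix v :: 'b assume v: "v \<noteq> 0"
  have c0: "c \<noteq> 0" and ci: "inverse c = c" using assms by (auto simp: power2_eq_square intro: inverse_unique)
  have "poly (chebyshev M) (c * v + inverse (c * v)) = (c * v) ^ M + inverse (c * v) ^ M"
    using v c0 by (intro poly_chebyshev) simp
  then show "poly (chebyshev M \<circ>\<^sub>p [:0, c:]) (v + inverse v) = poly (smult (c ^ M) (chebyshev M)) (v + inverse v)"
    using v by (simp add: poly_pcompose poly_chebyshev ci power_mult_distrib distrib_left mult.commute)
qed

text \<open>
  With \<open>X = b (v + v\<^sup>-\<^sup>1)\<close> the equation becomes \<open>f\<^sup>2 - (v - v\<^sup>-\<^sup>1)\<^sup>2 g\<^sup>2 = 4\<close>, and it factors into
  \<open>f + (v - v\<^sup>-\<^sup>1) g\<close> and \<open>f - (v - v\<^sup>-\<^sup>1) g\<close>. Both factors are units of the Laurent polynomials, so their sum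
  \<open>2 f\<close> is a sum of two monomials. Invariance under \<open>v \<mapsto> v\<^sup>-\<^sup>1\<close> makes it \<open>2 \<epsilon> (v\<^sup>m + v\<^sup>-\<^sup>m)\<close>.
\<close>

theorem chebyshev_of_pell_equation:
  fixes F :: "'b::alg_closed_field poly"
  assumes m: "degree F = m" "m > 1" "of_nat m \<noteq> (0::'b)" and two: "(2::'b) \<noteq> 0" and b: "b \<noteq> 0"
    and eq: "smult ((of_nat m)\<^sup>2) ([:- 4 * b\<^sup>2, 0, 1:] \<circ>\<^sub>p F) = (pderiv F)\<^sup>2 * [:- 4 * b\<^sup>2, 0, 1:]"
  obtains \<epsilon> where "\<epsilon> \<in> {1, -1}" "smult (inverse b) (F \<circ>\<^sub>p [:0, b:]) = smult \<epsilon> (chebyshev m)"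
proof -
  define F1 where "F1 = smult (inverse b) (F \<circ>\<^sub>p [:0, b:])"
  define S where "S = smult (inverse (of_nat m)) (pderiv F \<circ>\<^sub>p [:0, b:])"
  have dF1: "degree F1 = m" using m b by (simp add: F1_def degree_pcompose)
  have dS: "degree S \<le> m - 1"
    using degree_pderiv_le[of F] m b by (simp add: S_def degree_pcompose)
  have pell: "(poly F1 (v + inverse v))\<^sup>2 - (v - inverse v)\<^sup>2 * (poly S (v + inverse v))\<^sup>2 = 4"
    if v: "v \<noteq> 0" for v
  proof -
    define w where "w = b * (v + inverse v)"
    have F1: "poly F1 (v + inverse v) = inverse b * poly F w"
      and S: "poly S (v + inverse v) = inverse (of_nat m) * poly (pderiv F) w"
      by (simp_all add: F1_def S_def poly_pcompose w_def mult.commute)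
    have "poly (smult ((of_nat m)\<^sup>2) ([:- 4 * b\<^sup>2, 0, 1:] \<circ>\<^sub>p F)) w = poly ((pderiv F)\<^sup>2 * [:- 4 * b\<^sup>2, 0, 1:]) w"
      by (simp only: eq)
    then have e: "(of_nat m)\<^sup>2 * ((poly F w)\<^sup>2 - 4 * b\<^sup>2) = (poly (pderiv F) w)\<^sup>2 * (w\<^sup>2 - 4 * b\<^sup>2)"
      by (simp add: poly_pcompose power2_eq_square algebra_simps)
    have "(v + inverse v)\<^sup>2 - 4 = (v - inverse v)\<^sup>2"
      using v by (simp add: power2_eq_square algebra_simps)
    then have w2: "w\<^sup>2 - 4 * b\<^sup>2 = b\<^sup>2 * (v - inverse v)\<^sup>2"
      by (simp add: w_def power_mult_distrib right_diff_distrib flip: \<open>(v + inverse v)\<^sup>2 - 4 = (v - inverse v)\<^sup>2\<close>)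
    have "(poly F w)\<^sup>2 - 4 * b\<^sup>2 = (inverse (of_nat m) * poly (pderiv F) w)\<^sup>2 * (b\<^sup>2 * (v - inverse v)\<^sup>2)"
      using e m(3) unfolding w2 by (simp add: field_simps power_mult_distrib)
    then have "(poly F w)\<^sup>2 = 4 * b\<^sup>2 + (poly S (v + inverse v))\<^sup>2 * (b\<^sup>2 * (v - inverse v)\<^sup>2)"
      unfolding S by (simp add: algebra_simps)
    then have "(inverse b)\<^sup>2 * (poly F w)\<^sup>2 = (inverse b)\<^sup>2 * b\<^sup>2 * (4 + (v - inverse v)\<^sup>2 * (poly S (v + inverse v))\<^sup>2)"
      by (simp add: distrib_left mult_ac)
    moreover have "(inverse b)\<^sup>2 * b\<^sup>2 = 1" using b by (simp flip: power_mult_distrib)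
    ultimately show ?thesis unfolding F1 by (simp add: power_mult_distrib)
  qed
  obtain QF where QF: "\<And>v. v \<noteq> 0 \<Longrightarrow> poly QF v = v ^ m * poly F1 (v + inverse v)"
    using clear_denominators[of F1 m] dF1 by blast
  obtain QS where QS: "\<And>v. v \<noteq> 0 \<Longrightarrow> poly QS v = v ^ (m - 1) * poly S (v + inverse v)"
    using clear_denominators[OF dS] by blast
  define A where "A = QF + [:-1, 0, 1:] * QS"
  define B where "B = QF - [:-1, 0, 1:] * QS"
  have AB: "poly A v = v ^ m * (poly F1 (v + inverse v) + (v - inverse v) * poly S (v + inverse v))"
     "poly B v = v ^ m * (poly F1 (v + inverse v) - (v - inverse v) * poly S (v + inverse v))" if v: "v \<noteq> 0" for v
  proof -
    have "v ^ m = v * v ^ (m - 1)" using m by (cases m) auto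
    moreover have "v * (v - inverse v) = v * v - 1" using v by (simp add: right_diff_distrib)
    ultimately have "v ^ m * ((v - inverse v) * poly S (v + inverse v)) = (v * v - 1) * poly QS v"
      using QS[OF v] by (metis mult.assoc mult.left_commute)
    then show "poly A v = v ^ m * (poly F1 (v + inverse v) + (v - inverse v) * poly S (v + inverse v))"
     "poly B v = v ^ m * (poly F1 (v + inverse v) - (v - inverse v) * poly S (v + inverse v))"
      using QF[OF v] by (simp_all add: A_def B_def distrib_left right_diff_distrib algebra_simps)
  qed
  have "A * B = monom 4 (2 * m)"
  proof (rule poly_eqI_off_zero)
    fix v :: 'b assume v: "v \<noteq> 0"
    have "poly A v * poly B v = (v ^ m * v ^ m) * ((poly F1 (v + inverse v))\<^sup>2 - (v - inverse v)\<^sup>2 * (poly S (v + inverse v))\<^sup>2)"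
      unfolding AB[OF v] by (simp add: power2_eq_square algebra_simps)
    then show "poly (A * B) v = poly (monom 4 (2 * m)) v"
      unfolding pell[OF v] by (simp add: poly_monom mult_2 power_add)
  qed
  moreover have four: "(4::'b) \<noteq> 0"
  proof -
    have "(4::'b) = 2 * 2" by simp
    then show ?thesis using two by (metis mult_eq_0_iff)
  qed
  ultimately obtain a i c j where ac: "A = monom a i" "B = monom c j" "a * c = 4" "i + j = 2 * m"
    by (rule is_monom_of_mult_eq_monom)
  have F1v: "2 * (v ^ m * poly F1 (v + inverse v)) = a * v ^ i + c * v ^ j" if v: "v \<noteq> 0" for v
  proof -
    have "poly A v + poly B v = 2 * (v ^ m * poly F1 (v + inverse v))"
      unfolding AB[OF v] by (simp add: algebra_simps)
    then show ?thesis by (simp add: ac poly_monom)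
  qed
  have sym: "a * v ^ i + c * v ^ j = a * v ^ j + c * v ^ i" if v: "v \<noteq> 0" for v
  proof -
    have "2 * (inverse v ^ m * poly F1 (v + inverse v)) = a * inverse v ^ i + c * inverse v ^ j"
      using F1v[of "inverse v"] v by (simp add: add.commute)
    then have "v ^ (2 * m) * (2 * (inverse v ^ m * poly F1 (v + inverse v))) = v ^ (2 * m) * (a * inverse v ^ i + c * inverse v ^ j)"
      by simp
    then have "2 * ((v ^ (2 * m) * inverse v ^ m) * poly F1 (v + inverse v))
        = a * (v ^ (2 * m) * inverse v ^ i) + c * (v ^ (2 * m) * inverse v ^ j)"
      by (simp only: distrib_left mult_ac)
    moreover have "v ^ (2 * m) * inverse v ^ m = v ^ m" using v by (simp add: mult_2 power_add power_inverse)
    moreover have "v ^ (2 * m) * inverse v ^ i = v ^ j" "v ^ (2 * m) * inverse v ^ j = v ^ i"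
      using v by (simp_all add: power_add power_inverse flip: ac(4))
    ultimately have "2 * (v ^ m * poly F1 (v + inverse v)) = a * v ^ j + c * v ^ i" by (simp only:)
    then show ?thesis using F1v[OF v] by simp
  qed
  have ac': "a = c \<or> i = j"
  proof (cases "i = j")
    case False
    have "monom a i + monom c j = monom a j + monom c i"
      by (rule poly_eqI_off_zero) (simp add: poly_monom sym)
    then have "coeff (monom a i + monom c j) i = coeff (monom a j + monom c i) i" by simp
    then show ?thesis using False by simp
  qed simp
  have ij: "i \<noteq> j"
  proof
    assume "i = j"
    then have "i = m" using ac(4) by simp
    then have "2 * poly F1 (v + inverse v) = a + c" if "v \<noteq> 0" for v
    proof -
      have "v ^ m * (2 * poly F1 (v + inverse v)) = v ^ m * (a + c)"
        using F1v[OF that] \<open>i = j\<close> \<open>i = m\<close> by (simp add: algebra_simps)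
      then show ?thesis using that by simp
    qed
    then have "smult 2 F1 = [:a + c:]" by (intro poly_eqI_joukowski) simp
    then have "degree (smult 2 F1) = 0" by simp
    then show False using two dF1 m by simp
  qed
  with ac' have ac2: "a = c" by simp
  define \<epsilon> where "\<epsilon> = a / 2"
  have "\<epsilon> * \<epsilon> = 1" using ac(3) two four by (simp add: \<epsilon>_def ac2)
  then have "(\<epsilon> - 1) * (\<epsilon> + 1) = 0" by (simp add: algebra_simps)
  then have \<epsilon>: "\<epsilon> \<in> {1, -1}" by (auto simp: add_eq_0_iff2)
  define n where "n = (if i < j then j - m else i - m)"
  have nij: "n > 0" "{i, j} = {m + n, m - n}" "n \<le> m" using ij ac(4) by (auto simp: n_def)
  have F1: "F1 = smult \<epsilon> (chebyshev n)"
  proof (rule poly_eqI_joukowski)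
    fix v :: 'b assume v: "v \<noteq> 0"
    have "v ^ i + v ^ j = v ^ (m + n) + v ^ (m - n)"
      using nij(2) ij by (auto simp: doubleton_eq_iff add.commute)
    also have "\<dots> = v ^ m * (v ^ n + inverse v ^ n)"
    proof -
      have "v ^ m = v ^ (m - n) * v ^ n" using nij(3) by (simp flip: power_add)
      then have "v ^ m * inverse v ^ n = v ^ (m - n)" using v by (simp add: power_inverse)
      then show ?thesis by (simp add: distrib_left power_add)
    qed
    finally have "2 * (v ^ m * poly F1 (v + inverse v)) = a * (v ^ m * (v ^ n + inverse v ^ n))"
      using F1v[OF v] by (simp add: ac2 distrib_left[symmetric])
    then have "v ^ m * (2 * poly F1 (v + inverse v)) = v ^ m * (a * (v ^ n + inverse v ^ n))"
      by (simp add: mult_ac)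
    then have "2 * poly F1 (v + inverse v) = a * (v ^ n + inverse v ^ n)" using v by simp
    then have "2 * poly F1 (v + inverse v) = a * poly (chebyshev n) (v + inverse v)" by (simp only: poly_chebyshev[OF v])
    moreover have "a = 2 * \<epsilon>" using two by (simp add: \<epsilon>_def)
    ultimately have "2 * poly F1 (v + inverse v) = 2 * poly (smult \<epsilon> (chebyshev n)) (v + inverse v)"
      by (simp only: poly_smult mult.assoc)
    then show "poly F1 (v + inverse v) = poly (smult \<epsilon> (chebyshev n)) (v + inverse v)"
      using two mult_left_cancel by blast
  qed
  have "\<epsilon> \<noteq> 0" using \<epsilon> by auto
  then have "n = m" using dF1 F1 degree_chebyshev[OF nij(1), where ?'b = 'b] by simp
  then show ?thesis using that[OF \<epsilon>] F1 by (simp add: F1_def)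
qed

text \<open>
  With \<open>X = b (v + v\<^sup>-\<^sup>1)\<close>, and with \<open>r, \<tau>\<close> for the values of \<open>R\<close> and \<open>X R'\<close>, the equation becomes
  \<open>(r + (1 + v) \<tau>) (v r + (1 + v) \<tau>) = v\<close>. Both factors are monomials in \<open>v\<close> up to a power of \<open>v\<close>, their sum is \<open>(1 + v) r\<close>,
  and its square is \<open>v (v + v\<^sup>-\<^sup>1) r\<^sup>2\<close>, that is \<open>v\<close> times the value of \<open>X R\<^sup>2\<close> divided by \<open>b\<close>.
\<close>

theorem chebyshev_of_artin_schreier_equation:
  fixes R :: "'b::alg_closed_field poly"
  assumes char: "CHAR('b) = 2" and b: "b \<noteq> 0" and R0: "R \<noteq> 0"
    and eq: "smult b (1 + R\<^sup>2) = pCons 0 (pCons 0 (pderiv R)) * (pCons 0 (pderiv R) + R)"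
  shows "smult (inverse b) (pCons 0 (R\<^sup>2) \<circ>\<^sub>p [:0, b:]) = chebyshev (degree (pCons 0 (R\<^sup>2)))"
proof -
  note c2 = char_2_identities[where ?'b = 'b, OF char]
  define F1 where "F1 = smult (inverse b) (pCons 0 (R\<^sup>2) \<circ>\<^sub>p [:0, b:])"
  define k where "k = degree R"
  define R1 where "R1 = R \<circ>\<^sub>p [:0, b:]"
  define T where "T = pCons 0 (pderiv R) \<circ>\<^sub>p [:0, b:]"
  have dR1: "degree R1 \<le> k" using b by (simp add: R1_def degree_pcompose k_def)
  have dT: "degree T \<le> k"
  proof (cases "pderiv R = 0")
    case False
    then have "degree R > 0" by (metis degree_eq_zeroE gr0I pderiv_pCons pderiv_0 pCons_0_0 add.right_neutral)
    then show ?thesis using degree_pderiv_le[of R] b False by (simp add: T_def degree_pcompose k_def)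
  qed (simp add: T_def)
  let ?r = "\<lambda>v. poly R1 (v + inverse v)" and ?t = "\<lambda>v. poly T (v + inverse v)"
  have rel: "1 + (?r v)\<^sup>2 = (v + inverse v) * (?t v * (?t v + ?r v))" for v
  proof -
    let ?w = "b * (v + inverse v)"
    have r: "?r v = poly R ?w" and t: "?t v = ?w * poly (pderiv R) ?w"
      by (simp_all add: R1_def T_def poly_pcompose mult.commute)
    have "poly (smult b (1 + R\<^sup>2)) ?w = poly (pCons 0 (pCons 0 (pderiv R)) * (pCons 0 (pderiv R) + R)) ?w"
      by (simp only: eq)
    then have "b * (1 + (?r v)\<^sup>2) = b * ((v + inverse v) * (?t v * (?t v + ?r v)))"
      unfolding r t by (simp add: mult_ac)
    then show ?thesis using b by simp
  qed
  obtain QR where QR: "\<And>v. v \<noteq> 0 \<Longrightarrow> poly QR v = v ^ k * ?r v" using clear_denominators[OF dR1] by blast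
  obtain QT where QT: "\<And>v. v \<noteq> 0 \<Longrightarrow> poly QT v = v ^ k * ?t v" using clear_denominators[OF dT] by blast
  define A where "A = QR + [:1, 1:] * QT"
  define B where "B = [:0, 1:] * QR + [:1, 1:] * QT"
  have AB: "poly A v = v ^ k * (?r v + (1 + v) * ?t v)" "poly B v = v ^ k * (v * ?r v + (1 + v) * ?t v)"
    if "v \<noteq> 0" for v
    using QR[OF that] QT[OF that] by (simp_all add: A_def B_def distrib_left distrib_right mult_ac)
  have sq: "(1 + v)\<^sup>2 = v * (v + inverse v)" if "v \<noteq> 0" for v :: 'b
    using that by (simp only: c2(5)) (simp add: distrib_left power2_eq_square)
  have "A * B = monom 1 (2 * k + 1)"
  proof (rule poly_eqI_off_zero)
    fix v :: 'b assume v: "v \<noteq> 0"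
    have "(r + p * t) * (v * r + p * t) = v * r\<^sup>2 + (p\<^sup>2 * t) * (t + r) + ((v + 1) * p + p\<^sup>2) * (r * t)" for r t p
    proof -
      have "v * r\<^sup>2 + (p\<^sup>2 * t) * (t + r) + ((v + 1) * p + p\<^sup>2) * (r * t)
          = (r + p * t) * (v * r + p * t) + (p\<^sup>2 * t * r + p\<^sup>2 * t * r)"
        by (simp add: power2_eq_square distrib_left distrib_right mult_ac add_ac)
      then show ?thesis by (simp only: c2(1) add_0_right)
    qed
    from this[of "?r v" "1 + v" "?t v"]
    have "(?r v + (1 + v) * ?t v) * (v * ?r v + (1 + v) * ?t v)
       = v * (?r v)\<^sup>2 + ((1 + v)\<^sup>2 * ?t v) * (?t v + ?r v) + ((1 + v)\<^sup>2 + (1 + v)\<^sup>2) * (?r v * ?t v)"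
      by (simp add: power2_eq_square add.commute)
    also have "\<dots> = v * (?r v)\<^sup>2 + v * ((v + inverse v) * (?t v * (?t v + ?r v)))"
      unfolding c2(1) sq[OF v] by (simp add: mult_ac)
    also have "\<dots> = v * (?r v)\<^sup>2 + v * (1 + (?r v)\<^sup>2)" by (simp only: rel)
    also have "\<dots> = v + (v * (?r v)\<^sup>2 + v * (?r v)\<^sup>2)" by (simp add: distrib_left add_ac)
    also have "\<dots> = v" by (simp only: c2(1) add_0_right)
    finally have *: "(?r v + (1 + v) * ?t v) * (v * ?r v + (1 + v) * ?t v) = v" .
    have "poly (A * B) v = (v ^ k * v ^ k) * ((?r v + (1 + v) * ?t v) * (v * ?r v + (1 + v) * ?t v))"
      by (simp only: poly_mult AB[OF v] mult_ac)
    then show "poly (A * B) v = poly (monom 1 (2 * k + 1)) v"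
      unfolding * by (simp only: poly_monom mult_2 power_add power_one_right mult_1_left)
  qed
  then obtain a i c j where ac: "A = monom a i" "B = monom c j" "a * c = 1" "i + j = 2 * k + 1"
    by (rule is_monom_of_mult_eq_monom) simp
  have ij: "i \<noteq> j" using ac(4) by presburger
  have F1v: "v ^ (2 * k + 1) * poly F1 (v + inverse v) = a\<^sup>2 * v ^ (2 * i) + c\<^sup>2 * v ^ (2 * j)" if v: "v \<noteq> 0" for v
  proof -
    have "poly A v + poly B v = v ^ k * ((1 + v) * ?r v) + (v ^ k * ((1 + v) * ?t v) + v ^ k * ((1 + v) * ?t v))"
      unfolding AB[OF v] by (simp add: algebra_simps)
    then have "a * v ^ i + c * v ^ j = v ^ k * ((1 + v) * ?r v)"
      by (simp add: c2(1) ac poly_monom)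
    then have "(a * v ^ i)\<^sup>2 + (c * v ^ j)\<^sup>2 = (v ^ k * ((1 + v) * ?r v))\<^sup>2" by (simp only: c2(5)[symmetric])
    also have "\<dots> = (v ^ k)\<^sup>2 * ((1 + v)\<^sup>2 * (?r v)\<^sup>2)" by (simp add: power_mult_distrib)
    also have "\<dots> = (v ^ k * v ^ k * v) * ((v + inverse v) * (?r v)\<^sup>2)"
      unfolding sq[OF v] by (simp only: power2_eq_square mult_ac)
    also have "v ^ k * v ^ k * v = v ^ (2 * k + 1)" by (simp only: mult_2 power_add power_one_right)
    also have "(v + inverse v) * (?r v)\<^sup>2 = poly F1 (v + inverse v)"
      using b by (simp add: F1_def R1_def poly_pcompose mult.commute mult.assoc)
    finally show ?thesis by (simp add: power_mult_distrib mult.commute flip: power_mult)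
  qed
  have "monom (a\<^sup>2) (2 * i) + monom (c\<^sup>2) (2 * j) = monom (a\<^sup>2) (2 * j) + monom (c\<^sup>2) (2 * i)"
  proof (rule poly_eqI_off_zero)
    fix v :: 'b assume v: "v \<noteq> 0"
    let ?K = "2 * k + 1"
    have "inverse v ^ ?K * poly F1 (v + inverse v) = a\<^sup>2 * inverse v ^ (2 * i) + c\<^sup>2 * inverse v ^ (2 * j)"
      using F1v[of "inverse v"] v by (simp only: inverse_inverse_eq add.commute[of "inverse v"]) simp
    then have "v ^ (2 * ?K) * (inverse v ^ ?K * poly F1 (v + inverse v)) =
       a\<^sup>2 * (v ^ (2 * ?K) * inverse v ^ (2 * i)) + c\<^sup>2 * (v ^ (2 * ?K) * inverse v ^ (2 * j))"
      by (simp only: distrib_left mult_ac)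
    moreover have "v ^ (2 * ?K) * inverse v ^ ?K = v ^ ?K"
    proof -
      have "v ^ ?K * inverse v ^ ?K = 1" using v by (simp only: power_mult_distrib[symmetric] right_inverse power_one not_False_eq_True)
      then show ?thesis by (simp only: mult_2[of ?K] power_add[of v ?K ?K] mult.assoc mult_1_right)
    qed
    moreover have "v ^ (2 * ?K) * inverse v ^ (2 * i) = v ^ (2 * j)" "v ^ (2 * ?K) * inverse v ^ (2 * j) = v ^ (2 * i)"
      unfolding ac(4)[symmetric] distrib_left power_add using v by (simp_all add: power_inverse)
    ultimately have "v ^ ?K * poly F1 (v + inverse v) = a\<^sup>2 * v ^ (2 * j) + c\<^sup>2 * v ^ (2 * i)"
      by (simp only: mult.assoc[symmetric])
    then show "poly (monom (a\<^sup>2) (2 * i) + monom (c\<^sup>2) (2 * j)) v = poly (monom (a\<^sup>2) (2 * j) + monom (c\<^sup>2) (2 * i)) v"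
      using F1v[OF v] by (simp add: poly_monom)
  qed
  then have "coeff (monom (a\<^sup>2) (2 * i) + monom (c\<^sup>2) (2 * j)) (2 * i) = coeff (monom (a\<^sup>2) (2 * j) + monom (c\<^sup>2) (2 * i)) (2 * i)"
    by simp
  then have ac2: "a\<^sup>2 = c\<^sup>2" using ij by simp
  have "(a\<^sup>2 + 1)\<^sup>2 = 0"
  proof -
    have "(a\<^sup>2)\<^sup>2 = a\<^sup>2 * c\<^sup>2" by (simp only: ac2 power2_eq_square[of "c\<^sup>2"])
    also have "\<dots> = 1" using ac(3) by (metis power_mult_distrib power_one)
    finally show ?thesis by (simp only: c2(5) power_one c2(1))
  qed
  then have "a\<^sup>2 + 1 = 0" by simp
  then have a1: "a\<^sup>2 = 1" by (metis c2(3) add_eq_0_iff2)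
  define n where "n = (if i < j then j - i else i - j)"
  have n: "n > 0" using ij by (auto simp: n_def)
  have "F1 = chebyshev n"
  proof (rule poly_eqI_joukowski)
    fix v :: 'b assume v: "v \<noteq> 0"
    have "v ^ (i + j) * poly F1 (v + inverse v) = v ^ (2 * i) + v ^ (2 * j)"
      using F1v[OF v] by (simp only: ac(4) a1 ac2[symmetric] mult_1_left)
    also have "\<dots> = v ^ (i + j) * (v ^ n + inverse v ^ n)"
    proof -
      have *: "v ^ (2 * p) + v ^ (2 * q) = v ^ (p + q) * (v ^ (q - p) + inverse v ^ (q - p))" if "p < q" for p q
      proof -
        define r where "r = q - p"
        have r: "q = p + r" using that by (simp add: r_def)
        have "v ^ r * inverse v ^ r = 1" using v by (simp add: power_inverse)
        have pow: "v ^ (2 * p) = v ^ p * v ^ p" "v ^ (2 * (p + r)) = v ^ p * (v ^ p * v ^ r) * v ^ r"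
          "v ^ (p + (p + r)) = v ^ p * (v ^ p * v ^ r)" by (simp_all only: mult_2 power_add mult.assoc mult.left_commute)
        have "v ^ p * (v ^ p * v ^ r) * inverse v ^ r = v ^ p * v ^ p * (v ^ r * inverse v ^ r)" by (simp only: mult_ac)
        also have "\<dots> = v ^ p * v ^ p" by (simp only: \<open>v ^ r * inverse v ^ r = 1\<close> mult_1_right)
        finally have e: "v ^ p * (v ^ p * v ^ r) * inverse v ^ r = v ^ p * v ^ p" .
        show ?thesis unfolding r add_diff_cancel_left' pow distrib_left[of "v ^ p * (v ^ p * v ^ r)"] e by (rule add.commute)
      qed
      show ?thesis
      proof (cases "i < j")
        case True
        then show ?thesis using *[OF True] by (simp only: n_def if_True)
      next
        case False
        then have "j < i" using ij by simp
        from *[OF this] show ?thesis using False by (simp only: n_def if_False add.commute[of j i] add.commute[of "v ^ (2 * j)"])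
      qed
    qed
    finally show "poly F1 (v + inverse v) = poly (chebyshev n) (v + inverse v)"
      using v by (simp add: poly_chebyshev)
  qed
  moreover have "degree F1 = degree (pCons 0 (R\<^sup>2))" using b by (simp only: F1_def) (simp add: degree_pcompose)
  ultimately show ?thesis using degree_chebyshev[OF n, where ?'b = 'b] by (simp add: F1_def)
qed

section \<open>From standard forms to relations and back\<close>

lemma linear_eq_monom: "[:0, c:] = monom c 1"
  by (simp add: monom_Suc monom_0)

lemma linear_pcompose: "[:0, c:] \<circ>\<^sub>p P = smult c P"
  by (simp add: pcompose_pCons)

lemma comp_pow_pcompose_comp_pow: "comp_pow H i \<circ>\<^sub>p comp_pow H j = comp_pow H (i + j)"
  by (induction i) (simp_all add: comp_pow_def pcompose_X_left flip: pcompose_assoc)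

text \<open>
  Suppose that polynomials \<open>Q\<^sub>N\<close> compose like the powers \<open>X\<^sup>N\<close>, also with respect to constants \<open>c\<close> with \<open>c\<^sup>s = 1\<close>.
  Then a word in \<open>\<alpha> Q\<^sub>m\<close> and \<open>\<beta> Q\<^sub>n\<close> evaluates to \<open>c Q\<^sub>N\<close>, and the same word in \<open>\<alpha> X\<^sup>m\<close> and \<open>\<beta> X\<^sup>n\<close> to \<open>c X\<^sup>N\<close>
  with the same \<open>c\<close> and \<open>N\<close>. The predicate \<open>D\<close> collects the indices for which the family is defined.
\<close>

lemma same_relations_of_semigroup_family:
  fixes Q :: "nat \<Rightarrow> 'b::idom poly"
  assumes D: "D m" "D n" "D 1" "\<And>M N. D M \<Longrightarrow> D N \<Longrightarrow> D (M * N)"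
    and Q1: "Q 1 = [:0, 1:]" and QQ: "\<And>M N. D M \<Longrightarrow> D N \<Longrightarrow> Q M \<circ>\<^sub>p Q N = Q (M * N)"
    and Qc: "\<And>M c. D M \<Longrightarrow> c ^ s = 1 \<Longrightarrow> Q M \<circ>\<^sub>p [:0, c:] = smult (c ^ M) (Q M)"
    and deg: "\<And>M. D M \<Longrightarrow> degree (Q M) = M" "\<And>M. D M \<Longrightarrow> Q M \<noteq> 0"
    and s: "s > 0" and \<alpha>\<beta>: "\<alpha> ^ s = 1" "\<beta> ^ s = 1"
  shows "same_relations (smult \<alpha> (Q m)) (smult \<beta> (Q n)) (monom \<alpha> m) (monom \<beta> n)"
proof -
  let ?w = "comp_word (smult \<alpha> (Q m)) (smult \<beta> (Q n))" and ?w' = "comp_word (monom \<alpha> m) (monom \<beta> n)"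
  have word: "\<exists>c N. c ^ s = 1 \<and> D N \<and> ?w w = smult c (Q N) \<and> ?w' w = monom c N" for w
  proof (induction w)
    case Nil
    show ?case using D(3) Q1 by (intro exI[of _ 1]) (auto simp: linear_eq_monom)
  next
    case (Cons l w)
    then obtain c N where c: "c ^ s = 1" "D N" "?w w = smult c (Q N)" "?w' w = monom c N" by blast
    define a M where "a = (case l of LetterF \<Rightarrow> \<alpha> | LetterG \<Rightarrow> \<beta>)" and "M = (case l of LetterF \<Rightarrow> m | LetterG \<Rightarrow> n)"
    have aM: "a ^ s = 1" "D M" using \<alpha>\<beta> D by (cases l; simp add: a_def M_def)+
    have l: "(case l of LetterF \<Rightarrow> smult \<alpha> (Q m) | LetterG \<Rightarrow> smult \<beta> (Q n)) = smult a (Q M)"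
      "(case l of LetterF \<Rightarrow> monom \<alpha> m | LetterG \<Rightarrow> monom \<beta> n) = monom a M"
      by (cases l; simp add: a_def M_def)+
    have "smult a (Q M) \<circ>\<^sub>p smult c (Q N) = smult (a * c ^ M) (Q (M * N))"
    proof -
      have "smult a (Q M) \<circ>\<^sub>p smult c (Q N) = smult a ((Q M \<circ>\<^sub>p [:0, c:]) \<circ>\<^sub>p Q N)"
        by (simp only: pcompose_smult linear_pcompose[symmetric] pcompose_assoc)
      also have "\<dots> = smult a (smult (c ^ M) (Q M \<circ>\<^sub>p Q N))" by (simp only: Qc[OF aM(2) c(1)] pcompose_smult)
      finally show ?thesis by (simp add: QQ[OF aM(2) c(2)])
    qed
    moreover have "(a * c ^ M) ^ s = 1"
      using aM c(1) by (metis mult_1 power_mult_distrib power_mult mult.commute power_one)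
    moreover have "monom a M \<circ>\<^sub>p monom c N = monom (a * c ^ M) (M * N)" by (rule monom_pcompose_monom)
    ultimately show ?case using D(4)[OF aM(2) c(2)]
      by (intro exI[of _ "a * c ^ M"] exI[of _ "M * N"]) (simp add: comp_word_Cons l c)
  qed
  show ?thesis unfolding same_relations_def
  proof (intro allI impI)
    fix v w
    obtain c N where c: "c ^ s = 1" "D N" "?w v = smult c (Q N)" "?w' v = monom c N" using word by blast
    obtain d M where d: "d ^ s = 1" "D M" "?w w = smult d (Q M)" "?w' w = monom d M" using word by blast
    have cd: "c \<noteq> 0" "d \<noteq> 0" using c d s by (auto simp: power_0_left)
    have "smult c (Q N) = smult d (Q M) \<longleftrightarrow> N = M \<and> c = d"
    proof
      assume e: "smult c (Q N) = smult d (Q M)"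
      then have "degree (smult c (Q N)) = degree (smult d (Q M))" by simp
      then have NM: "N = M" using cd deg c d by simp
      moreover have "c * lead_coeff (Q N) = d * lead_coeff (Q N)"
        using arg_cong[OF e, of "\<lambda>P. coeff P N"] deg(1)[OF c(2)] NM by simp
      ultimately show "N = M \<and> c = d" using deg(2)[OF c(2)] by simp
    qed auto
    moreover have "monom c N = monom d M \<longleftrightarrow> N = M \<and> c = d"
      using cd by (metis degree_monom_eq lead_coeff_monom)
    ultimately show "?w v = ?w w \<longleftrightarrow> ?w' v = ?w' w" by (simp only: c d)
  qed
qed

lemma same_relations_chebyshev:
  fixes \<alpha> \<beta> :: "'b::alg_closed_field"
  assumes "\<alpha>\<^sup>2 = 1" "\<beta>\<^sup>2 = 1" "m > 0" "n > 0"
  shows "same_relations (smult \<alpha> (chebyshev m)) (smult \<beta> (chebyshev n)) (monom \<alpha> m) (monom \<beta> n)"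
proof (rule same_relations_of_semigroup_family[where D = "\<lambda>N. N > 0" and s = 2])
  show "chebyshev M \<noteq> (0 :: 'b poly)" if "M > 0" for M
    using degree_chebyshev[OF that, where ?'b = 'b] that by auto
  show "chebyshev 1 = ([:0, 1:] :: 'b poly)" using chebyshev_1 by simp
qed (use assms in \<open>simp_all add: chebyshev_1 chebyshev_pcompose chebyshev_sign degree_chebyshev flip: One_nat_def\<close>)

text \<open>
  The family is indexed by the powers of \<open>h = degree H\<close>. It is compatible with constants because \<open>h \<equiv> r\<close> modulo \<open>s\<close>
  gives \<open>H(c X) = c\<^sup>r H(X) = c\<^sup>h H(X)\<close>.
\<close>

lemma same_relations_iterates:
  fixes C :: "'b::idom poly"
  assumes H: "H = monom 1 r * (C \<circ>\<^sub>p monom 1 s)" "degree H > 1" and s: "s > 0"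
    and \<alpha>\<beta>: "\<alpha> ^ s = 1" "\<beta> ^ s = 1"
  shows "same_relations (smult \<alpha> (comp_pow H i)) (smult \<beta> (comp_pow H j))
    (monom \<alpha> (degree H ^ i)) (monom \<beta> (degree H ^ j))"
proof -
  define h where "h = degree H"
  have h: "h > 1" "h = r + s * degree C"
  proof -
    have "C \<circ>\<^sub>p monom 1 s \<noteq> 0" using H by auto
    then show "h > 1" "h = r + s * degree C"
      using H unfolding h_def by (simp_all add: degree_mult_eq degree_monom_eq degree_pcompose)
  qed
  have Hc: "H \<circ>\<^sub>p [:0, c:] = smult (c ^ h) H" if "c ^ s = 1" for c
  proof -
    have "monom 1 r \<circ>\<^sub>p [:0, c:] = smult (c ^ r) (monom 1 r)"
      unfolding linear_eq_monom monom_pcompose_monom by (simp add: smult_monom)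
    moreover have "(C \<circ>\<^sub>p monom 1 s) \<circ>\<^sub>p [:0, c:] = C \<circ>\<^sub>p monom 1 s"
      unfolding linear_eq_monom pcompose_assoc[symmetric] monom_pcompose_monom by (simp add: that)
    moreover have "c ^ h = c ^ r" by (simp add: h(2) power_add power_mult that)
    ultimately show ?thesis by (simp add: H(1) pcompose_mult)
  qed
  have pow_c: "comp_pow H k \<circ>\<^sub>p [:0, c:] = smult (c ^ (h ^ k)) (comp_pow H k)" if c: "c ^ s = 1" for c k
  proof (induction k)
    case 0
    then show ?case by (simp add: comp_pow_def pcompose_X_left)
  next
    case (Suc k)
    have c': "(c ^ (h ^ k)) ^ s = 1" using c by (metis power_mult mult.commute power_one)
    have "comp_pow H (Suc k) \<circ>\<^sub>p [:0, c:] = H \<circ>\<^sub>p (comp_pow H k \<circ>\<^sub>p [:0, c:])"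
      by (simp add: comp_pow_def pcompose_assoc)
    also have "\<dots> = (H \<circ>\<^sub>p [:0, c ^ (h ^ k):]) \<circ>\<^sub>p comp_pow H k"
      by (simp only: Suc linear_pcompose[symmetric] pcompose_assoc)
    also have "\<dots> = smult (c ^ (h ^ Suc k)) (comp_pow H (Suc k))"
      by (simp only: Hc[OF c'] pcompose_smult) (simp add: comp_pow_def mult.commute flip: power_mult)
    finally show ?case .
  qed
  have deg_pow: "degree (comp_pow H k) = h ^ k" for k
    by (induction k) (simp_all add: comp_pow_def degree_pcompose h_def)
  \<comment> \<open>Indexing by the degree \<open>h\<^sup>k\<close> instead of \<open>k\<close> fits the family lemma; \<open>k\<close> is determined because \<open>h > 1\<close>.\<close>
  define Q where "Q N = comp_pow H (SOME k. N = h ^ k)" for N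
  have Q: "Q (h ^ k) = comp_pow H k" for k using h(1) by (simp add: Q_def)
  have "same_relations (smult \<alpha> (Q (h ^ i))) (smult \<beta> (Q (h ^ j))) (monom \<alpha> (h ^ i)) (monom \<beta> (h ^ j))"
  proof (rule same_relations_of_semigroup_family[where D = "\<lambda>N. \<exists>k. N = h ^ k" and s = s])
    show "\<exists>k. 1 = h ^ k" by (rule exI[of _ 0]) simp
    show "\<exists>k. M * N = h ^ k" if "\<exists>k. M = h ^ k" "\<exists>k. N = h ^ k" for M N
      using that power_add[of h] by metis
    show "Q 1 = [:0, 1:]" using Q[of 0] by (simp add: comp_pow_def)
    show "Q M \<circ>\<^sub>p Q N = Q (M * N)" if "\<exists>k. M = h ^ k" "\<exists>k. N = h ^ k" for M N
      using that by (auto simp: Q comp_pow_pcompose_comp_pow simp flip: power_add)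
    show "Q M \<circ>\<^sub>p [:0, c:] = smult (c ^ M) (Q M)" if "\<exists>k. M = h ^ k" "c ^ s = 1" for M c
      using that pow_c by (auto simp: Q)
    show "degree (Q M) = M" if "\<exists>k. M = h ^ k" for M using that by (auto simp: Q deg_pow)
    show "Q M \<noteq> 0" if "\<exists>k. M = h ^ k" for M
    proof -
      from that obtain k where k: "M = h ^ k" by blast
      have "degree (Q M) \<noteq> 0 \<or> k = 0" using h(1) by (auto simp: k Q deg_pow)
      then show ?thesis using Q[of 0] by (auto simp: k comp_pow_def)
    qed
  qed (use s \<alpha>\<beta> in auto)
  then show ?thesis by (simp only: Q h_def[symmetric])
qed

lemma is_root_of_unity_mult:
  fixes a b :: "'b::field"
  assumes "is_root_of_unity a" "is_root_of_unity b" shows "is_root_of_unity (a * b)"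
proof -
  obtain k l where kl: "k > 0" "a ^ k = 1" "l > 0" "b ^ l = 1" using assms by (auto simp: is_root_of_unity_def)
  have "(a * b) ^ (k * l) = (a ^ k) ^ l * (b ^ l) ^ k"
    by (simp add: power_mult_distrib mult.commute[of k] flip: power_mult)
  then show ?thesis using kl by (auto simp: is_root_of_unity_def intro!: exI[of _ "k * l"])
qed

text \<open>
  Conjugation by \<open>b X\<close> with \<open>b\<^sup>m\<^sup>-\<^sup>1 = \<alpha>\<^sup>-\<^sup>1\<close>.
\<close>

lemma rescale_monomial_pair:
  fixes \<alpha> \<beta> :: "'b::alg_closed_field"
  assumes m: "m > 1" and n: "n > 0" and \<alpha>: "is_root_of_unity \<alpha>" and \<beta>: "is_root_of_unity \<beta>"
  obtains \<gamma> :: 'b where "is_root_of_unity \<gamma>" "same_relations (monom \<alpha> m) (monom \<beta> n) (monom 1 m) (monom \<gamma> n)"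
proof -
  obtain k where k: "k > 0" "\<alpha> ^ k = 1" using \<alpha> by (auto simp: is_root_of_unity_def)
  then have \<alpha>0: "\<alpha> \<noteq> 0" by (auto simp: power_0_left)
  obtain b where b: "b ^ (m - 1) = inverse \<alpha>" using nth_root_exists[of "m - 1" "inverse \<alpha>"] m by auto
  have b0: "b \<noteq> 0" using b \<alpha>0 m by (auto simp: power_0_left)
  have "b ^ ((m - 1) * k) = 1" by (simp only: power_mult b power_inverse k inverse_1)
  then have rb: "is_root_of_unity b" using m k by (auto simp: is_root_of_unity_def intro!: exI[of _ "(m - 1) * k"])
  have pow: "is_root_of_unity (b ^ i)" for i
  proof (induction i)
    case 0
    then show ?case by (auto simp: is_root_of_unity_def)
  next
    case (Suc i)
    then show ?case using is_root_of_unity_mult[OF rb] by simp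
  qed
  have inv: "[:0, b:] \<circ>\<^sub>p [:0, inverse b:] = [:0, 1:]" "[:0, inverse b:] \<circ>\<^sub>p [:0, b:] = [:0, 1:]"
    using b0 by (simp_all add: linear_pcompose)
  have conj: "[:0, inverse b:] \<circ>\<^sub>p monom c N \<circ>\<^sub>p [:0, b:] = monom (c * b ^ (N - 1)) N" if "N > 0" for c N
  proof -
    have "inverse b * b ^ N = b ^ (N - 1)" using b0 that by (cases N) simp_all
    then show ?thesis
      unfolding linear_eq_monom monom_pcompose_monom by (simp add: mult_ac)
  qed
  have "[:0, inverse b:] \<circ>\<^sub>p monom \<alpha> m \<circ>\<^sub>p [:0, b:] = monom (\<alpha> * b ^ (m - 1)) m"
    by (rule conj) (use m in simp)
  also have "\<alpha> * b ^ (m - 1) = 1" by (simp only: b right_inverse[OF \<alpha>0])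
  finally have "same_relations (monom \<alpha> m) (monom \<beta> n) (monom 1 m) (monom (\<beta> * b ^ (n - 1)) n)"
    using same_relations_conj[OF inv, of "monom \<alpha> m" "monom \<beta> n"] conj[OF n] by (simp only:)
  then show ?thesis using that is_root_of_unity_mult[OF \<beta> pow] by blast
qed

definition standard_pair :: "nat \<Rightarrow> nat \<Rightarrow> 'a::field poly \<Rightarrow> 'a poly \<Rightarrow> bool" where
  "standard_pair m n F' G' \<longleftrightarrow>
    (\<exists>\<alpha>. is_root_of_unity \<alpha> \<and> F' = monom 1 m \<and> G' = monom \<alpha> n) \<or>
    (\<exists>\<alpha>\<in>{1, -1}. \<exists>\<beta>\<in>{1, -1}. F' = smult \<alpha> (chebyshev m) \<and> G' = smult \<beta> (chebyshev n)) \<or>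
    (\<exists>i j r s :: nat. \<exists>C H :: 'a poly. \<exists>\<alpha> \<beta> :: 'a.
       i > 0 \<and> j > 0 \<and> s > 0 \<and> H = monom 1 r * (C \<circ>\<^sub>p monom 1 s) \<and>
       \<alpha> \<noteq> 0 \<and> \<beta> \<noteq> 0 \<and> \<alpha> ^ s = 1 \<and> \<beta> ^ s = 1 \<and>
       F' = smult \<alpha> (comp_pow H i) \<and> G' = smult \<beta> (comp_pow H j))"

lemma same_relations_of_standard_pair:
  fixes F G :: "'b::alg_closed_field poly"
  assumes deg: "degree F = m" "degree G = n" "m > 1" "n > 1" and st: "standard_pair m n F G"
  obtains \<gamma> :: 'b where "is_root_of_unity \<gamma>" "same_relations F G (monom 1 m) (monom \<gamma> n)"
proof -
  note result = that
  have via: thesis if "same_relations F G (monom \<alpha> m) (monom \<beta> n)" "s > 0" "\<alpha> ^ s = 1" "\<beta> ^ s = 1" for \<alpha> \<beta> :: 'b and s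
  proof -
    have "is_root_of_unity \<alpha>" "is_root_of_unity \<beta>" using that(2-4) by (auto simp: is_root_of_unity_def)
    from rescale_monomial_pair[OF deg(3) _ this, of n] deg(4) obtain \<gamma> :: 'b where \<gamma>:
      "is_root_of_unity \<gamma>" "same_relations (monom \<alpha> m) (monom \<beta> n) (monom 1 m) (monom \<gamma> n)" by auto
    show thesis by (rule result[OF \<gamma>(1) same_relations_trans[OF that(1) \<gamma>(2)]])
  qed
  from st show thesis unfolding standard_pair_def
  proof (elim disjE)
    assume "\<exists>\<alpha>. is_root_of_unity \<alpha> \<and> F = monom 1 m \<and> G = monom \<alpha> n"
    then show thesis using that by (auto simp: same_relations_def)
  next
    assume "\<exists>\<alpha>\<in>{1, -1}. \<exists>\<beta>\<in>{1, -1}. F = smult \<alpha> (chebyshev m) \<and> G = smult \<beta> (chebyshev n)"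
    then obtain \<alpha> \<beta> :: 'b where *: "\<alpha>\<^sup>2 = 1" "\<beta>\<^sup>2 = 1" "F = smult \<alpha> (chebyshev m)" "G = smult \<beta> (chebyshev n)"
      by (metis insertE singletonD power2_minus power_one)
    show thesis by (rule via[of \<alpha> \<beta> 2]) (use * deg same_relations_chebyshev[OF *(1,2)] in auto)
  next
    assume "\<exists>i j r s :: nat. \<exists>C H :: 'b poly. \<exists>\<alpha> \<beta> :: 'b.
       i > 0 \<and> j > 0 \<and> s > 0 \<and> H = monom 1 r * (C \<circ>\<^sub>p monom 1 s) \<and>
       \<alpha> \<noteq> 0 \<and> \<beta> \<noteq> 0 \<and> \<alpha> ^ s = 1 \<and> \<beta> ^ s = 1 \<and>
       F = smult \<alpha> (comp_pow H i) \<and> G = smult \<beta> (comp_pow H j)"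
    then obtain i j r s :: nat and C H :: "'b poly" and \<alpha> \<beta> :: 'b where *: "i > 0" "j > 0" "s > 0"
      "H = monom 1 r * (C \<circ>\<^sub>p monom 1 s)" "\<alpha> \<noteq> 0" "\<beta> \<noteq> 0" "\<alpha> ^ s = 1" "\<beta> ^ s = 1"
      "F = smult \<alpha> (comp_pow H i)" "G = smult \<beta> (comp_pow H j)" by blast
    have "degree (comp_pow H k) = degree H ^ k" for k
      by (induction k) (simp_all add: comp_pow_def degree_pcompose)
    then have mn: "degree H ^ i = m" "degree H ^ j = n" using * deg by auto
    have "degree H \<noteq> 0" using mn(1) deg(3) \<open>i > 0\<close> by (metis not_less_zero power_0_left less_not_refl2)
    moreover have "degree H \<noteq> 1" using mn(1) deg(3) by (metis less_irrefl power_one)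
    ultimately have "degree H > 1" by linarith
    from same_relations_iterates[OF *(4) this *(3,7,8), of i j]
    have "same_relations F G (monom \<alpha> m) (monom \<beta> n)" by (simp only: mn *(9,10))
    from this *(3,7,8) show thesis by (rule via)
  qed
qed

text \<open>
  For fitting the normalised coordinate, which fixes \<open>L\<close> only up to the scale \<open>b\<close>, to the Chebyshev
  polynomials.
\<close>

lemma rescale_conjugation:
  fixes L :: "'b::field poly"
  assumes L: "degree L = 1" and b: "b \<noteq> 0"
  shows "degree (L \<circ>\<^sub>p [:0, b:]) = 1"
    "comp_inv (L \<circ>\<^sub>p [:0, b:]) \<circ>\<^sub>p P \<circ>\<^sub>p (L \<circ>\<^sub>p [:0, b:]) = smult (inverse b) ((comp_inv L \<circ>\<^sub>p P \<circ>\<^sub>p L) \<circ>\<^sub>p [:0, b:])"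
proof -
  show "degree (L \<circ>\<^sub>p [:0, b:]) = 1" using L b by (simp add: degree_pcompose)
  note inv = comp_inv_degree_1[OF L]
  have lin: "[:0, b:] \<circ>\<^sub>p [:0, inverse b:] = [:0, 1:]" "[:0, inverse b:] \<circ>\<^sub>p [:0, b:] = [:0, 1:]"
    using b by (simp_all add: linear_pcompose)
  have "comp_inv (L \<circ>\<^sub>p [:0, b:]) = [:0, inverse b:] \<circ>\<^sub>p comp_inv L"
  proof (rule comp_inv_unique)
    have "(L \<circ>\<^sub>p [:0, b:]) \<circ>\<^sub>p ([:0, inverse b:] \<circ>\<^sub>p comp_inv L) = L \<circ>\<^sub>p ([:0, b:] \<circ>\<^sub>p [:0, inverse b:]) \<circ>\<^sub>p comp_inv L"
      by (simp only: pcompose_assoc)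
    then show "(L \<circ>\<^sub>p [:0, b:]) \<circ>\<^sub>p ([:0, inverse b:] \<circ>\<^sub>p comp_inv L) = [:0, 1:]"
      by (simp only: lin pcompose_idR inv)
    have "([:0, inverse b:] \<circ>\<^sub>p comp_inv L) \<circ>\<^sub>p (L \<circ>\<^sub>p [:0, b:]) = [:0, inverse b:] \<circ>\<^sub>p (comp_inv L \<circ>\<^sub>p L) \<circ>\<^sub>p [:0, b:]"
      by (simp only: pcompose_assoc)
    then show "([:0, inverse b:] \<circ>\<^sub>p comp_inv L) \<circ>\<^sub>p (L \<circ>\<^sub>p [:0, b:]) = [:0, 1:]"
      by (simp only: lin pcompose_idR inv)
  qed
  then show "comp_inv (L \<circ>\<^sub>p [:0, b:]) \<circ>\<^sub>p P \<circ>\<^sub>p (L \<circ>\<^sub>p [:0, b:]) = smult (inverse b) ((comp_inv L \<circ>\<^sub>p P \<circ>\<^sub>p L) \<circ>\<^sub>p [:0, b:])"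
    by (simp only: pcompose_assoc linear_pcompose pcompose_smult)
qed

text \<open>
  The three cases of the introduction, for the coordinate shared by \<open>F\<close> and \<open>G\<close>.
\<close>

theorem standard_form_of_relation:
  fixes F G :: "'b::alg_closed_field poly"
  assumes deg: "degree F = m" "degree G = n" "m > 1" "n > 1"
    and nz: "of_nat m \<noteq> (0::'b)" "of_nat n \<noteq> (0::'b)" and nf: "\<not> free_on_letters F G"
  obtains L where "degree L = 1" "standard_pair m n (comp_inv L \<circ>\<^sub>p F \<circ>\<^sub>p L) (comp_inv L \<circ>\<^sub>p G \<circ>\<^sub>p L)"
proof -
  obtain v w where vw: "comp_word F G v = comp_word F G w" "v \<noteq> w"
    using nf by (auto simp: free_on_letters_def inj_on_def)
  obtain a b where rel: "comp_word F G a \<circ>\<^sub>p F = comp_word F G b \<circ>\<^sub>p G"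
    using relation_of_equal_words[OF _ _ vw] deg by auto
  obtain y where y: "fls_subdegree y = -1" "ev y F = power_subst 1 m y"
    using Boettcher_exists[OF deg(1,3) nz(1)] by blast
  obtain \<gamma> where \<gamma>: "\<gamma> \<noteq> 0" "ev y G = power_subst \<gamma> n y"
    using common_Boettcher[OF deg nz y rel] by blast
  obtain L x where L: "degree L = 1" and x: "normalized_coordinate x"
    and trans: "\<And>P z M. z \<noteq> 0 \<Longrightarrow> M > 0 \<Longrightarrow> ev y P = power_subst z M y \<Longrightarrow>
       ev x (comp_inv L \<circ>\<^sub>p P \<circ>\<^sub>p L) = power_subst z M x"
    using normalize_coordinate[OF y(1)] by metis
  define F0 where "F0 = comp_inv L \<circ>\<^sub>p F \<circ>\<^sub>p L"
  define G0 where "G0 = comp_inv L \<circ>\<^sub>p G \<circ>\<^sub>p L"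
  interpret normalized_coordinate x by (rule x)
  have F0: "scales F0 1 m" and G0: "scales G0 \<gamma> n"
    using trans[OF _ _ y(2)] trans[OF \<gamma>(1) _ \<gamma>(2)] deg \<gamma>(1) by (simp_all add: scales_def F0_def G0_def)
  show thesis
  proof (cases "x = fls_X_inv")
    case True
    have F0m: "F0 = monom 1 m" and G0m: "G0 = monom (inverse \<gamma>) n"
      using scales_of_trivial_coordinate[OF True F0] scales_of_trivial_coordinate[OF True G0] by simp_all
    have "comp_word F0 G0 (a @ [LetterF]) = comp_word F0 G0 (b @ [LetterG])"
      using rel unfolding F0_def G0_def comp_word_conj[OF comp_inv_degree_1[OF L]] by (simp add: comp_word_snoc)
    then have "is_root_of_unity (inverse \<gamma>)"
      using root_of_unity_of_monomial_relation[of m n "inverse \<gamma>" a b] deg \<gamma>(1)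
      by (simp add: comp_word_snoc F0m G0m)
    then have "standard_pair m n F0 G0" using F0m G0m by (auto simp: standard_pair_def)
    then show thesis using that[OF L] by (simp add: F0_def G0_def)
  next
    case x1: False
    show thesis
    proof (cases "\<exists>i j. i > 0 \<and> j > 0 \<and> m ^ i = n ^ j")
      case True
      then obtain i j where ij: "i > 0" "j > 0" "n ^ j = m ^ i" by metis
      from iterates_of_commensurable_degrees[OF F0 G0 deg(3,4) ij(2,3) x1] have "standard_pair m n F0 G0"
        unfolding standard_pair_def by (intro disjI2) metis
      then show thesis using that[OF L] by (simp add: F0_def G0_def)
    next
      case False
      have close: close_pairs
        by (rule close_pairs_of_independent_degrees[OF F0 G0 deg(3,4) nz]) (use False in blast)
      from leading_terms_of_coordinate[OF close x1] show thesis
      proof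
        assume a: "(2::'b) \<noteq> 0 \<and> x $$ 1 \<noteq> 0"
        obtain b where b: "b\<^sup>2 = x $$ 1" using nth_root_exists[of 2 "x $$ 1"] by auto
        have b0: "b \<noteq> 0" using a b by auto
        have "\<exists>\<epsilon>\<in>{1, -1}. smult (inverse b) (P \<circ>\<^sub>p [:0, b:]) = smult \<epsilon> (chebyshev N)"
          if P: "scales P z N" "N > 1" "of_nat N \<noteq> (0::'b)" for P z N
        proof -
          have "smult ((of_nat N)\<^sup>2) (conic \<circ>\<^sub>p P) = (pderiv P)\<^sup>2 * conic"
            using conic_equation_char_0[OF close P] conic_equation_char_p[OF close P] a by metis
          then have "smult ((of_nat N)\<^sup>2) ([:- 4 * b\<^sup>2, 0, 1:] \<circ>\<^sub>p P) = (pderiv P)\<^sup>2 * [:- 4 * b\<^sup>2, 0, 1:]"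
            by (simp only: conic_def b)
          from chebyshev_of_pell_equation[OF degree_scales[OF P(1)] P(2,3) _ b0 this] a show ?thesis by metis
        qed
        from this[OF F0 deg(3) nz(1)] this[OF G0 deg(4) nz(2)]
        have "standard_pair m n (smult (inverse b) (F0 \<circ>\<^sub>p [:0, b:])) (smult (inverse b) (G0 \<circ>\<^sub>p [:0, b:]))"
          unfolding standard_pair_def by (intro disjI2 disjI1) metis
        then show thesis using that rescale_conjugation[OF L b0] by (simp only: F0_def G0_def)
      next
        assume "CHAR('b) = 2 \<and> (\<exists>\<psi>. x = fls_X_inv * \<psi>\<^sup>2 \<and> ord_ge 1 (\<psi> - 1) \<and> \<psi> $$ 1 \<noteq> 0)"
        then obtain \<psi> where coord: "CHAR('b) = 2" "x = fls_X_inv * \<psi>\<^sup>2" "ord_ge 1 (\<psi> - 1)" "\<psi> $$ 1 \<noteq> 0" by blast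
        have "char_2_coordinate x \<psi>"
          by (intro char_2_coordinate.intro char_2_coordinate_axioms.intro x; fact coord)
        then interpret char_2_coordinate x \<psi> .
        define b where "b = \<psi> $$ 1"
        have b0: "b \<noteq> 0" using coord(4) by (simp only: b_def not_False_eq_True)
        have cheb: "smult (inverse b) (P \<circ>\<^sub>p [:0, b:]) = chebyshev N"
          if P: "scales P z N" "N > 1" "of_nat N \<noteq> (0::'b)" for P z N
        proof -
          obtain R where R: "P = pCons 0 (R\<^sup>2)"
            "smult b (1 + R\<^sup>2) = pCons 0 (pCons 0 (pderiv R)) * (pCons 0 (pderiv R) + R)"
            using artin_schreier_equation[OF close P] unfolding b_def by blast
          have dP: "degree P = N" by (rule degree_scales[OF P(1)])
          then have "R \<noteq> 0" using P(2) R(1) by auto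
          from chebyshev_of_artin_schreier_equation[OF coord(1) b0 this R(2)] show ?thesis
            using R(1) dP by simp
        qed
        have "standard_pair m n (smult (inverse b) (F0 \<circ>\<^sub>p [:0, b:])) (smult (inverse b) (G0 \<circ>\<^sub>p [:0, b:]))"
          unfolding standard_pair_def cheb[OF F0 deg(3) nz(1)] cheb[OF G0 deg(4) nz(2)]
          by (intro disjI2 disjI1 bexI[of _ 1]) simp_all
        then show thesis using that rescale_conjugation[OF L b0] by (simp only: F0_def G0_def)
      qed
    qed
  qed
qed

unbundle no fps_syntax

theorem theorem1p4:
  fixes F G :: "'a::alg_closed_field poly" and m n :: nat
  assumes "degree F = m" and "degree G = n" and "m > 1" and "n > 1"
    and "\<not> CHAR('a) dvd m * n"
  shows
    "(\<not> free_on_letters F G \<longleftrightarrow>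
        (\<exists>\<gamma>::'a. is_root_of_unity \<gamma> \<and> (\<exists>\<phi>.
           comp_semigroup_iso \<phi> (comp_semigroup F G)
             (comp_semigroup (monom 1 m) (monom \<gamma> n)) \<and>
           \<phi> F = monom 1 m \<and> \<phi> G = monom \<gamma> n))) \<and>
     (\<not> free_on_letters F G \<longleftrightarrow>
        (\<exists>L F' G' :: 'a poly. degree L = 1 \<and>
           F' = comp_inv L \<circ>\<^sub>p F \<circ>\<^sub>p L \<and> G' = comp_inv L \<circ>\<^sub>p G \<circ>\<^sub>p L \<and>
           ((\<exists>\<alpha>. is_root_of_unity \<alpha> \<and> F' = monom 1 m \<and> G' = monom \<alpha> n) \<or>
            (\<exists>\<alpha>\<in>{1, -1}. \<exists>\<beta>\<in>{1, -1}.
               F' = smult \<alpha> (chebyshev m) \<and> G' = smult \<beta> (chebyshev n)) \<or>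
            (\<exists>i j r s :: nat. \<exists>C H :: 'a poly. \<exists>\<alpha> \<beta> :: 'a.
               i > 0 \<and> j > 0 \<and> s > 0 \<and>
               H = monom 1 r * (C \<circ>\<^sub>p monom 1 s) \<and>
               \<alpha> \<noteq> 0 \<and> \<beta> \<noteq> 0 \<and> \<alpha> ^ s = 1 \<and> \<beta> ^ s = 1 \<and>
               F' = smult \<alpha> (comp_pow H i) \<and> G' = smult \<beta> (comp_pow H j)))))"
  (is "(?a \<longleftrightarrow> ?b) \<and> (_ \<longleftrightarrow> ?c)")
proof -
  note deg = assms(1-4)
  have nz: "of_nat m \<noteq> (0::'a)" "of_nat n \<noteq> (0::'a)"
    using assms(5) by (auto simp: of_nat_eq_0_iff_char_dvd)
  have c: "?c \<longleftrightarrow> (\<exists>L. degree L = 1 \<and> standard_pair m n (comp_inv L \<circ>\<^sub>p F \<circ>\<^sub>p L) (comp_inv L \<circ>\<^sub>p G \<circ>\<^sub>p L))"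
    unfolding standard_pair_def by simp
  have "?a \<Longrightarrow> ?c" unfolding c using standard_form_of_relation[OF deg nz] by metis
  moreover have "?c \<Longrightarrow> ?b"
  proof -
    assume ?c
    then obtain L where L: "degree L = 1" and st: "standard_pair m n (comp_inv L \<circ>\<^sub>p F \<circ>\<^sub>p L) (comp_inv L \<circ>\<^sub>p G \<circ>\<^sub>p L)"
      unfolding c by blast
    note inv = comp_inv_degree_1[OF L]
    have "degree (comp_inv L) = 1"
      using degree_pcompose[of L "comp_inv L"] L by (simp add: inv)
    then have "degree (comp_inv L \<circ>\<^sub>p F \<circ>\<^sub>p L) = m" "degree (comp_inv L \<circ>\<^sub>p G \<circ>\<^sub>p L) = n"
      using deg L by (simp_all add: degree_pcompose)
    from same_relations_of_standard_pair[OF this deg(3,4) st] obtain \<gamma> :: 'a where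
      \<gamma>: "is_root_of_unity \<gamma>" "same_relations (comp_inv L \<circ>\<^sub>p F \<circ>\<^sub>p L) (comp_inv L \<circ>\<^sub>p G \<circ>\<^sub>p L) (monom 1 m) (monom \<gamma> n)" by metis
    have "same_relations F G (monom 1 m) (monom \<gamma> n)"
      by (rule same_relations_trans[OF same_relations_conj[OF inv] \<gamma>(2)])
    from iso_of_same_relations[OF this] show ?b using \<gamma>(1) by metis
  qed
  moreover have "?b \<Longrightarrow> ?a" using not_free_of_iso not_free_monomials by metis
  ultimately show ?thesis by argo
qed

end
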